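(* Let $\mathbb{F}$ be an infinite field of characteristic $2$ and let $m$ be a positive integer. Then the following set is a minimal homogeneous generating system of the $\mathbb{F}$-algebra $\mathcal{O}((\mathbb{F}^{2\times 2})^m)^{SL_2\times SL_2}$: \[\{\det(x_k),\ \langle x_l\vert x_r\rangle,\ \xi_q(x_{k_1},\dots,x_{k_{2q}}) \mid k=1,\dots,m;\ 1\le l<r\le m;\ 2\le q\le \tfrac m2;\ 1\le k_1<\cdots<k_{2q}\le m\}.\]
   Context: The group $SL_2\times SL_2$ (two copies of the special linear group over $\mathbb{F}$) acts on the space $(\mathbb{F}^{2\times 2})^m$ of $m$-tuples of $2\times 2$ matrices by $(g,h)\cdot(A_1,\dots,A_m)=(gA_1h^{-1},\dots,gA_mh^{-1})$. $\mathcal{O}((\mathbb{F}^{2\times 2})^m)=\mathbb{F}[x_{ijk}\mid 1\le i,j\le 2,\ 1\le k\le m]$ is the polynomial algebra, where $x_{ijk}$ is the function sending $(A_1,\dots,A_m)$ to the $(i,j)$-entry of $A_k$; it is graded with every $x_{ijk}$ of degree $1$. $\mathcal{O}((\mathbb{F}^{2\times 2})^m)^{SL_2\times SL_2}$ is the graded subalgebra of polynomial functions that are constant on $SL_2\times SL_2$-orbits. $x_k=(x_{ijk})_{i,j=1}^2$ is the $k$-th generic matrix. $\langle x_k\vert x_l\rangle$ is the coefficient of $zw$ in $\det(zx_k+wx_l)$ ($z,w$ commuting variables), i.e. $\langle x_k\vert x_l\rangle=x_{11k}x_{22l}+x_{11l}x_{22k}-x_{12k}x_{21l}-x_{12l}x_{21k}$.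 For $q\ge 2$ and $2\times 2$ matrices $y_1,\dots,y_{2q}$ over a commutative ring $A$, $\xi_q(y_1,\dots,y_{2q})\in A$ is the coefficient of $z_1\cdots z_qw_1\cdots w_q$ in the determinant of the $2q\times 2q$ matrix over $A[z_1,\dots,z_q,w_1,\dots,w_q]$ which, as a $q\times q$ block matrix with $2\times 2$ blocks, has $z_ry_r$ in position $(r,r)$ for $1\le r\le q$, $w_ry_{q+r}$ in position $(r,r+1)$ for $1\le r\le q-1$, $w_qy_{2q}$ in position $(q,1)$, and zero blocks elsewhere. A minimal homogeneous generating system is a set of homogeneous elements that generates the algebra and no proper subset of which generates it. *)

theory Defs
  imports
    Jordan_Normal_Form.Matrix
    Jordan_Normal_Form.Determinant
    "HOL-Library.Poly_Mapping"
begin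

section \<open>Polynomials\<close>

text \<open>
  A monomial over the variables \<open>'v\<close> is a finitely supported exponent function, and a polynomial
  is a finitely supported function from monomials to coefficients; its ring structure (convolution
  product) is that of \<^theory>\<open>HOL-Library.Poly_Mapping\<close>.
\<close>

type_synonym ('v, 'a) mpoly = "('v \<Rightarrow>\<^sub>0 nat) \<Rightarrow>\<^sub>0 'a"

definition Const :: "'a::comm_ring_1 \<Rightarrow> ('v, 'a) mpoly" where
  "Const c = Poly_Mapping.single 0 c"

definition Var :: "'v \<Rightarrow> ('v, 'a::comm_ring_1) mpoly" where
  "Var v = Poly_Mapping.single (Poly_Mapping.single v 1) 1"

definition mpoly_eval :: "('v \<Rightarrow> 'a::comm_ring_1) \<Rightarrow> ('v, 'a) mpoly \<Rightarrow> 'a" where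
  "mpoly_eval f p =
     (\<Sum>t\<in>Poly_Mapping.keys p. Poly_Mapping.lookup p t *
        (\<Prod>v\<in>Poly_Mapping.keys t. f v ^ Poly_Mapping.lookup t v))"

definition homogeneous :: "('v, 'a::comm_ring_1) mpoly \<Rightarrow> bool" where
  "homogeneous p \<longleftrightarrow>
     (\<exists>d. \<forall>t\<in>Poly_Mapping.keys p. (\<Sum>v\<in>Poly_Mapping.keys t. Poly_Mapping.lookup t v) = d)"

definition is_subalgebra :: "('v, 'a::comm_ring_1) mpoly set \<Rightarrow> bool" where
  "is_subalgebra B \<longleftrightarrow>
     (\<forall>c. Const c \<in> B) \<and> (\<forall>p\<in>B. \<forall>q\<in>B. p + q \<in> B) \<and> (\<forall>p\<in>B. \<forall>q\<in>B. p * q \<in> B)"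

definition minimal_homogeneous_generating_system ::
    "('v, 'a::comm_ring_1) mpoly set \<Rightarrow> ('v, 'a) mpoly set \<Rightarrow> bool" where
  "minimal_homogeneous_generating_system R S \<longleftrightarrow>
     (\<forall>p\<in>S. homogeneous p) \<and> is_subalgebra hull S = R \<and>
     (\<forall>T. T \<subset> S \<longrightarrow> is_subalgebra hull T \<noteq> R)"


section \<open>The action of \<open>SL\<^sub>2 \<times> SL\<^sub>2\<close> on tuples of matrices and its invariants\<close>

text \<open>
  The variable \<open>x\<^sub>i\<^sub>j\<^sub>k\<close> is indexed by a triple \<open>(i, j, k)\<close>. Following the convention for matrix
  entries, rows and columns are counted from 0, so \<open>i, j \<in> {0, 1}\<close>; the matrices of a tuple are
  numbered \<open>1, \<dots>, m\<close>.
\<close>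

type_synonym 'a xpoly = "(nat \<times> nat \<times> nat, 'a) mpoly"

definition coord_ring :: "nat \<Rightarrow> 'a::comm_ring_1 xpoly set" where
  "coord_ring m = {p. \<forall>t\<in>Poly_Mapping.keys p. Poly_Mapping.keys t \<subseteq> {0..<2} \<times> {0..<2} \<times> {1..m}}"

definition eval_at :: "(nat \<Rightarrow> 'a::comm_ring_1 mat) \<Rightarrow> 'a xpoly \<Rightarrow> 'a" where
  "eval_at A p = mpoly_eval (\<lambda>(i, j, k). A k $$ (i, j)) p"

definition SL2 :: "'a::field mat set" where
  "SL2 = {g \<in> carrier_mat 2 2. det g = 1}"

definition act :: "'a::field mat \<Rightarrow> 'a mat \<Rightarrow> (nat \<Rightarrow> 'a mat) \<Rightarrow> nat \<Rightarrow> 'a mat" where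
  "act g h A k = g * A k * inv\<^bsub>ring_mat TYPE('a) 2 ()\<^esub> h"

definition invariants :: "nat \<Rightarrow> 'a::field xpoly set" where
  "invariants m = {p \<in> coord_ring m.
     \<forall>g\<in>SL2. \<forall>h\<in>SL2. \<forall>A. (\<forall>k\<in>{1..m}. A k \<in> carrier_mat 2 2) \<longrightarrow>
       eval_at (act g h A) p = eval_at A p}"


section \<open>The generators\<close>

definition generic_matrix :: "nat \<Rightarrow> 'a::comm_ring_1 xpoly mat" where
  "generic_matrix k = mat 2 2 (\<lambda>(i, j). Var (i, j, k))"

text \<open>
  For the auxiliary variables \<open>z\<^sub>r\<close> and \<open>w\<^sub>r\<close> we use the index type \<^typ>\<open>nat + nat\<close>; a single pair
  \<open>z, w\<close> is \<open>z\<^sub>1, w\<^sub>1\<close>.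
\<close>

abbreviation z_var :: "nat \<Rightarrow> (nat + nat, 'a::comm_ring_1) mpoly" where
  "z_var r \<equiv> Var (Inl r)"

abbreviation w_var :: "nat \<Rightarrow> (nat + nat, 'a::comm_ring_1) mpoly" where
  "w_var r \<equiv> Var (Inr r)"

definition zw_monomial :: "nat \<Rightarrow> (nat + nat) \<Rightarrow>\<^sub>0 nat" where
  "zw_monomial q = (\<Sum>r=1..q. Poly_Mapping.single (Inl r) 1 + Poly_Mapping.single (Inr r) 1)"

definition bracket :: "'a::comm_ring_1 mat \<Rightarrow> 'a mat \<Rightarrow> 'a" where
  "bracket x y =
     Poly_Mapping.lookup
       (det (z_var 1 \<cdot>\<^sub>m map_mat Const x + w_var 1 \<cdot>\<^sub>m map_mat Const y))
       (zw_monomial 1)"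

text \<open>Block positions \<open>(r, s)\<close> are counted from 1.\<close>

definition xi_block ::
    "nat \<Rightarrow> (nat \<Rightarrow> 'a::comm_ring_1 mat) \<Rightarrow> nat \<Rightarrow> nat \<Rightarrow> (nat + nat, 'a) mpoly mat" where
  "xi_block q y r s =
     (if s = r then z_var r \<cdot>\<^sub>m map_mat Const (y r)
      else if s = r + 1 then w_var r \<cdot>\<^sub>m map_mat Const (y (q + r))
      else if r = q \<and> s = 1 then w_var q \<cdot>\<^sub>m map_mat Const (y (2 * q))
      else 0\<^sub>m 2 2)"

definition xi_matrix :: "nat \<Rightarrow> (nat \<Rightarrow> 'a::comm_ring_1 mat) \<Rightarrow> (nat + nat, 'a) mpoly mat" where
  "xi_matrix q y =
     mat (2 * q) (2 * q)
       (\<lambda>(i, j). xi_block q y (i div 2 + 1) (j div 2 + 1) $$ (i mod 2, j mod 2))"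

definition xi :: "nat \<Rightarrow> (nat \<Rightarrow> 'a::comm_ring_1 mat) \<Rightarrow> 'a" where
  "xi q y = Poly_Mapping.lookup (det (xi_matrix q y)) (zw_monomial q)"

definition generators :: "nat \<Rightarrow> 'a::comm_ring_1 xpoly set" where
  "generators m =
     {det (generic_matrix k) | k. k \<in> {1..m}} \<union>
     {bracket (generic_matrix l) (generic_matrix r) | l r. 1 \<le> l \<and> l < r \<and> r \<le> m} \<union>
     {xi q (\<lambda>s. generic_matrix (\<kappa> s)) | q \<kappa>.
        2 \<le> q \<and> 2 * q \<le> m \<and> strict_mono_on {1..2 * q} \<kappa> \<and> \<kappa> ` {1..2 * q} \<subseteq> {1..m}}"

end

theory Submission
  imports Defs
begin

text \<open>
  Over an infinite field a polynomial is determined by its values, so the algebra of invariants can be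
  studied as an algebra of polynomial functions. Write \<open>x\<^sup>*\<close> for the adjugate of a
  \<open>2 \<times> 2\<close> matrix. The proof first shows, over every infinite field, that the invariants
  are generated by the determinants \<open>det x\<^sub>k\<close> and the traces
  \<open>tr (x\<^sub>1 x\<^sub>2\<^sup>* x\<^sub>3 x\<^sub>4\<^sup>* \<dots>)\<close> of alternating words
  of even length whose letters increase strictly. Characteristic 2 enters only when the traces are
  exchanged for the \<open>\<xi>\<^sub>q\<close>.

  Everything rests on one divisibility: a polynomial function that vanishes whenever
  \<open>a d = b c\<close> is a multiple of \<open>a d - b c\<close> (\<open>polyfun_det_dvd\<close>). Let
  \<open>f\<close> be a multihomogeneous invariant of vectors in the plane under \<open>SL\<^sub>2\<close>.
  Setting one vector equal to another leaves an invariant of fewer vectors, by induction a combination of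
  products of \<open>2 \<times> 2\<close> minors, and relabelling some of the indices lifts this
  combination back. The difference vanishes on proportional pairs, hence is divisible by the minor of that
  pair, and the quotient is an invariant of smaller degree (\<open>vector_invariants\<close>). The two
  groups act on two families of vectors, and both are treated at once.

  The same induction works for matrices (\<open>mixed_invariants\<close>). Substituting a rank one matrix
  \<open>u v\<^sup>T\<close> for \<open>x\<^sub>k\<close> leaves an invariant with one matrix less and two
  vectors more; if this restriction agrees with that of an element of the algebra of determinants and
  traces, the difference is \<open>det x\<^sub>k\<close> times an invariant of smaller degree. When all
  matrices have been replaced, the vector case gives products of minors of the \<open>u\<^sub>k\<close> and
  of the \<open>v\<^sub>k\<close> in which \<open>u\<^sub>k\<close> and \<open>v\<^sub>k\<close> occur
  equally often; following them alternately one walks along closed cycles, and each cycle is the value of a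
  trace of an alternating word at rank one matrices (\<open>minor_mono_glue_aux\<close>). The relations
  \<open>x y\<^sup>* + y x\<^sup>* = \<langle>x|y\<rangle>\<close> and \<open>x x\<^sup>* = det x\<close>
  sort the words and remove repeated letters (\<open>graded_alg_trace_word\<close>).

  In characteristic 2 look at the point \<open>P\<close> where \<open>x\<^sub>k\<close> is the matrix unit
  \<open>E\<^sub>2\<^sub>2\<close> and all other matrices are the identity. The trace of a word without
  repeated letters is 1 at \<open>P\<close> if \<open>k\<close> occurs in the word, and
  \<open>tr 1 = 2 = 0\<close> if not. A multilinear product of two invariants of positive degree has a
  factor that does not involve \<open>x\<^sub>k\<close>, so it vanishes at \<open>P\<close>. Now
  \<open>\<xi>\<^sub>q\<close> is a multilinear invariant, hence a scalar multiple of the trace of its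
  sorted word plus such products, and its value at \<open>P\<close> is 1 for the first letter
  \<open>k\<close> (\<open>xi_special\<close>). So the scalar is 1 and the trace can be replaced by
  \<open>\<xi>\<^sub>q\<close> (\<open>trace_word_in_H\<close>).

  For minimality, let \<open>K\<close> be the set of indices occurring in a bracket or in a
  \<open>\<xi>\<^sub>q\<close>, and \<open>k\<close> its least element. Multiply the matrices of
  \<open>P\<close> by independent parameters \<open>t\<^sub>l\<close>, \<open>l \<in> K\<close>, and set
  the matrices outside \<open>K\<close> to zero. Then this generator becomes the product of all
  \<open>t\<^sub>l\<close>. The others become zero, an even power \<open>t\<^sub>l\<^sup>2\<close> with
  \<open>l \<noteq> k\<close>, or a product of \<open>t\<^sub>k\<close> with fewer parameters, and a
  polynomial in these never contains the product of all \<open>t\<^sub>l\<close>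
  (\<open>generators_irredundant\<close>). A determinant is irredundant because all other generators vanish
  where its matrix is the only nonzero one.
\<close>

section \<open>Polynomial functions over an infinite field\<close>

inductive_set polyfun :: "'v set \<Rightarrow> (('v \<Rightarrow> 'a::comm_ring_1) \<Rightarrow> 'a) set" for S where
  const: "(\<lambda>X. c) \<in> polyfun S"
| var: "v \<in> S \<Longrightarrow> (\<lambda>X. X v) \<in> polyfun S"
| add: "f \<in> polyfun S \<Longrightarrow> g \<in> polyfun S \<Longrightarrow> (\<lambda>X. f X + g X) \<in> polyfun S"
| mult: "f \<in> polyfun S \<Longrightarrow> g \<in> polyfun S \<Longrightarrow> (\<lambda>X. f X * g X) \<in> polyfun S"

lemma polyfun_uminus: "f \<in> polyfun S \<Longrightarrow> (\<lambda>X. - f X) \<in> polyfun S"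
  using polyfun.mult[OF polyfun.const[of "-1"], of f S] by simp

lemma polyfun_diff: "f \<in> polyfun S \<Longrightarrow> g \<in> polyfun S \<Longrightarrow> (\<lambda>X. f X - g X) \<in> polyfun S"
  using polyfun.add[OF _ polyfun_uminus, of f S g] by simp

lemma polyfun_power: "f \<in> polyfun S \<Longrightarrow> (\<lambda>X. f X ^ n) \<in> polyfun S"
  by (induction n) (auto intro: polyfun.intros)

lemma polyfun_sum: "(\<And>i. i \<in> I \<Longrightarrow> f i \<in> polyfun S) \<Longrightarrow> (\<lambda>X. \<Sum>i\<in>I. f i X) \<in> polyfun S"
  by (induction I rule: infinite_finite_induct) (auto intro: polyfun.intros)

lemma polyfun_prod: "(\<And>i. i \<in> I \<Longrightarrow> f i \<in> polyfun S) \<Longrightarrow> (\<lambda>X. \<Prod>i\<in>I. f i X) \<in> polyfun S"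
  by (induction I rule: infinite_finite_induct) (auto intro: polyfun.intros)

lemma polyfun_if:
  "(P \<Longrightarrow> f \<in> polyfun S) \<Longrightarrow> (\<not> P \<Longrightarrow> g \<in> polyfun S) \<Longrightarrow> (\<lambda>X. if P then f X else g X) \<in> polyfun S"
  by (cases P) simp_all

lemmas polyfun_intros = polyfun.intros polyfun_if polyfun_uminus polyfun_diff polyfun_power

lemma polyfun_compose:
  assumes "f \<in> polyfun S" and "\<And>v. v \<in> S \<Longrightarrow> (\<lambda>X. M X v) \<in> polyfun S'"
  shows "(\<lambda>X. f (M X)) \<in> polyfun S'"
  using assms by (induction rule: polyfun.induct) (auto intro: polyfun.intros)

lemma polyfun_cong:
  assumes "f \<in> polyfun S" and "\<And>v. v \<in> S \<Longrightarrow> X v = Y v"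
  shows "f X = f Y"
  using assms by (induction rule: polyfun.induct) auto

text \<open>
  Setting the variables outside \<open>S'\<close> to zero turns a function that does not depend on them
  into a polynomial function of the remaining ones.
\<close>

lemma polyfun_restrict:
  assumes "f \<in> polyfun S" and "\<And>X Y. (\<And>v. v \<in> S' \<Longrightarrow> X v = Y v) \<Longrightarrow> f X = f Y"
  shows "f \<in> polyfun S'"
proof -
  have "(\<lambda>X. f (\<lambda>v. if v \<in> S' then X v else 0)) \<in> polyfun S'"
    by (rule polyfun_compose[OF assms(1)]) (auto intro!: polyfun_intros)
  moreover have "(\<lambda>X. f (\<lambda>v. if v \<in> S' then X v else 0)) = f"
    by (rule ext, rule assms(2)) simp
  ultimately show ?thesis by simp
qed

lemma polyfun_curve:
  assumes "f \<in> polyfun S" and "\<And>v. v \<in> S \<Longrightarrow> \<exists>p. \<forall>t. M t v = poly p t"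
  shows "\<exists>p. \<forall>t. f (M t) = poly p t"
  using assms
proof (induction rule: polyfun.induct)
  case (const c)
  show ?case by (rule exI[of _ "[:c:]"]) simp
next
  case (add f g)
  then obtain p q where "\<forall>t. f (M t) = poly p t" "\<forall>t. g (M t) = poly q t" by metis
  then show ?case by (intro exI[of _ "p + q"]) simp
next
  case (mult f g)
  then obtain p q where "\<forall>t. f (M t) = poly p t" "\<forall>t. g (M t) = poly q t" by metis
  then show ?case by (intro exI[of _ "p * q"]) simp
qed auto

lemma polyfun_update_diff:
  assumes "f \<in> polyfun S" and "s \<in> polyfun S" and "t \<in> polyfun S"
  shows "\<exists>h\<in>polyfun S. \<forall>X. f (X(v := s X)) - f (X(v := t X)) = (s X - t X) * h X"
  using assms
proof (induction rule: polyfun.induct)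
  case (const c)
  show ?case by (rule bexI[of _ "\<lambda>X. 0"]) (auto intro: polyfun.intros)
next
  case (var w)
  show ?case
    by (rule bexI[of _ "\<lambda>X. if w = v then 1 else 0"]) (auto intro: polyfun.intros)
next
  case (add f g)
  then obtain h k where hk: "h \<in> polyfun S" "k \<in> polyfun S"
    "\<forall>X. f (X(v := s X)) - f (X(v := t X)) = (s X - t X) * h X"
    "\<forall>X. g (X(v := s X)) - g (X(v := t X)) = (s X - t X) * k X" by blast
  have "f (X(v := s X)) + g (X(v := s X)) - (f (X(v := t X)) + g (X(v := t X)))
      = (s X - t X) * (h X + k X)" for X
    using hk(3)[rule_format, of X] hk(4)[rule_format, of X] by (simp add: algebra_simps)
  then show ?case by (intro bexI[of _ "\<lambda>X. h X + k X"]) (auto intro: polyfun.intros hk simp: fun_upd_def)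
next
  case (mult f g)
  then obtain h k where hk: "h \<in> polyfun S" "k \<in> polyfun S"
    "\<forall>X. f (X(v := s X)) - f (X(v := t X)) = (s X - t X) * h X"
    "\<forall>X. g (X(v := s X)) - g (X(v := t X)) = (s X - t X) * k X" by blast
  have "f (X(v := s X)) * g (X(v := s X)) - f (X(v := t X)) * g (X(v := t X))
      = (s X - t X) * (h X * g (X(v := s X)) + f (X(v := t X)) * k X)" for X
  proof -
    have "f (X(v := s X)) * g (X(v := s X)) - f (X(v := t X)) * g (X(v := t X))
      = (f (X(v := s X)) - f (X(v := t X))) * g (X(v := s X))
        + f (X(v := t X)) * (g (X(v := s X)) - g (X(v := t X)))" by (simp add: algebra_simps)
    then show ?thesis using hk by (simp add: algebra_simps)
  qed
  moreover have "(\<lambda>X. g (X(v := s X))) \<in> polyfun S" "(\<lambda>X. f (X(v := t X))) \<in> polyfun S"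
    by (rule polyfun_compose[OF mult.hyps(2)], use mult.prems in \<open>auto intro!: polyfun_intros simp: fun_upd_def\<close>)
       (rule polyfun_compose[OF mult.hyps(1)], use mult.prems in \<open>auto intro!: polyfun_intros simp: fun_upd_def\<close>)
  ultimately show ?case
    by (intro bexI[of _ "\<lambda>X. h X * g (X(v := s X)) + f (X(v := t X)) * k X"] polyfun_intros hk)
       (auto simp: fun_upd_def)
qed

text \<open>
  For \<open>X a \<noteq> 0\<close> the right-hand side gives access to the value of \<open>f\<close> at
  \<open>X d = s / X a\<close> without a division: it equals \<open>F\<close> at \<open>X d = s\<close> up
  to a power of \<open>X a\<close>.
\<close>

lemma polyfun_clear_denominator:
  assumes "f \<in> polyfun S" and "a \<in> S" "d \<in> S" "a \<noteq> d"
  shows "\<exists>n. \<exists>F\<in>polyfun S. \<forall>X. X a ^ n * f X = F (X(d := X a * X d))"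
  using assms
proof (induction rule: polyfun.induct)
  case (const c)
  show ?case by (rule exI[of _ 0], rule bexI[of _ "\<lambda>X. c"]) (auto intro: polyfun.intros)
next
  case (var w)
  show ?case
  proof (cases "w = d")
    case True
    then show ?thesis using var
      by (intro exI[of _ 1] bexI[of _ "\<lambda>X. X d"]) (auto intro: polyfun.intros)
  next
    case False
    then show ?thesis using var
      by (intro exI[of _ 0] bexI[of _ "\<lambda>X. X w"]) (auto intro: polyfun.intros)
  qed
next
  case (add f g)
  then obtain n F m G where hk: "F \<in> polyfun S" "G \<in> polyfun S"
    "\<forall>X. X a ^ n * f X = F (X(d := X a * X d))"
    "\<forall>X. X a ^ m * g X = G (X(d := X a * X d))" by blast
  have "X a ^ (n + m) * (f X + g X) = X a ^ m * (X a ^ n * f X) + X a ^ n * (X a ^ m * g X)"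
    for X by (simp add: algebra_simps power_add)
  then show ?case using hk assms
    by (intro exI[of _ "n + m"] bexI[of _ "\<lambda>X. X a ^ m * F X + X a ^ n * G X"])
       (auto intro!: polyfun_intros simp: fun_upd_def)
next
  case (mult f g)
  then obtain n F m G where hk: "F \<in> polyfun S" "G \<in> polyfun S"
    "\<forall>X. X a ^ n * f X = F (X(d := X a * X d))"
    "\<forall>X. X a ^ m * g X = G (X(d := X a * X d))" by blast
  have "X a ^ (n + m) * (f X * g X) = (X a ^ n * f X) * (X a ^ m * g X)"
    for X by (simp add: algebra_simps power_add)
  then show ?case using hk assms
    by (intro exI[of _ "n + m"] bexI[of _ "\<lambda>X. F X * G X"])
       (auto intro!: polyfun_intros simp: fun_upd_def)
qed

text \<open>
  Infinitude is an assumption on a type variable of sort \<open>field\<close>, so it is carried by a locale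
  that can be interpreted inside a proof.
\<close>

locale infinite_field =
  fixes ty :: "'a::field itself"
  assumes infinite_field: "infinite (UNIV :: 'a set)"
begin

lemma poly_nonroot:
  assumes "(p :: 'a poly) \<noteq> 0" and "finite A"
  shows "\<exists>t. t \<notin> A \<and> poly p t \<noteq> 0"
  using infinite_field poly_roots_finite[OF assms(1)] assms(2) ex_new_if_finite[of "A \<union> {t. poly p t = 0}"]
  by auto

lemma poly_eq_cofinite:
  assumes "\<And>t. t \<notin> A \<Longrightarrow> poly p t = poly q (t :: 'a)" and "finite A"
  shows "p = q"
  using poly_nonroot[of "p - q" A] assms by auto

text \<open>
  If \<open>f\<close> is nonzero at \<open>X\<close> and \<open>g\<close> is nonzero at \<open>Y\<close>,
  both restrict to nonzero polynomials in one parameter on the line through \<open>X\<close> and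
  \<open>Y\<close>, and the product of these has a nonroot.
\<close>

lemma polyfun_mult_eq_0:
  fixes f g :: "('v \<Rightarrow> 'a) \<Rightarrow> 'a"
  assumes f: "f \<in> polyfun S" and g: "g \<in> polyfun S'"
    and fg: "\<And>X. f X * g X = 0" and X: "f X \<noteq> 0"
  shows "g Y = 0"
proof (rule ccontr)
  assume Y: "g Y \<noteq> 0"
  define M where "M = (\<lambda>t v. X v + t * (Y v - X v))"
  have M: "\<exists>p. \<forall>t. M t v = poly p t" for v
    by (rule exI[of _ "[:X v, Y v - X v:]"]) (simp add: M_def)
  obtain p where p: "\<forall>t. f (M t) = poly p t" using polyfun_curve[OF f, of M] M by auto
  obtain q where q: "\<forall>t. g (M t) = poly q t" using polyfun_curve[OF g, of M] M by auto
  have "M 0 = X" "M 1 = Y" by (auto simp: M_def)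
  then have "poly p 0 \<noteq> 0" "poly q 1 \<noteq> 0" using X Y p q by metis+
  then have "p * q \<noteq> 0" by auto
  then obtain t where "poly (p * q) t \<noteq> 0" using poly_nonroot[of "p * q" "{}"] by auto
  then show False using fg[of "M t"] p q by simp
qed

lemma polyfun_cancel:
  fixes f g h :: "('v \<Rightarrow> 'a) \<Rightarrow> 'a"
  assumes "f \<in> polyfun S" "g \<in> polyfun S'" "h \<in> polyfun S'"
    and "\<And>X. f X * g X = f X * h X" and "f X \<noteq> 0"
  shows "g Y = h Y"
  using polyfun_mult_eq_0[OF assms(1) polyfun_diff[OF assms(2,3)] _ assms(5), of Y] assms(4)
  by (simp add: algebra_simps)

text \<open>
  Both sides are polynomials in \<open>t\<close>, so an identity for \<open>t \<noteq> 0\<close> persists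
  at \<open>t = 0\<close>.
\<close>

lemma polyfun_curve_eq:
  fixes f g :: "('v \<Rightarrow> 'a) \<Rightarrow> 'a"
  assumes "f \<in> polyfun S" "g \<in> polyfun S"
    and M: "\<And>v. \<exists>p. \<forall>t. M t v = poly p t"
    and eq: "\<And>t. t \<noteq> 0 \<Longrightarrow> t ^ i * f (M t) = t ^ j * g (N t)"
    and N: "\<And>v. \<exists>p. \<forall>t. N t v = poly p t"
  shows "t ^ i * f (M t) = t ^ j * g (N t)"
proof -
  obtain p where p: "\<forall>t. f (M t) = poly p t" using polyfun_curve[OF assms(1), of M] M by auto
  obtain q where q: "\<forall>t. g (N t) = poly q t" using polyfun_curve[OF assms(2), of N] N by auto
  have "monom 1 i * p = monom 1 j * q"
    by (rule poly_eq_cofinite[of "{0}"]) (use p q eq in \<open>auto simp: poly_monom\<close>)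
  then show ?thesis using p q by (metis poly_mult poly_monom mult_1)
qed

text \<open>
  Multiply \<open>f\<close> by a power of \<open>X a\<close> so that it becomes a polynomial
  \<open>F\<close> in \<open>X a * X d\<close>. Replacing \<open>X a * X d\<close> by
  \<open>X b * X c\<close> changes \<open>F\<close> by a multiple of the determinant and makes it vanish,
  so \<open>X a ^ n * f\<close> is a multiple of the determinant. The powers of \<open>X a\<close> are then
  cancelled one at a time, because the determinant does not vanish identically on \<open>X a = 0\<close>.

  The hypothesis is restricted to points with \<open>X a \<noteq> 0\<close> because these are easy to
  parametrise: the second row is a multiple of the first.
\<close>

lemma polyfun_det_dvd:
  fixes f :: "('v \<Rightarrow> 'a) \<Rightarrow> 'a"
  assumes f: "f \<in> polyfun S" and S: "a \<in> S" "b \<in> S" "c \<in> S" "d \<in> S"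
    and neq: "distinct [a, b, c, d]"
    and van: "\<And>X. X a \<noteq> 0 \<Longrightarrow> X a * X d = X b * X c \<Longrightarrow> f X = 0"
  shows "\<exists>h\<in>polyfun S. \<forall>X. f X = (X a * X d - X b * X c) * h X"
proof -
  note I = polyfun_intros
  \<comment> \<open>\<open>F\<close> is \<open>X a ^ n * f\<close> as a function of the product \<open>X a * X d\<close>\<close>
  obtain n F where F: "F \<in> polyfun S" and nF: "\<And>X. X a ^ n * f X = F (X(d := X a * X d))"
    using polyfun_clear_denominator[OF f S(1,4)] neq by auto
  have "(\<lambda>X. X a * X d) \<in> polyfun S" "(\<lambda>X. X b * X c) \<in> polyfun S"
    using S by (auto intro!: I simp: fun_upd_def)
  from polyfun_update_diff[OF F this, of d]
  obtain H where H: "H \<in> polyfun S"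
    and FH: "\<And>X. F (X(d := X a * X d)) - F (X(d := X b * X c)) = (X a * X d - X b * X c) * H X"
    by auto
  have G: "(\<lambda>X. F (X(d := X b * X c))) \<in> polyfun S"
    by (rule polyfun_compose[OF F]) (use S in \<open>auto intro!: I simp: fun_upd_def\<close>)
  have aG: "X a * F (X(d := X b * X c)) = 0" for X
  proof (cases "X a = 0")
    case False
    let ?X = "X(d := X b * X c / X a)"
    have "f ?X = 0" by (rule van) (use False neq in auto)
    moreover have "X a * (X b * X c / X a) = X b * X c" using False by simp
    ultimately have "F (X(d := X b * X c)) = 0" using nF[of ?X] neq by simp
    then show ?thesis by simp
  qed simp
  have "F (X(d := X b * X c)) = 0" for X
    by (rule polyfun_mult_eq_0[OF polyfun.var[OF S(1)] G aG, of "\<lambda>_. 1"]) simp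
  then have "\<exists>H\<in>polyfun S. \<forall>X. X a ^ n * f X = (X a * X d - X b * X c) * H X"
    using H FH nF by (metis diff_zero)
  \<comment> \<open>put \<open>X a = 0\<close>: the determinant becomes \<open>- X b * X c\<close>, so the cofactor must vanish there\<close>
  then show ?thesis
  proof (induction n)
    case (Suc n)
    then obtain H where H: "H \<in> polyfun S"
      and eq: "\<And>X. X a ^ Suc n * f X = (X a * X d - X b * X c) * H X" by auto
    have H0: "(\<lambda>X. H (X(a := 0))) \<in> polyfun S"
      by (rule polyfun_compose[OF H]) (auto intro!: I simp: fun_upd_def)
    have z: "H (X(a := 0)) = 0" for X
    proof (rule polyfun_mult_eq_0[OF _ H0, of "\<lambda>X. X b * X c" S "\<lambda>_. 1"])
      show "X b * X c * H (X(a := 0)) = 0" for X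
        using eq[of "X(a := 0)"] neq by auto
    qed (use S in \<open>auto intro!: I simp: fun_upd_def\<close>)
    obtain H' where H': "H' \<in> polyfun S" and "\<And>X. H X - H (X(a := 0)) = X a * H' X"
      using polyfun_update_diff[OF H polyfun.var[OF S(1)] polyfun.const[of 0], of a] by auto
    then have HH': "\<And>X. H X = X a * H' X" using z by simp
    have "X a ^ n * f X = (X a * X d - X b * X c) * H' X" for X
    proof (rule polyfun_cancel[OF polyfun.var[OF S(1)], where S' = S and X = "\<lambda>_. 1"
          and g = "\<lambda>X. X a ^ n * f X" and h = "\<lambda>X. (X a * X d - X b * X c) * H' X"])
      show "X a * (X a ^ n * f X) = X a * ((X a * X d - X b * X c) * H' X)" for X
        using eq[of X] HH'[of X] by (simp add: algebra_simps)
    qed (use S f H' in \<open>auto intro!: I simp: fun_upd_def\<close>)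
    then show ?case using Suc.IH H' by blast
  qed auto
qed

end

section \<open>Homogeneous functions\<close>

definition scale :: "'v set \<Rightarrow> 'a::comm_ring_1 \<Rightarrow> ('v \<Rightarrow> 'a) \<Rightarrow> 'v \<Rightarrow> 'a" where
  "scale A t X = (\<lambda>v. if v \<in> A then t * X v else X v)"

text \<open>
  The scaling parameter \<open>t = 0\<close> is included, so a function of degree 0 in the variables
  \<open>A\<close> does not depend on them.
\<close>

definition homog :: "'v set \<Rightarrow> nat \<Rightarrow> (('v \<Rightarrow> 'a::comm_ring_1) \<Rightarrow> 'a) \<Rightarrow> bool" where
  "homog A n f \<longleftrightarrow> (\<forall>t X. f (scale A t X) = t ^ n * f X)"

lemma homogD: "homog A n f \<Longrightarrow> f (scale A t X) = t ^ n * f X"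
  by (simp add: homog_def)

lemma homog_add: "homog A n f \<Longrightarrow> homog A n g \<Longrightarrow> homog A n (\<lambda>X. f X + g X)"
  by (simp add: homog_def algebra_simps)

lemma homog_diff: "homog A n f \<Longrightarrow> homog A n g \<Longrightarrow> homog A n (\<lambda>X. f X - g X)"
  by (simp add: homog_def algebra_simps)

lemma homog_mult: "homog A n f \<Longrightarrow> homog A m g \<Longrightarrow> homog A (n + m) (\<lambda>X. f X * g X)"
  by (simp add: homog_def algebra_simps power_add)

lemma homog_zero: "homog A n (\<lambda>X. 0)"
  by (simp add: homog_def)

lemma homog_const: "homog A 0 (\<lambda>X. c)"
  by (simp add: homog_def)

lemma scale_1 [simp]: "scale A 1 X = X"
  by (auto simp: scale_def)

lemma scale_scale: "scale A s (scale A t X) = scale A (s * t) X"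
  by (auto simp: scale_def)

lemma scale_commute: "scale A s (scale B t X) = scale B t (scale A s X)"
  by (auto simp: scale_def algebra_simps)

lemma scale_polyfun: "f \<in> polyfun S \<Longrightarrow> (\<lambda>X. f (scale A t X)) \<in> polyfun S"
  by (erule polyfun_compose[where M = "scale A t"]) (auto simp: scale_def intro!: polyfun_intros)

lemma scale_curve: "\<exists>p. \<forall>t. scale A t X v = poly p t"
  by (cases "v \<in> A", rule exI[of _ "[:0, X v:]"], simp add: scale_def,
      rule exI[of _ "[:X v:]"], simp add: scale_def)

lemma const_curve: "\<exists>p. \<forall>t. X v = poly p (t :: 'a::comm_ring_1)"
  by (rule exI[of _ "[:X v:]"]) simp

lemma polyfun_scale_expansion:
  assumes "f \<in> polyfun S"
  shows "\<exists>N P. (\<forall>n. (\<lambda>X. coeff (P X) n) \<in> polyfun S) \<and> (\<forall>X. degree (P X) \<le> N) \<and>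
               (\<forall>t X. f (scale A t X) = poly (P X) t)"
  using assms
proof (induction rule: polyfun.induct)
  case (const c)
  have "(\<lambda>X. coeff [:c:] n) \<in> polyfun S" for n
    by (rule polyfun.const)
  then show ?case
    by (intro exI[of _ 0] exI[of _ "\<lambda>X. [:c:]"]) auto
next
  case (var v)
  show ?case
  proof (cases "v \<in> A")
    case True
    have "(\<lambda>X. coeff [:0, X v:] n) \<in> polyfun S" for n
    proof -
      consider "n = 0" | "n = 1" | m where "n = Suc (Suc m)"
        by (metis One_nat_def not0_implies_Suc)
      then show ?thesis
        using polyfun.var[OF var] polyfun.const[of 0 S] by cases simp_all
    qed
    with True show ?thesis
      by (intro exI[of _ 1] exI[of _ "\<lambda>X. [:0, X v:]"]) (auto simp: scale_def)
  next
    case False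
    have "(\<lambda>X. coeff [:X v:] n) \<in> polyfun S" for n
    proof (cases n)
      case 0
      then show ?thesis using polyfun.var[OF var] by simp
    next
      case (Suc n')
      then show ?thesis using polyfun.const by simp
    qed
    with False show ?thesis
      by (intro exI[of _ 0] exI[of _ "\<lambda>X. [:X v:]"]) (auto simp: scale_def)
  qed
next
  case (add f g)
  then obtain N P M Q where *:
    "\<forall>n. (\<lambda>X. coeff (P X) n) \<in> polyfun S" "\<forall>X. degree (P X) \<le> N" "\<forall>t X. f (scale A t X) = poly (P X) t"
    "\<forall>n. (\<lambda>X. coeff (Q X) n) \<in> polyfun S" "\<forall>X. degree (Q X) \<le> M" "\<forall>t X. g (scale A t X) = poly (Q X) t"
    by metis
  have "(\<lambda>X. coeff (P X + Q X) n) \<in> polyfun S" for n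
    using * by (auto intro!: polyfun_intros)
  moreover have "degree (P X + Q X) \<le> N + M" for X
    using *(2,5) by (meson degree_add_le le_add1 le_add2 le_trans)
  ultimately show ?case using *
    by (intro exI[of _ "N + M"] exI[of _ "\<lambda>X. P X + Q X"]) simp
next
  case (mult f g)
  then obtain N P M Q where *:
    "\<forall>n. (\<lambda>X. coeff (P X) n) \<in> polyfun S" "\<forall>X. degree (P X) \<le> N" "\<forall>t X. f (scale A t X) = poly (P X) t"
    "\<forall>n. (\<lambda>X. coeff (Q X) n) \<in> polyfun S" "\<forall>X. degree (Q X) \<le> M" "\<forall>t X. g (scale A t X) = poly (Q X) t"
    by metis
  have "(\<lambda>X. coeff (P X * Q X) n) \<in> polyfun S" for n
    unfolding coeff_mult by (intro polyfun_sum polyfun_intros) (use * in auto)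
  moreover have "degree (P X * Q X) \<le> N + M" for X
    using *(2,5) by (meson degree_mult_le add_mono le_trans)
  ultimately show ?case using *
    by (intro exI[of _ "N + M"] exI[of _ "\<lambda>X. P X * Q X"]) simp
qed

context infinite_field begin

text \<open>
  The components are the coefficients of \<open>f (scale A t X)\<close> as a polynomial in
  \<open>t\<close>. Since these are uniquely determined, every symmetry \<open>M\<close> of
  \<open>f\<close> up to a factor that commutes with the scaling is a symmetry of each component; this
  covers the group action as well as the scaling of other variables.
\<close>

lemma homog_components:
  fixes f :: "('v \<Rightarrow> 'a) \<Rightarrow> 'a"
  assumes f: "f \<in> polyfun S"
  shows "\<exists>N F. (\<forall>n. F n \<in> polyfun S \<and> homog A n (F n)) \<and> (\<forall>X. f X = (\<Sum>n\<le>N. F n X)) \<and>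
    (\<forall>M c n. (\<forall>X. f (M X) = c * f X) \<longrightarrow> (\<forall>t X. M (scale A t X) = scale A t (M X)) \<longrightarrow>
       (\<forall>X. F n (M X) = c * F n X))"
proof -
  obtain N P where P: "\<And>n. (\<lambda>X. coeff (P X) n) \<in> polyfun S" "\<And>X. degree (P X) \<le> N"
    "\<And>t X. f (scale A t X) = poly (P X) t"
    using polyfun_scale_expansion[OF f, of A] by auto
  have inj: "p = q" if "\<And>t. poly p t = poly q (t :: 'a)" for p q
    by (rule poly_eq_cofinite[of "{}"]) (use that in auto)
  have "P (scale A s X) = pcompose (P X) [:0, s:]" for s X
    by (rule inj) (simp add: P(3)[symmetric] poly_pcompose scale_scale mult.commute)
  then have "homog A n (\<lambda>X. coeff (P X) n)" for n
    by (simp add: homog_def coeff_pcompose_linear)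
  moreover have "f X = (\<Sum>n\<le>N. coeff (P X) n)" for X
  proof -
    have "f X = poly (P X) 1" using P(3)[of 1 X] by simp
    also have "\<dots> = (\<Sum>n\<le>degree (P X). coeff (P X) n)" by (simp add: poly_altdef)
    also have "\<dots> = (\<Sum>n\<le>N. coeff (P X) n)"
      by (rule sum.mono_neutral_left) (use P(2)[of X] in \<open>auto simp: coeff_eq_0\<close>)
    finally show ?thesis .
  qed
  moreover have "coeff (P (M X)) n = c * coeff (P X) n"
    if "\<forall>X. f (M X) = c * f X" "\<forall>t X. M (scale A t X) = scale A t (M X)" for M c n X
  proof -
    have "P (M X) = smult c (P X)"
      by (rule inj) (use that in \<open>simp add: P(3)[symmetric] flip: that(2)[rule_format]\<close>)
    then show ?thesis by simp
  qed
  ultimately show ?thesis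
    using P(1) by (intro exI[of _ N] exI[of _ "\<lambda>n X. coeff (P X) n"]) auto
qed

text \<open>
  Degrees subtract under division because \<open>d\<close> can be cancelled from
  \<open>d(t X) h(t X) = t\<^sup>n d(X) h(X)\<close>. If \<open>n < r\<close>, the remaining factor
  \<open>t ^ (r - n)\<close> forces \<open>h = 0\<close> at \<open>t = 0\<close>.
\<close>

lemma homog_cancel:
  fixes d h :: "('v \<Rightarrow> 'a) \<Rightarrow> 'a"
  assumes d: "d \<in> polyfun S" "d X0 \<noteq> 0" and h: "h \<in> polyfun S"
    and f: "homog A n (\<lambda>X. d X * h X)" and r: "homog A r d"
  shows "(\<forall>X. h X = 0) \<or> (r \<le> n \<and> homog A (n - r) h)"
proof -
  have eq: "t ^ r * h (scale A t X) = t ^ n * h X" for t X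
  proof (rule polyfun_cancel[OF d(1), where g = "\<lambda>X. t ^ r * h (scale A t X)"
        and h = "\<lambda>X. t ^ n * h X" and S' = S, OF _ _ _ d(2)])
    show "d X * (t ^ r * h (scale A t X)) = d X * (t ^ n * h X)" for X
      using homogD[OF f, of t X] homogD[OF r, of t X] by (simp add: algebra_simps)
  qed (use h scale_polyfun[OF h] in \<open>auto intro!: polyfun_intros\<close>)
  show ?thesis
  proof (cases "r \<le> n")
    case True
    have "h (scale A t X) = t ^ (n - r) * h X" for t X
    proof -
      have "t ^ 0 * h (scale A t X) = t ^ (n - r) * h X"
      proof (rule polyfun_curve_eq[OF h h scale_curve _ const_curve])
        fix t :: 'a assume "t \<noteq> 0"
        have "t ^ r * h (scale A t X) = t ^ r * (t ^ (n - r) * h X)"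
          using eq[of t X] True by (simp flip: power_add mult.assoc)
        with \<open>t \<noteq> 0\<close> show "t ^ 0 * h (scale A t X) = t ^ (n - r) * h X" by simp
      qed
      then show ?thesis by simp
    qed
    with True show ?thesis by (auto simp: homog_def)
  next
    case False
    have "h X = 0" for X
    proof -
      have "0 ^ (r - n) * h (scale A 0 X) = 0 ^ 0 * h X"
      proof (rule polyfun_curve_eq[OF h h scale_curve _ const_curve])
        fix t :: 'a assume "t \<noteq> 0"
        have "t ^ n * (t ^ (r - n) * h (scale A t X)) = t ^ n * h X"
          using eq[of t X] False by (simp flip: power_add mult.assoc)
        with \<open>t \<noteq> 0\<close> show "t ^ (r - n) * h (scale A t X) = t ^ 0 * h X" by simp
      qed
      then show ?thesis using False by (simp add: zero_power)
    qed
    then show ?thesis by blast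
  qed
qed

end

section \<open>Two-by-two matrices and the action of the group\<close>

text \<open>
  An associative ring of \<open>2 \<times> 2\<close> matrices of its own makes the ring simplification
  rules available for products of unbounded length, without side conditions on dimensions.
\<close>

datatype 'a m2 = M2 (e00: 'a) (e01: 'a) (e10: 'a) (e11: 'a)

instantiation m2 :: (comm_ring_1) ring_1
begin
definition "0 = M2 0 0 0 (0::'a)"
definition "1 = M2 1 0 0 (1::'a)"
definition "x + y = M2 (e00 x + e00 y) (e01 x + e01 y) (e10 x + e10 y) (e11 x + e11 (y :: 'a m2))"
definition "x - y = M2 (e00 x - e00 y) (e01 x - e01 y) (e10 x - e10 y) (e11 x - e11 (y :: 'a m2))"
definition "- x = M2 (- e00 x) (- e01 x) (- e10 x) (- e11 (x :: 'a m2))"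
definition "x * y = M2 (e00 x * e00 y + e01 x * e10 y) (e00 x * e01 y + e01 x * e11 y)
                       (e10 x * e00 y + e11 x * e10 y) (e10 x * e01 y + e11 x * e11 (y :: 'a m2))"
instance
  by standard
    (auto simp: zero_m2_def one_m2_def plus_m2_def minus_m2_def uminus_m2_def times_m2_def algebra_simps)
end

lemmas m2_simps = zero_m2_def one_m2_def plus_m2_def minus_m2_def uminus_m2_def times_m2_def

definition det2 :: "'a::comm_ring_1 m2 \<Rightarrow> 'a" where
  "det2 x = e00 x * e11 x - e01 x * e10 x"

definition adj2 :: "'a::comm_ring_1 m2 \<Rightarrow> 'a m2" where
  "adj2 x = M2 (e11 x) (- e01 x) (- e10 x) (e00 x)"

definition tr2 :: "'a::comm_ring_1 m2 \<Rightarrow> 'a" where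
  "tr2 x = e00 x + e11 x"

definition transp2 :: "'a m2 \<Rightarrow> 'a m2" where
  "transp2 x = M2 (e00 x) (e10 x) (e01 x) (e11 x)"

definition entry :: "'a m2 \<Rightarrow> bool \<Rightarrow> bool \<Rightarrow> 'a" where
  "entry x i j = (if i then if j then e11 x else e10 x else if j then e01 x else e00 x)"

text \<open>
  A point assigns values to variables \<open>(i, j, k)\<close> and is read in two ways. For an unsplit
  index \<open>k\<close> it gives the entry in row \<open>i\<close> and column \<open>j\<close> of the
  \<open>k\<close>-th matrix, with \<open>True\<close> for the second row or column. For a split index it
  gives two vectors instead: \<open>(False, j, k)\<close> is the \<open>j\<close>-th coordinate of
  \<open>u\<^sub>k\<close> and \<open>(True, j, k)\<close> that of \<open>v\<^sub>k\<close>. The first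
  component is then called the colour of the vector.
\<close>

type_synonym 'a point = "bool \<times> bool \<times> nat \<Rightarrow> 'a"

definition mtx :: "'a point \<Rightarrow> nat \<Rightarrow> 'a m2" where
  "mtx X k = M2 (X (False, False, k)) (X (False, True, k)) (X (True, False, k)) (X (True, True, k))"

text \<open>
  Indices in \<open>J\<close> are split. The action is chosen so that \<open>u v\<^sup>T\<close> transforms
  like a matrix, namely to \<open>g u v\<^sup>T h\<^sup>T\<close>. The inverse transpose is an automorphism
  of \<open>SL\<^sub>2\<close>, so the invariants are the same as for \<open>g x h\<^sup>-\<^sup>1\<close>.
\<close>

definition sl_act :: "nat set \<Rightarrow> 'a::comm_ring_1 m2 \<Rightarrow> 'a m2 \<Rightarrow> 'a point \<Rightarrow> 'a point" where
  "sl_act J g h X = (\<lambda>(i, j, k).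
     if k \<in> J then entry (if i then h else g) j False * X (i, False, k)
                 + entry (if i then h else g) j True * X (i, True, k)
     else entry (g * mtx X k * transp2 h) i j)"

definition sl_invariant :: "nat set \<Rightarrow> ('a::comm_ring_1 point \<Rightarrow> 'a) \<Rightarrow> bool" where
  "sl_invariant J f \<longleftrightarrow> (\<forall>g h X. det2 g = 1 \<longrightarrow> det2 h = 1 \<longrightarrow> f (sl_act J g h X) = f X)"

lemma sl_invariantD: "sl_invariant J f \<Longrightarrow> det2 g = 1 \<Longrightarrow> det2 h = 1 \<Longrightarrow> f (sl_act J g h X) = f X"
  by (simp add: sl_invariant_def)

text \<open>
  Sets of variables that contain with any entry the whole vector or matrix it belongs to; the action
  preserves the polynomial functions of such variables.
\<close>

definition act_closed :: "nat set \<Rightarrow> (bool \<times> bool \<times> nat) set \<Rightarrow> bool" where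
  "act_closed J S \<longleftrightarrow> (\<forall>i j k. (i, j, k) \<in> S \<longrightarrow>
     (\<forall>i' j'. (k \<in> J \<longrightarrow> i' = i) \<longrightarrow> (i', j', k) \<in> S))"

lemma sl_invariant_add: "sl_invariant J f \<Longrightarrow> sl_invariant J g \<Longrightarrow> sl_invariant J (\<lambda>X. f X + g X)"
  by (simp add: sl_invariant_def)

lemma sl_invariant_diff: "sl_invariant J f \<Longrightarrow> sl_invariant J g \<Longrightarrow> sl_invariant J (\<lambda>X. f X - g X)"
  by (simp add: sl_invariant_def)

lemma sl_invariant_mult: "sl_invariant J f \<Longrightarrow> sl_invariant J g \<Longrightarrow> sl_invariant J (\<lambda>X. f X * g X)"
  by (simp add: sl_invariant_def)

lemma sl_act_polyfun:
  assumes "f \<in> polyfun S" and "act_closed J S"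
  shows "(\<lambda>X. f (sl_act J g h X)) \<in> polyfun S"
proof (rule polyfun_compose[OF assms(1)])
  fix v assume v: "v \<in> S"
  obtain i j k where ijk: "v = (i, j, k)" by (cases v)
  show "(\<lambda>X. sl_act J g h X v) \<in> polyfun S"
  proof (cases "k \<in> J")
    case True
    then show ?thesis using v assms(2) True unfolding ijk sl_act_def act_closed_def
      by (auto intro!: polyfun_intros)
  next
    case False
    then show ?thesis using v assms(2) False unfolding ijk sl_act_def act_closed_def
      by (auto simp: entry_def mtx_def times_m2_def transp2_def intro!: polyfun_intros)
  qed
qed

context infinite_field begin

text \<open>
  A quotient of invariants is invariant: for fixed group elements \<open>d\<close> cancels as a function of
  the point, including the points where it vanishes.
\<close>

lemma sl_invariant_cancel:
  fixes d h :: "'a point \<Rightarrow> 'a"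
  assumes "sl_invariant J (\<lambda>X. d X * h X)" "sl_invariant J d"
    and d: "d \<in> polyfun S" "d X0 \<noteq> 0" and h: "h \<in> polyfun S"
    and "act_closed J S"
  shows "sl_invariant J h"
  unfolding sl_invariant_def
proof (intro allI impI)
  fix g1 g2 :: "'a m2" and X :: "'a point"
  assume g: "det2 g1 = 1" "det2 g2 = 1"
  show "h (sl_act J g1 g2 X) = h X"
  proof (rule polyfun_cancel[where f = d and g = "\<lambda>X. h (sl_act J g1 g2 X)" and h = h and X = X0,
        OF d(1) sl_act_polyfun[OF h assms(6)] h _ d(2)])
    show "d X * h (sl_act J g1 g2 X) = d X * h X" for X
      using sl_invariantD[OF assms(1) g, of X] sl_invariantD[OF assms(2) g, of X] by simp
  qed
qed

end

section \<open>Invariants of vectors\<close>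

definition vec_vars :: "bool \<times> nat \<Rightarrow> (bool \<times> bool \<times> nat) set" where
  "vec_vars p = {fst p} \<times> UNIV \<times> {snd p}"

lemma vec_vars_iff [simp]: "(c, i, k) \<in> vec_vars p \<longleftrightarrow> p = (c, k)"
  by (cases p) (auto simp: vec_vars_def)

definition vecs_vars :: "(bool \<times> nat) set \<Rightarrow> (bool \<times> bool \<times> nat) set" where
  "vecs_vars V = (\<Union>p\<in>V. vec_vars p)"

lemma vecs_vars_iff [simp]: "(c, i, k) \<in> vecs_vars V \<longleftrightarrow> (c, k) \<in> V"
  by (auto simp: vecs_vars_def)

definition minor :: "bool \<Rightarrow> nat \<Rightarrow> nat \<Rightarrow> 'a::comm_ring_1 point \<Rightarrow> 'a" where
  "minor c k l X = X (c, False, k) * X (c, True, l) - X (c, True, k) * X (c, False, l)"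

text \<open>
  Scalar multiples of products of minors. A vector is a pair of a colour and an index, both vectors of a
  minor have the same colour, and the multiset records how often each vector occurs.
\<close>

inductive minor_mono :: "(bool \<times> nat) multiset \<Rightarrow> ('a::comm_ring_1 point \<Rightarrow> 'a) \<Rightarrow> bool" where
  const: "minor_mono {#} (\<lambda>X. a)"
| minor: "minor_mono \<alpha> f \<Longrightarrow> minor_mono (add_mset (c, k) (add_mset (c, l) \<alpha>)) (\<lambda>X. minor c k l X * f X)"

inductive minor_span :: "(bool \<times> nat) multiset \<Rightarrow> ('a::comm_ring_1 point \<Rightarrow> 'a) \<Rightarrow> bool" where
  zero: "minor_span \<alpha> (\<lambda>X. 0)"
| mon: "minor_mono \<alpha> f \<Longrightarrow> minor_span \<alpha> f"
| add: "minor_span \<alpha> f \<Longrightarrow> minor_span \<alpha> g \<Longrightarrow> minor_span \<alpha> (\<lambda>X. f X + g X)"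

lemma minor_swap: "minor c k l X = - minor c l k X"
  by (simp add: minor_def)

lemma minor_span_minor:
  assumes "minor_span \<alpha> f" shows "minor_span (add_mset (c, k) (add_mset (c, l) \<alpha>)) (\<lambda>X. minor c k l X * f X)"
  using assms
proof (induction rule: minor_span.induct)
  case (add \<alpha> f g)
  then show ?case using minor_span.add[OF add.IH] by (simp add: distrib_left)
next
  case (zero \<alpha>)
  show ?case using minor_span.zero by simp
next
  case (mon \<alpha> f)
  show ?case by (rule minor_span.mon[OF minor_mono.minor[OF mon]])
qed

lemma minor_mono_uminus: "minor_mono \<alpha> f \<Longrightarrow> minor_mono \<alpha> (\<lambda>X. - f X)"
proof (induction rule: minor_mono.induct)
  case (minor \<alpha> f c k l)
  show ?case using minor_mono.minor[OF minor.IH, of c k l] by simp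
qed (rule minor_mono.const)

text \<open>
  Any vector that occurs can be made the first vector of the first minor; the sign goes into the scalar.
\<close>

lemma minor_mono_extract:
  assumes "minor_mono \<alpha> f" and "(c, k) \<in># \<alpha>"
  shows "\<exists>l f' \<beta>. \<alpha> = add_mset (c, k) (add_mset (c, l) \<beta>) \<and> minor_mono \<beta> f' \<and> f = (\<lambda>X. minor c k l X * f' X)"
  using assms
proof (induction rule: minor_mono.induct)
  case (minor \<alpha> f c' i j)
  consider "(c, k) = (c', i)" | "(c, k) = (c', j)" | "(c, k) \<in># \<alpha>" using minor.prems by auto
  then show ?case
  proof cases
    case 1
    then show ?thesis using minor.hyps by blast
  next
    case 2
    have "(\<lambda>X. minor c' i j X * f X) = (\<lambda>X. minor c' j i X * (- f X))"
      by (rule ext) (subst minor_swap, simp)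
    then show ?thesis using 2 minor_mono_uminus[OF minor.hyps]
      by (intro exI[of _ i] exI[of _ "\<lambda>X. - f X"] exI[of _ \<alpha>] conjI) (auto simp: add_mset_commute)
  next
    case 3
    then obtain l f' \<beta> where "\<alpha> = add_mset (c, k) (add_mset (c, l) \<beta>)" "minor_mono \<beta> f'"
      "f = (\<lambda>X. minor c k l X * f' X)" using minor.IH by blast
    moreover from this(2) have "minor_mono (add_mset (c', i) (add_mset (c', j) \<beta>)) (\<lambda>X. minor c' i j X * f' X)"
      by (rule minor_mono.minor)
    ultimately show ?thesis
      by (intro exI[of _ l] exI[of _ "\<lambda>X. minor c' i j X * f' X"]
            exI[of _ "add_mset (c', i) (add_mset (c', j) \<beta>)"] conjI)
         (auto simp: mult.left_commute)
  qed
qed simp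

lemma minor_homog:
  "homog (vec_vars p) (count {#(c, k), (c, l)#} p) (minor c k l)"
  by (auto simp: homog_def minor_def scale_def power2_eq_square algebra_simps)

lemma minor_polyfun: "(c, k) \<in> V \<Longrightarrow> (c, l) \<in> V \<Longrightarrow> minor c k l \<in> polyfun (vecs_vars V)"
  unfolding minor_def by (intro polyfun_intros) auto

lemma minor_invariant: "sl_invariant UNIV (minor c k l)"
  unfolding sl_invariant_def
proof (intro allI impI)
  fix g h :: "'a m2" and X :: "'a point"
  assume "det2 g = 1" "det2 h = 1"
  moreover have "minor c k l (sl_act UNIV g h X) = det2 (if c then h else g) * minor c k l X"
    by (simp add: minor_def sl_act_def det2_def entry_def algebra_simps)
  ultimately show "minor c k l (sl_act UNIV g h X) = minor c k l X" by simp
qed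

lemma minor_mono_props:
  assumes "minor_mono \<alpha> f" and "set_mset \<alpha> \<subseteq> V"
  shows "f \<in> polyfun (vecs_vars V) \<and> sl_invariant UNIV f \<and> (\<forall>p. homog (vec_vars p) (count \<alpha> p) f)"
  using assms
proof (induction rule: minor_mono.induct)
  case (minor \<alpha> f c k l)
  have "homog (vec_vars p) (count {#(c, k), (c, l)#} p + count \<alpha> p) (\<lambda>X. minor c k l X * f X)" for p
    by (rule homog_mult[OF minor_homog]) (use minor.IH minor.prems in \<open>simp only: set_mset_add_mset_insert insert_subset\<close>)
  moreover have "count {#(c, k), (c, l)#} p + count \<alpha> p = count (add_mset (c, k) (add_mset (c, l) \<alpha>)) p" for p
    by simp
  moreover have "sl_invariant UNIV (\<lambda>X. minor c k l X * f X)"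
    using sl_invariant_mult minor_invariant minor.IH minor.prems
    by (metis insert_subset set_mset_add_mset_insert)
  moreover have "minor c k l \<in> polyfun (vecs_vars V)" "f \<in> polyfun (vecs_vars V)"
    using minor minor_polyfun[of c k V l] by auto
  ultimately show ?case using polyfun.mult by metis
qed (auto intro: polyfun.const homog_const simp: sl_invariant_def)

lemma minor_span_props:
  assumes "minor_span \<alpha> f" and "set_mset \<alpha> \<subseteq> V"
  shows "f \<in> polyfun (vecs_vars V) \<and> sl_invariant UNIV f \<and> (\<forall>p. homog (vec_vars p) (count \<alpha> p) f)"
  using assms
proof (induction rule: minor_span.induct)
  case (mon \<alpha> f)
  then show ?case using minor_mono_props by blast
next
  case (add \<alpha> f g)
  then show ?case by (auto intro!: polyfun_intros homog_add sl_invariant_add)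
qed (auto intro: polyfun.const homog_zero simp: sl_invariant_def)

definition subst_vec :: "bool \<Rightarrow> nat \<Rightarrow> nat \<Rightarrow> 'a point \<Rightarrow> 'a point" where
  "subst_vec c k l X = (\<lambda>(c', i, k'). if c' = c \<and> k' = l then X (c, i, k) else X (c', i, k'))"

lemma minor_mono_relabel1:
  assumes "minor_mono (add_mset (c, k) \<alpha>) f" and "k \<noteq> l"
  shows "\<exists>f'. minor_mono (add_mset (c, l) \<alpha>) f' \<and> (\<forall>X. f' (subst_vec c k l X) = f (subst_vec c k l X))"
proof -
  obtain k' f' \<beta> where *: "add_mset (c, k) \<alpha> = add_mset (c, k) (add_mset (c, k') \<beta>)" "minor_mono \<beta> f'"
    "f = (\<lambda>X. minor c k k' X * f' X)" using minor_mono_extract[OF assms(1), of c k] by auto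
  have "minor c l k' (subst_vec c k l X) = minor c k k' (subst_vec c k l X)" for X :: "'a point"
    using assms(2) by (simp add: minor_def subst_vec_def)
  with * show ?thesis
    by (intro exI[of _ "\<lambda>X. minor c l k' X * f' X"]) (auto intro: minor_mono.minor)
qed

text \<open>
  Relabelling \<open>n\<close> occurrences of \<open>k\<close> by \<open>l\<close> is not visible after the
  two vectors have been identified. This lifts invariants of the identified vectors.
\<close>

lemma minor_mono_relabel:
  assumes "minor_mono (\<alpha> + replicate_mset n (c, k)) f" and "k \<noteq> l"
  shows "\<exists>f'. minor_mono (\<alpha> + replicate_mset n (c, l)) f' \<and> (\<forall>X. f' (subst_vec c k l X) = f (subst_vec c k l X))"
  using assms(1)
proof (induction n arbitrary: \<alpha> f)
  case 0
  then show ?case by auto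
next
  case (Suc n)
  then have "minor_mono (add_mset (c, k) (\<alpha> + replicate_mset n (c, k))) f" by simp
  from minor_mono_relabel1[OF this assms(2)] obtain f' where
    f': "minor_mono (add_mset (c, l) \<alpha> + replicate_mset n (c, k)) f'"
      "\<forall>X. f' (subst_vec c k l X) = f (subst_vec c k l X)" by auto
  from Suc.IH[OF f'(1)] f'(2) show ?case by auto
qed

lemma minor_span_relabel:
  assumes "minor_span (\<alpha> + replicate_mset n (c, k)) f" and "k \<noteq> l"
  shows "\<exists>f'. minor_span (\<alpha> + replicate_mset n (c, l)) f' \<and> (\<forall>X. f' (subst_vec c k l X) = f (subst_vec c k l X))"
proof -
  have "\<exists>f'. minor_span (\<alpha> + replicate_mset n (c, l)) f' \<and> (\<forall>X. f' (subst_vec c k l X) = f (subst_vec c k l X))"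
    if "minor_span \<beta> f" "\<beta> = \<alpha> + replicate_mset n (c, k)" for \<beta> f
    using that
  proof (induction rule: minor_span.induct)
    case (zero \<beta>)
    show ?case by (intro exI[of _ "\<lambda>X. 0"] conjI minor_span.zero) simp
  next
    case (mon \<beta> f)
    from minor_mono_relabel[OF mon(1)[unfolded mon(2)] assms(2)] show ?case using minor_span.mon by blast
  next
    case (add \<beta> f g)
    from add.IH(1)[OF add.prems] obtain f' where f': "minor_span (\<alpha> + replicate_mset n (c, l)) f'"
      "\<forall>X. f' (subst_vec c k l X) = f (subst_vec c k l X)" by blast
    from add.IH(2)[OF add.prems] obtain g' where g': "minor_span (\<alpha> + replicate_mset n (c, l)) g'"
      "\<forall>X. g' (subst_vec c k l X) = g (subst_vec c k l X)" by blast
    show ?case by (rule exI, rule conjI[OF minor_span.add[OF f'(1) g'(1)]]) (simp add: f' g')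
  qed
  then show ?thesis using assms(1) by blast
qed

lemma act_closed_vecs_vars: "act_closed UNIV (vecs_vars V)"
  by (auto simp: act_closed_def)

context infinite_field begin

lemma minor_nonzero:
  assumes "k \<noteq> l"
  shows "minor c k l (\<lambda>v. if v = (c, False, k) \<or> v = (c, True, l) then 1 else (0 :: 'a)) \<noteq> 0"
  using assms by (simp add: minor_def)

text \<open>
  By homogeneity a function that vanishes for equal vectors \<open>k\<close> and \<open>l\<close> vanishes
  whenever \<open>l\<close> is a multiple of \<open>k\<close>.
\<close>

lemma vanishing_minor_dvd:
  fixes f :: "'a point \<Rightarrow> 'a"
  assumes f: "f \<in> polyfun (vecs_vars V)" and V: "(c, k) \<in> V" "(c, l) \<in> V" "k \<noteq> l"
    and hom: "homog (vec_vars (c, l)) n f" and van: "\<And>X. f (subst_vec c k l X) = 0"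
  shows "\<exists>h\<in>polyfun (vecs_vars V). \<forall>X. f X = minor c k l X * h X"
proof -
  have "\<exists>h\<in>polyfun (vecs_vars V). \<forall>X. f X =
      (X (c, False, k) * X (c, True, l) - X (c, True, k) * X (c, False, l)) * h X"
  proof (rule polyfun_det_dvd[OF f])
    fix X :: "'a point"
    assume nz: "X (c, False, k) \<noteq> 0"
      and eq: "X (c, False, k) * X (c, True, l) = X (c, True, k) * X (c, False, l)"
    have "X = scale (vec_vars (c, l)) (X (c, False, l) / X (c, False, k)) (subst_vec c k l X)"
    proof
      fix v :: "bool \<times> bool \<times> nat"
      obtain c' i k' where v: "v = (c', i, k')" by (cases v)
      show "X v = scale (vec_vars (c, l)) (X (c, False, l) / X (c, False, k)) (subst_vec c k l X) v"
        using nz eq unfolding v by (cases i) (auto simp: scale_def subst_vec_def field_simps)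
    qed
    then show "f X = 0" using homogD[OF hom] van by (metis mult_zero_right)
  qed (use V in auto)
  then show ?thesis by (simp add: minor_def)
qed

lemma subst_vec_scale_other:
  assumes "p \<noteq> (c, k)" "p \<noteq> (c, l)"
  shows "subst_vec c k l (scale (vec_vars p) t X) = scale (vec_vars p) t (subst_vec c k l X)"
  using assms by (auto simp: subst_vec_def scale_def fun_eq_iff)

lemma subst_vec_scale_source:
  assumes "k \<noteq> l"
  shows "subst_vec c k l (scale (vec_vars (c, k)) t X)
    = scale (vec_vars (c, l)) t (scale (vec_vars (c, k)) t (subst_vec c k l X))"
  using assms by (auto simp: subst_vec_def scale_def fun_eq_iff)

lemma subst_vec_idem: "k \<noteq> l \<Longrightarrow> subst_vec c k l (subst_vec c k l X) = subst_vec c k l X"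
  by (auto simp: subst_vec_def fun_eq_iff)

lemma subst_vec_act: "subst_vec c k l (sl_act UNIV g h X) = sl_act UNIV g h (subst_vec c k l X)"
  by (auto simp: subst_vec_def sl_act_def fun_eq_iff)

text \<open>
  After the identification of \<open>l\<close> with \<open>k\<close> the degree in \<open>k\<close> is the
  sum of both degrees.
\<close>

lemma merge_props:
  fixes f :: "'a point \<Rightarrow> 'a"
  assumes f: "f \<in> polyfun (vecs_vars V)" and inv: "sl_invariant UNIV f"
    and V: "(c, k) \<in> V" "(c, l) \<in> V" "k \<noteq> l" and \<alpha>: "set_mset \<alpha> \<subseteq> V"
    and hom: "\<And>p. p \<in> V \<Longrightarrow> homog (vec_vars p) (count \<alpha> p) f"
    and p: "p \<in> V - {(c, l)}"
  defines "g \<equiv> \<lambda>X. f (subst_vec c k l X)"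
    and "\<beta> \<equiv> filter_mset (\<lambda>p. p \<noteq> (c, l)) \<alpha> + replicate_mset (count \<alpha> (c, l)) (c, k)"
  shows "g \<in> polyfun (vecs_vars (V - {(c, l)}))" "sl_invariant UNIV g"
    "set_mset \<beta> \<subseteq> V - {(c, l)}" "homog (vec_vars p) (count \<beta> p) g"
proof -
  show "g \<in> polyfun (vecs_vars (V - {(c, l)}))"
    unfolding g_def
  proof (rule polyfun_compose[OF f])
    fix v :: "bool \<times> bool \<times> nat" assume "v \<in> vecs_vars V"
    then show "(\<lambda>X. subst_vec c k l X v) \<in> polyfun (vecs_vars (V - {(c, l)}))"
      using V by (cases v) (auto simp: subst_vec_def intro!: polyfun_intros)
  qed
  show "sl_invariant UNIV g"
    using inv by (simp add: sl_invariant_def g_def subst_vec_act)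
  show "set_mset \<beta> \<subseteq> V - {(c, l)}" using \<alpha> V by (auto simp: \<beta>_def)
  show "homog (vec_vars p) (count \<beta> p) g"
  proof (cases "p = (c, k)")
    case True
    have "count \<beta> p = count \<alpha> (c, l) + count \<alpha> (c, k)" using True V by (simp add: \<beta>_def)
    then show ?thesis unfolding homog_def g_def True subst_vec_scale_source[OF V(3)]
      using homogD[OF hom[OF V(1)]] homogD[OF hom[OF V(2)]] by (simp add: power_add)
  next
    case False
    then have "count \<beta> p = count \<alpha> p" using p by (simp add: \<beta>_def)
    then show ?thesis unfolding homog_def g_def using False p homogD[OF hom, of p]
      by (simp add: subst_vec_scale_other)
  qed
qed

text \<open>
  The first fundamental theorem for \<open>SL\<^sub>2\<close>, for two copies of the group acting on
  vectors of two colours. The induction is on the number of vectors and then on the degree. With at most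
  one vector of each colour an invariant is constant, because \<open>SL\<^sub>2\<close> moves any vector
  with nonzero first coordinate to any nonzero multiple of the first unit vector.
\<close>

theorem vector_invariants:
  fixes f :: "'a point \<Rightarrow> 'a"
  assumes "finite V" and "f \<in> polyfun (vecs_vars V)" and "sl_invariant UNIV f"
    and "set_mset \<alpha> \<subseteq> V" and "\<And>p. p \<in> V \<Longrightarrow> homog (vec_vars p) (count \<alpha> p) f"
  shows "minor_span \<alpha> f"
  using assms
proof (induction "card V" arbitrary: V f \<alpha> rule: less_induct)
  case less
  consider (empty) "V = {}"
    | (merge) c k l where "(c, k) \<in> V" "(c, l) \<in> V" "k \<noteq> l"
    | (single) c k where "(c, k) \<in> V" "\<And>l. (c, l) \<in> V \<Longrightarrow> l = k"
    by (metis ex_in_conv surj_pair)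
  then show ?case
  proof cases
    case empty
    have "f = (\<lambda>X. f (\<lambda>v. 0))"
      by (rule ext, rule polyfun_cong[OF less.prems(2)]) (use empty in \<open>auto simp: vecs_vars_def\<close>)
    moreover have "minor_span \<alpha> (\<lambda>X. f (\<lambda>v. 0))"
      using less.prems(4) empty minor_span.mon[OF minor_mono.const] by simp
    ultimately show ?thesis by simp
  next
    case merge
    have smaller: "card (V - {(c, l)}) < card V"
      using merge less.prems(1) by (meson card_Diff1_less)
    have "minor_span \<alpha> f"
      if "f \<in> polyfun (vecs_vars V)" "sl_invariant UNIV f" "set_mset \<alpha> \<subseteq> V"
        "\<And>p. p \<in> V \<Longrightarrow> homog (vec_vars p) (count \<alpha> p) f" for f :: "'a point \<Rightarrow> 'a" and \<alpha>
      using that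
    proof (induction "size \<alpha>" arbitrary: f \<alpha> rule: less_induct)
      case inner: less
      define \<gamma> where "\<gamma> = filter_mset (\<lambda>p. p \<noteq> (c, l)) \<alpha>"
      define n where "n = count \<alpha> (c, l)"
      have \<alpha>: "\<gamma> + replicate_mset n (c, l) = \<alpha>"
        by (rule multiset_eqI) (simp add: \<gamma>_def n_def)
      note P = merge_props[OF inner.prems(1,2) merge inner.prems(3,4)]
      have "(c, k) \<in> V - {(c, l)}" using merge by auto
      note P' = P(1-3)[OF _ this]
      have "minor_span (\<gamma> + replicate_mset n (c, k)) (\<lambda>X. f (subst_vec c k l X))"
        unfolding \<gamma>_def n_def
        by (rule less.hyps[OF smaller]) (use less.prems(1) P' P(4) in auto)
      \<comment> \<open>\<open>a\<close> agrees with \<open>f\<close> where the vectors \<open>k\<close> and \<open>l\<close> coincide\<close>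
      from minor_span_relabel[OF this merge(3)] obtain a where
        a: "minor_span \<alpha> a" "\<And>X. a (subst_vec c k l X) = f (subst_vec c k l X)"
        using \<alpha> subst_vec_idem[OF merge(3)] by metis
      note aP = minor_span_props[OF a(1) inner.prems(3)]
      have D: "(\<lambda>X. f X - a X) \<in> polyfun (vecs_vars V)" "sl_invariant UNIV (\<lambda>X. f X - a X)"
        "\<And>p. p \<in> V \<Longrightarrow> homog (vec_vars p) (count \<alpha> p) (\<lambda>X. f X - a X)"
        using aP inner.prems by (auto intro!: polyfun_diff sl_invariant_diff homog_diff)
      obtain h where h: "h \<in> polyfun (vecs_vars V)" and fh: "\<And>X. f X - a X = minor c k l X * h X"
        using vanishing_minor_dvd[OF D(1) merge D(3)[OF merge(2)]] a(2) by auto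
      have hh: "(\<forall>X. h X = 0) \<or> (count {#(c, k), (c, l)#} p \<le> count \<alpha> p
          \<and> homog (vec_vars p) (count \<alpha> p - count {#(c, k), (c, l)#} p) h)" if "p \<in> V" for p
        by (rule homog_cancel[OF minor_polyfun[OF merge(1,2)] minor_nonzero[OF merge(3)] h _ minor_homog])
           (use D(3)[OF that] fh in simp)
      have f_eq: "f = (\<lambda>X. a X + minor c k l X * h X)"
        using fh by (auto simp: fun_eq_iff algebra_simps)
      show ?case
      proof (cases "\<forall>X. h X = 0")
        case True
        then show ?thesis using a(1) f_eq by simp
      next
        case False
        define \<beta> where "\<beta> = \<alpha> - {#(c, k), (c, l)#}"
        have "{#(c, k), (c, l)#} \<subseteq># \<alpha>"
        proof (rule mset_subset_eqI)
          fix p show "count {#(c, k), (c, l)#} p \<le> count \<alpha> p"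
            using hh[of p] False merge by (cases "p \<in> V") auto
        qed
        then have \<beta>: "\<alpha> = add_mset (c, k) (add_mset (c, l) \<beta>)"
          unfolding \<beta>_def by (metis add_mset_add_single subset_mset.diff_add union_mset_add_mset_right
              union_mset_add_mset_left add.commute add_0)
        have "minor_span \<beta> h"
        proof (rule inner.hyps)
          show "size \<beta> < size \<alpha>" by (simp add: \<beta>)
          show "h \<in> polyfun (vecs_vars V)" by (rule h)
          show "sl_invariant UNIV h"
            by (rule sl_invariant_cancel[OF _ minor_invariant minor_polyfun[OF merge(1,2)]
                  minor_nonzero[OF merge(3)] h act_closed_vecs_vars]) (use D(2) fh in simp)
          show "set_mset \<beta> \<subseteq> V" using inner.prems(3) \<beta> by auto
          show "homog (vec_vars p) (count \<beta> p) h" if "p \<in> V" for p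
            using hh[OF that] False by (simp add: \<beta>_def)
        qed
        then show ?thesis unfolding f_eq \<beta> using minor_span.add[OF a(1)[unfolded \<beta>] minor_span_minor] by blast
      qed
    qed
    then show ?thesis using less.prems by blast
  next
    case single
    let ?p = "(c, k)"
    have hom: "homog (vec_vars ?p) (count \<alpha> ?p) f" using less.prems(5) single(1) by blast
    show ?thesis
    proof (cases "count \<alpha> ?p = 0")
      case True
      have *: "f (scale (vec_vars ?p) 0 X) = f X" for X using homogD[OF hom, of 0 X] True by simp
      show ?thesis
      proof (rule less.hyps)
        show "card (V - {?p}) < card V" using single(1) less.prems(1) by (meson card_Diff1_less)
        show "f \<in> polyfun (vecs_vars (V - {?p}))"
        proof (rule polyfun_restrict[OF less.prems(2)])
          fix X Y :: "'a point" assume eq: "\<And>v. v \<in> vecs_vars (V - {?p}) \<Longrightarrow> X v = Y v"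
          have "f (scale (vec_vars ?p) 0 X) = f (scale (vec_vars ?p) 0 Y)"
            by (rule polyfun_cong[OF less.prems(2)]) (use eq in \<open>auto simp: scale_def\<close>)
          then show "f X = f Y" by (simp only: *)
        qed
      qed (use less.prems True in \<open>auto simp: count_eq_zero_iff\<close>)
    next
      case False
      let ?n = "count \<alpha> ?p"
      obtain t :: 'a where t: "t \<noteq> 0" "t ^ ?n \<noteq> 1"
      proof -
        have "monom 1 ?n \<noteq> (1 :: 'a poly)" using False by (simp add: monom_eq_1_iff)
        then have "monom 1 ?n - 1 \<noteq> (0 :: 'a poly)" by simp
        from poly_nonroot[OF this, of "{0}"] show ?thesis using that by (auto simp: poly_monom)
      qed
      have key: "X (c, False, k) * f X = 0" for X
      proof (cases "X (c, False, k) = 0")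
        case nz: False
        \<comment> \<open>\<open>Y s\<close> replaces the vector by \<open>(s, 0)\<close>; comparing \<open>s = t\<close> with \<open>s = 1\<close> contradicts the degree\<close>
        define Y where "Y s = (\<lambda>(c', i, k'). if c' = c \<and> k' = k then if i then 0 else s else X (c', i, k'))"
          for s :: 'a
        have fY: "f X = f (Y s)" if s: "s \<noteq> 0" for s
        proof -
          define g where "g = M2 (s / X (c, False, k)) 0 (- X (c, True, k) / s) (X (c, False, k) / s)"
          have g: "det2 g = 1" using nz s by (simp add: g_def det2_def)
          have "f (sl_act UNIV (if c then 1 else g) (if c then g else 1) X) = f X"
            by (rule sl_invariantD[OF less.prems(3)]) (use g in \<open>auto simp: det2_def one_m2_def\<close>)
          moreover have "f (sl_act UNIV (if c then 1 else g) (if c then g else 1) X) = f (Y s)"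
          proof (rule polyfun_cong[OF less.prems(2)])
            fix v assume v: "v \<in> vecs_vars V"
            obtain c' i k' where v': "v = (c', i, k')" by (cases v)
            show "sl_act UNIV (if c then 1 else g) (if c then g else 1) X v = Y s v"
            proof (cases "c' = c")
              case True
              then have "k' = k" using v v' single(2) by auto
              with True show ?thesis using nz s unfolding v'
                by (cases i) (auto simp: sl_act_def Y_def g_def entry_def field_simps)
            next
              case False
              then show ?thesis unfolding v'
                by (cases c'; cases c; cases i) (auto simp: sl_act_def Y_def one_m2_def entry_def)
            qed
          qed
          ultimately show ?thesis by simp
        qed
        have "Y t = scale (vec_vars ?p) t (Y 1)"
          by (auto simp: Y_def scale_def fun_eq_iff)
        then have "f (Y t) = t ^ ?n * f (Y 1)" using homogD[OF hom] by simp
        then have "f X = t ^ ?n * f X" using fY[OF t(1)] fY[of 1] by simp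
        then have "(1 - t ^ ?n) * f X = 0" by (simp add: algebra_simps)
        then show ?thesis using t(2) by simp
      qed simp
      have "f X = 0" for X
        by (rule polyfun_mult_eq_0[OF polyfun.var[of "(c, False, k)" "vecs_vars V"] less.prems(2) key, of "\<lambda>_. 1"])
           (use single(1) in auto)
      then have "f = (\<lambda>X. 0)" by auto
      then show ?thesis using minor_span.zero by simp
    qed
  qed
qed

end

section \<open>Traces of alternating words\<close>

text \<open>
  The letters are alternately the matrices and their adjugates, beginning with an adjugate if
  \<open>b\<close> holds. Under the group action
  \<open>x\<^sub>1 x\<^sub>2\<^sup>* x\<^sub>3 \<dots>\<close> is multiplied from the left by
  \<open>g\<close> and the inner group elements cancel.
\<close>

fun word :: "bool \<Rightarrow> nat list \<Rightarrow> 'a::comm_ring_1 point \<Rightarrow> 'a m2" where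
  "word b [] X = 1"
| "word b (k # w) X = (if b then adj2 (mtx X k) else mtx X k) * word (\<not> b) w X"

definition trace_word :: "nat list \<Rightarrow> 'a::comm_ring_1 point \<Rightarrow> 'a" where
  "trace_word w X = tr2 (word False w X)"

definition scalar2 :: "'a::comm_ring_1 \<Rightarrow> 'a m2" where
  "scalar2 c = M2 c 0 0 c"

lemma scalar2_mult: "scalar2 c * scalar2 d = scalar2 (c * d)"
  by (simp add: scalar2_def m2_simps)

lemma scalar2_one: "scalar2 1 = 1"
  by (simp add: scalar2_def m2_simps)

lemma scalar2_comm: "x * scalar2 c = scalar2 c * x"
  by (cases x) (simp add: scalar2_def m2_simps mult.commute)

lemma scalar2_left: "x * (scalar2 c * y) = scalar2 c * (x * y)"
  by (metis mult.assoc scalar2_comm)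

lemma tr2_scalar2: "tr2 (scalar2 c * x) = c * tr2 x"
  by (cases x) (simp add: scalar2_def m2_simps tr2_def algebra_simps)

lemma tr2_diff: "tr2 (x - y) = tr2 x - tr2 y"
  by (simp add: tr2_def m2_simps)

lemma tr2_comm: "tr2 (x * y) = tr2 (y * x)"
  by (simp add: tr2_def m2_simps algebra_simps)

lemma adj2_mult: "adj2 (x * y) = adj2 y * adj2 x"
  by (simp add: adj2_def m2_simps algebra_simps)

lemma adj2_scalar2: "adj2 (scalar2 c * x) = scalar2 c * adj2 x"
  by (simp add: scalar2_def adj2_def m2_simps)

lemma mult_adj2: "x * adj2 x = scalar2 (det2 x)"
  by (simp add: adj2_def m2_simps scalar2_def det2_def algebra_simps)

lemma adj2_mult_self: "adj2 x * x = scalar2 (det2 x)"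
  by (simp add: adj2_def m2_simps scalar2_def det2_def algebra_simps)

text \<open>
  The polarised forms of \<open>x x\<^sup>* = det x\<close> and \<open>x\<^sup>* x = det x\<close>.
\<close>

lemma adj2_swap:
  "x * adj2 y = scalar2 (tr2 (x * adj2 y)) - y * adj2 x"
  "adj2 x * y = scalar2 (tr2 (x * adj2 y)) - adj2 y * x"
  by (simp_all add: adj2_def m2_simps scalar2_def tr2_def algebra_simps)

lemma adj2_swap_mult:
  "x * (adj2 y * v) = scalar2 (tr2 (x * adj2 y)) * v - y * (adj2 x * v)"
  "adj2 x * (y * v) = scalar2 (tr2 (x * adj2 y)) * v - adj2 y * (x * v)"
  by (simp_all only: mult.assoc[symmetric] left_diff_distrib[symmetric] adj2_swap[symmetric])

lemma tr2_adj2_comm: "tr2 (x * adj2 y) = tr2 (y * adj2 x)"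
  by (simp add: adj2_def m2_simps tr2_def algebra_simps)

lemma word_append:
  "word b (u @ v) X = word b u X * word (if even (length u) then b else \<not> b) v X"
  by (induction u arbitrary: b) (auto simp: mult.assoc)

lemma word_swap:
  "word b (k # l # v) X = scalar2 (trace_word [k, l] X) * word b v X - word b (l # k # v) X"
  using adj2_swap_mult[of "mtx X k" "mtx X l" "word b v X"] by (cases b) (simp_all add: trace_word_def)

text \<open>
  Up to products of shorter traces, a trace changes only by its sign when neighbouring letters are
  interchanged.
\<close>

lemma trace_word_swap: "trace_word (u @ k # l # v) X = trace_word [k, l] X * trace_word (u @ v) X - trace_word (u @ l # k # v) X"
  unfolding trace_word_def[of "u @ _"] word_append word_swap[of _ k l]
  by (simp add: right_diff_distrib tr2_diff scalar2_left tr2_scalar2 del: word.simps)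

lemma trace_word_square: "trace_word (u @ k # k # v) X = det2 (mtx X k) * trace_word (u @ v) X"
proof -
  have "x * (adj2 x * v) = scalar2 (det2 x) * v" "adj2 x * (x * v) = scalar2 (det2 x) * v" for x v :: "'a m2"
    by (simp_all add: mult_adj2 adj2_mult_self flip: mult.assoc)
  then show ?thesis unfolding trace_word_def word_append by (simp add: scalar2_left tr2_scalar2)
qed

lemma trace_word_pair_comm: "trace_word [k, l] = trace_word [l, k]"
  by (rule ext) (simp add: trace_word_def tr2_adj2_comm)

section \<open>The graded algebra of determinants and traces\<close>

text \<open>
  The homogeneous components of the algebra generated by determinants and traces of strictly sorted words.
  The degree is a multiset of matrix indices; keeping it in the definition makes it possible to split off
  the multilinear terms of a given degree later.
\<close>

inductive graded_alg :: "nat multiset \<Rightarrow> ('a::comm_ring_1 point \<Rightarrow> 'a) \<Rightarrow> bool" where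
  zero: "graded_alg \<alpha> (\<lambda>X. 0)"
| const: "graded_alg {#} (\<lambda>X. c)"
| add: "graded_alg \<alpha> f \<Longrightarrow> graded_alg \<alpha> g \<Longrightarrow> graded_alg \<alpha> (\<lambda>X. f X + g X)"
| mult: "graded_alg \<alpha> f \<Longrightarrow> graded_alg \<beta> g \<Longrightarrow> graded_alg (\<alpha> + \<beta>) (\<lambda>X. f X * g X)"
| det: "graded_alg {#k, k#} (\<lambda>X. det2 (mtx X k))"
| tr: "sorted_wrt (<) w \<Longrightarrow> even (length w) \<Longrightarrow> w \<noteq> [] \<Longrightarrow> graded_alg (mset w) (trace_word w)"

lemma graded_alg_smult: "graded_alg \<alpha> f \<Longrightarrow> graded_alg \<alpha> (\<lambda>X. c * f X)"
  using graded_alg.mult[OF graded_alg.const] by fastforce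

lemma graded_alg_diff: "graded_alg \<alpha> f \<Longrightarrow> graded_alg \<alpha> g \<Longrightarrow> graded_alg \<alpha> (\<lambda>X. f X - g X)"
  using graded_alg.add[OF _ graded_alg_smult[of \<alpha> g "-1"], of f] by simp

lemma graded_alg_trace_word_pair: "graded_alg {#k, l#} (trace_word [k, l] :: 'a::comm_ring_1 point \<Rightarrow> 'a)"
proof (cases k l rule: linorder_cases)
  case equal
  have "trace_word [l, l] = (\<lambda>X. 2 * det2 (mtx X l) :: 'a)"
    by (rule ext) (simp add: trace_word_def tr2_def det2_def adj2_def m2_simps algebra_simps)
  with equal show ?thesis using graded_alg_smult[OF graded_alg.det[of l], of "2 :: 'a"] by simp
next
  case less
  then show ?thesis using graded_alg.tr[of "[k, l]"] by simp
next
  case greater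
  then show ?thesis using graded_alg.tr[of "[l, k]"] by (simp add: trace_word_pair_comm[of k l] add_mset_commute)
qed

lemma insort_split: "\<exists>b c. xs = b @ c \<and> insort k xs = b @ k # c"
proof (induction xs)
  case (Cons x xs)
  then obtain b c where "xs = b @ c" "insort k xs = b @ k # c" by blast
  then show ?case
    by (cases "k \<le> x") (auto intro: exI[of _ "[]"] exI[of _ "x # b"])
qed simp

lemma sorted_not_distinct_split:
  "sorted xs \<Longrightarrow> \<not> distinct xs \<Longrightarrow> \<exists>u k v. xs = u @ k # k # v"
proof (induction xs)
  case (Cons x xs)
  show ?case
  proof (cases "x \<in> set xs")
    case True
    then obtain y ys where xs: "xs = y # ys" by (cases xs) auto
    then have "y = x" using True Cons.prems(1) by auto
    then show ?thesis using xs by (intro exI[of _ "[]"]) auto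
  next
    case False
    then obtain u k v where "xs = u @ k # k # v" using Cons by auto
    then show ?thesis by (intro exI[of _ "x # u"]) auto
  qed
qed simp

text \<open>
  Induction on the length. Interchanging neighbours only changes a trace by products of shorter ones, so
  the word may be sorted; two equal neighbours in the sorted word split off a determinant.
\<close>

lemma graded_alg_trace_word:
  "even (length w) \<Longrightarrow> graded_alg (mset w) (trace_word w :: 'a::comm_ring_1 point \<Rightarrow> 'a)"
proof (induction "length w" arbitrary: w rule: less_induct)
  case less
  define G where "G v \<longleftrightarrow> graded_alg (mset w) (trace_word v :: 'a point \<Rightarrow> 'a)" for v
  have swap: "G (u @ k # l # v)"
    if "G (u @ l # k # v)" "mset (u @ k # l # v) = mset w" for u k l v
  proof -
    have len: "length w = length u + length v + 2" using arg_cong[OF that(2), of size] by simp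
    then have "graded_alg (mset (u @ v)) (trace_word (u @ v) :: 'a point \<Rightarrow> 'a)" using less.prems by (intro less.hyps) auto
    from graded_alg.mult[OF graded_alg_trace_word_pair this]
    have "graded_alg (mset w) (\<lambda>X. trace_word [k, l] X * trace_word (u @ v) X :: 'a)"
      unfolding that(2)[symmetric] by simp
    from graded_alg_diff[OF this that(1)[unfolded G_def]] have "graded_alg (mset w) (\<lambda>X. trace_word [k, l] X * trace_word (u @ v) X - trace_word (u @ l # k # v) X :: 'a)" .
    moreover have "trace_word (u @ k # l # v) = (\<lambda>X. trace_word [k, l] X * trace_word (u @ v) X - trace_word (u @ l # k # v) X :: 'a)"
      by (rule ext, rule trace_word_swap)
    ultimately show ?thesis by (simp add: G_def)
  qed
  have move: "G (u @ k # b @ c)"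
    if "G (u @ b @ k # c)" "mset (u @ b @ k # c) = mset w" for u k b c
    using that
  proof (induction b arbitrary: u)
    case (Cons x b)
    have "G ((u @ [x]) @ k # b @ c)" by (rule Cons.IH) (use Cons.prems in auto)
    then have "G (u @ x # k # b @ c)" by simp
    from swap[OF this] show ?case using Cons.prems(2) by (simp add: add_mset_commute)
  qed simp
  have sort: "G (u @ v)"
    if "G (u @ sort v)" "mset (u @ v) = mset w" for u v
    using that
  proof (induction v arbitrary: u)
    case (Cons k v)
    obtain b c where bc: "sort v = b @ c" "insort k (sort v) = b @ k # c" using insort_split by blast
    have "mset v = mset b + mset c" by (metis bc(1) mset_append mset_sort)
    then have "G (u @ k # b @ c)"
      by (intro move) (use Cons.prems bc in auto)
    then have "G ((u @ [k]) @ sort v)" using bc by simp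
    from Cons.IH[OF this] show ?case using Cons.prems(2) by simp
  qed simp
  have "G (sort w)"
  proof (cases "w = []")
    case True
    have "trace_word [] = (\<lambda>X. 2 :: 'a)" by (rule ext) (simp add: trace_word_def tr2_def one_m2_def)
    with True show ?thesis using graded_alg.const by (simp add: G_def)
  next
    case ne: False
    show ?thesis
    proof (cases "distinct w")
      case True
      have "graded_alg (mset (sort w)) (trace_word (sort w) :: 'a point \<Rightarrow> 'a)"
      proof (rule graded_alg.tr)
        show "sorted_wrt (<) (sort w)" using True by (simp add: strict_sorted_iff)
        show "sort w \<noteq> []" using ne by (metis length_0_conv length_sort)
      qed (use less.prems in simp)
      then show ?thesis by (simp add: G_def)
    next
      case False
      then obtain u k v where s: "sort w = u @ k # k # v"
        using sorted_not_distinct_split[of "sort w"] by auto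
      then have len: "length w = length u + length v + 2" by (metis length_sort length_append length_Cons add_Suc_right add_2_eq_Suc')
      then have "graded_alg (mset (u @ v)) (trace_word (u @ v) :: 'a point \<Rightarrow> 'a)" using less.prems by (intro less.hyps) auto
      from graded_alg.mult[OF graded_alg.det this, of k] have "graded_alg (mset (sort w)) (\<lambda>X. det2 (mtx X k) * trace_word (u @ v) X :: 'a)"
        unfolding s by (simp add: add_mset_commute)
      moreover have "trace_word (sort w) = (\<lambda>X. det2 (mtx X k) * trace_word (u @ v) X :: 'a)"
        unfolding s by (rule ext, rule trace_word_square)
      ultimately show ?thesis by (simp add: G_def)
    qed
  qed
  from sort[of "[]" w, simplified, OF this] show ?case by (simp add: G_def)
qed

section \<open>Invariance and homogeneity of the traces\<close>

definition mat_vars :: "nat \<Rightarrow> (bool \<times> bool \<times> nat) set" where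
  "mat_vars k = UNIV \<times> UNIV \<times> {k}"

lemma mat_vars_iff [simp]: "(i, j, l) \<in> mat_vars k \<longleftrightarrow> l = k"
  by (auto simp: mat_vars_def)

definition mats_vars :: "nat set \<Rightarrow> (bool \<times> bool \<times> nat) set" where
  "mats_vars M = UNIV \<times> UNIV \<times> M"

lemma mats_vars_iff [simp]: "(i, j, k) \<in> mats_vars M \<longleftrightarrow> k \<in> M"
  by (auto simp: mats_vars_def)

lemma word_polyfun:
  assumes "set w \<subseteq> M"
  shows "(\<lambda>X :: 'a::comm_ring_1 point. e00 (word b w X)) \<in> polyfun (mats_vars M) \<and>
    (\<lambda>X :: 'a point. e01 (word b w X)) \<in> polyfun (mats_vars M) \<and>
    (\<lambda>X :: 'a point. e10 (word b w X)) \<in> polyfun (mats_vars M) \<and>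
    (\<lambda>X :: 'a point. e11 (word b w X)) \<in> polyfun (mats_vars M)"
  using assms
proof (induction w arbitrary: b)
  case Nil
  then show ?case by (simp add: one_m2_def polyfun.const)
next
  case (Cons k w)
  show ?case using Cons.IH[of True] Cons.IH[of False] Cons.prems
    by (cases b) (auto simp: times_m2_def mtx_def adj2_def intro!: polyfun_intros)
qed

lemma trace_word_polyfun: "set w \<subseteq> M \<Longrightarrow> trace_word w \<in> polyfun (mats_vars M)"
  using word_polyfun[of w M False] by (auto simp: trace_word_def[abs_def] tr2_def intro!: polyfun_intros)

lemma mtx_sl_act: "k \<notin> J \<Longrightarrow> mtx (sl_act J g h X) k = g * mtx X k * transp2 h"
  unfolding mtx_def[of "sl_act J g h X"] by (simp add: sl_act_def entry_def)

lemma det2_transp2: "det2 (transp2 h) = det2 h"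
  by (simp add: det2_def transp2_def mult.commute)

lemma word_act:
  assumes g: "det2 g = 1" and h: "det2 h = 1"
  shows "word b w (sl_act {} g h X) = (if b then adj2 (transp2 h) else g) * word b w X *
    (if even (length w) = b then transp2 h else adj2 g)"
proof (induction w arbitrary: b)
  case Nil
  show ?case using g h by (auto simp: mult_adj2 adj2_mult_self scalar2_one det2_transp2)
next
  case (Cons k w)
  have 1: "adj2 g * (g * y) = y" "transp2 h * (adj2 (transp2 h) * y) = y" for y
    by (simp_all add: mult_adj2 adj2_mult_self scalar2_one g h det2_transp2 flip: mult.assoc)
  show ?case
  proof (cases b)
    case True
    then show ?thesis by (simp add: Cons.IH[of False] mtx_sl_act adj2_mult mult.assoc 1)
  next
    case False
    then show ?thesis by (simp add: Cons.IH[of True] mtx_sl_act mult.assoc 1)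
  qed
qed

lemma trace_word_invariant: "even (length w) \<Longrightarrow> sl_invariant {} (trace_word w)"
  unfolding sl_invariant_def trace_word_def
proof (intro allI impI)
  fix g h :: "'a m2" and X :: "'a point"
  assume "even (length w)" and g: "det2 g = 1" and h: "det2 h = 1"
  then have "tr2 (word False w (sl_act {} g h X)) = tr2 (g * word False w X * adj2 g)"
    by (simp add: word_act)
  also have "\<dots> = tr2 (adj2 g * (g * word False w X))" by (rule tr2_comm)
  also have "\<dots> = tr2 (word False w X)" by (simp add: adj2_mult_self g scalar2_one flip: mult.assoc)
  finally show "tr2 (word False w (sl_act {} g h X)) = tr2 (word False w X)" .
qed

lemma word_scale: "word b w (scale (mat_vars k) t X) = scalar2 (t ^ count (mset w) k) * word b w X"
proof (induction w arbitrary: b)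
  case Nil
  then show ?case by (simp add: scalar2_one)
next
  case (Cons l w)
  define s where "s = (if l = k then t else 1)"
  define x where "x = (if b then adj2 (mtx X l) else mtx X l)"
  define c where "c = t ^ count (mset w) k"
  have "mtx (scale (mat_vars k) t X) l = scalar2 s * mtx X l"
    by (simp add: mtx_def scale_def scalar2_def s_def m2_simps)
  then have "word b (l # w) (scale (mat_vars k) t X) = (scalar2 s * x) * (scalar2 c * word (\<not> b) w X)"
    by (cases b) (simp_all add: Cons.IH adj2_scalar2 x_def c_def)
  also have "\<dots> = scalar2 s * (x * (scalar2 c * word (\<not> b) w X))" by (rule mult.assoc)
  also have "x * (scalar2 c * word (\<not> b) w X) = scalar2 c * (x * word (\<not> b) w X)" by (rule scalar2_left)
  also have "scalar2 s * (scalar2 c * (x * word (\<not> b) w X)) = scalar2 (s * c) * (x * word (\<not> b) w X)"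
    by (simp only: mult.assoc[symmetric] scalar2_mult)
  also have "s * c = t ^ count (mset (l # w)) k" by (simp add: s_def c_def)
  also have "x * word (\<not> b) w X = word b (l # w) X" by (simp add: x_def)
  finally show ?case .
qed

lemma trace_word_homog: "homog (mat_vars k) (count (mset w) k) (trace_word w)"
  by (simp add: homog_def trace_word_def word_scale tr2_scalar2)

lemma det2_mult: "det2 (x * y) = det2 x * det2 y"
  by (simp add: det2_def m2_simps algebra_simps)

lemma det_invariant: "sl_invariant {} (\<lambda>X. det2 (mtx X k))"
  unfolding sl_invariant_def
proof (intro allI impI)
  fix g h :: "'a m2" and X :: "'a point"
  assume g: "det2 g = 1" and h: "det2 h = 1"
  then show "det2 (mtx (sl_act {} g h X) k) = det2 (mtx X k)"
    by (simp add: mtx_sl_act det2_mult det2_transp2)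
qed

lemma det_homog: "homog (mat_vars k) (count {#l, l#} k) (\<lambda>X. det2 (mtx X l))"
  by (auto simp: homog_def det2_def mtx_def scale_def power2_eq_square algebra_simps)

lemma det_polyfun: "k \<in> M \<Longrightarrow> (\<lambda>X. det2 (mtx X k)) \<in> polyfun (mats_vars M)"
  by (auto simp: det2_def mtx_def intro!: polyfun_intros)

text \<open>
  A multiset degree \<open>\<alpha>\<close> really means degree \<open>count \<alpha> k\<close> in the
  \<open>k\<close>-th matrix.
\<close>

lemma graded_alg_props:
  assumes "graded_alg \<alpha> f"
  shows "(set_mset \<alpha> \<subseteq> M \<longrightarrow> f \<in> polyfun (mats_vars M)) \<and> sl_invariant {} f \<and> (\<forall>k. homog (mat_vars k) (count \<alpha> k) f)"
  using assms
proof (induction rule: graded_alg.induct)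
  case (tr w)
  then show ?case using trace_word_polyfun trace_word_invariant trace_word_homog by auto
next
  case (det k)
  show ?case
  proof (intro conjI allI impI)
    show "homog (mat_vars l) (count {#k, k#} l) (\<lambda>X. det2 (mtx X k))" for l by (rule det_homog)
  qed (auto intro: det_polyfun det_invariant)
next
  case (mult \<alpha> f \<beta> g)
  then show ?case by (auto intro!: polyfun_intros homog_mult sl_invariant_mult)
next
  case (add \<alpha> f g)
  then show ?case by (auto intro!: polyfun_intros homog_add sl_invariant_add)
qed (auto intro: polyfun.const homog_const homog_zero simp: sl_invariant_def)

section \<open>Closing up products of minors\<close>

text \<open>
  The vectors of a split index \<open>k\<close> are multiplied to the rank one matrix
  \<open>u\<^sub>k v\<^sub>k\<^sup>T\<close>.
\<close>

definition split_pt :: "nat set \<Rightarrow> 'a::comm_ring_1 point \<Rightarrow> 'a point" where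
  "split_pt J X = (\<lambda>(i, j, k). if k \<in> J then X (False, i, k) * X (True, j, k) else X (i, j, k))"

definition outer :: "nat \<Rightarrow> nat \<Rightarrow> 'a::comm_ring_1 point \<Rightarrow> 'a m2" where
  "outer a b X = M2 (X (False, False, a) * X (True, False, b)) (X (False, False, a) * X (True, True, b))
                    (X (False, True, a) * X (True, False, b)) (X (False, True, a) * X (True, True, b))"

lemma mtx_split_pt: "k \<in> J \<Longrightarrow> mtx (split_pt J X) k = outer k k X"
  "k \<notin> J \<Longrightarrow> mtx (split_pt J X) k = mtx X k"
  by (simp_all add: mtx_def split_pt_def outer_def)

lemma scalar2_scalar2: "scalar2 a * (scalar2 b * x) = scalar2 (a * b) * x"
  by (simp only: mult.assoc[symmetric] scalar2_mult)

text \<open>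
  Extending a path by two rank one matrices: the adjugate of \<open>u v\<^sup>T\<close> is again of rank
  one, built from the rotated vectors, and pairing neighbouring vectors yields minors.
\<close>

lemma outer_step: "outer a b X * (adj2 (outer k k X) * outer l l X) =
    scalar2 (minor True b k X * (- minor False k l X)) * outer a l X"
  by (simp add: outer_def adj2_def m2_simps scalar2_def minor_def algebra_simps)

text \<open>
  Closing a path of even length to a cycle.
\<close>

lemma outer_close: "tr2 (outer a b X * adj2 (outer k k X)) = minor True b k X * (- minor False k a X)"
  by (simp add: outer_def adj2_def m2_simps tr2_def minor_def algebra_simps)

definition uv_mset :: "nat multiset \<Rightarrow> nat multiset \<Rightarrow> (bool \<times> nat) multiset" where
  "uv_mset \<rho> \<sigma> = image_mset (Pair False) \<rho> + image_mset (Pair True) \<sigma>"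

lemma count_uv_mset: "count (uv_mset \<rho> \<sigma>) (c, k) = (if c then count \<sigma> k else count \<rho> k)"
proof -
  have "count (image_mset (Pair c') \<rho>) (c, k) = (if c = c' then count \<rho> k else 0)" for c' :: bool and \<rho> :: "nat multiset"
    by (induction \<rho>) auto
  then show ?thesis by (auto simp: uv_mset_def)
qed

lemma uv_mset_add:
  "uv_mset (add_mset k \<rho>) \<sigma> = add_mset (False, k) (uv_mset \<rho> \<sigma>)"
  "uv_mset \<rho> (add_mset k \<sigma>) = add_mset (True, k) (uv_mset \<rho> \<sigma>)"
  by (simp_all add: uv_mset_def)

lemma minor_mono_uv_extract_True:
  assumes "minor_mono (uv_mset \<rho> (add_mset b \<sigma>)) f"
  shows "\<exists>k f' \<sigma>'. \<sigma> = add_mset k \<sigma>' \<and> minor_mono (uv_mset \<rho> \<sigma>') f' \<and> f = (\<lambda>X. minor True b k X * f' X)"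
proof -
  from minor_mono_extract[OF assms, of True b] obtain k f' \<beta> where
    *: "uv_mset \<rho> (add_mset b \<sigma>) = add_mset (True, b) (add_mset (True, k) \<beta>)" "minor_mono \<beta> f'"
    "f = (\<lambda>X. minor True b k X * f' X)" by (auto simp: uv_mset_add)
  then have \<beta>: "uv_mset \<rho> \<sigma> = add_mset (True, k) \<beta>" by (simp add: uv_mset_add)
  then have "(True, k) \<in># uv_mset \<rho> \<sigma>" by simp
  then have "k \<in># \<sigma>" by (auto simp: uv_mset_def)
  then obtain \<sigma>' where "\<sigma> = add_mset k \<sigma>'" by (meson multi_member_split)
  moreover from this \<beta> have "\<beta> = uv_mset \<rho> \<sigma>'" by (simp add: uv_mset_add)
  ultimately show ?thesis using * by blast
qed

lemma minor_mono_uv_extract_False: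
  assumes "minor_mono (uv_mset (add_mset b \<rho>) \<sigma>) f"
  shows "\<exists>k f' \<rho>'. \<rho> = add_mset k \<rho>' \<and> minor_mono (uv_mset \<rho>' \<sigma>) f' \<and> f = (\<lambda>X. (- minor False b k X) * f' X)"
proof -
  from minor_mono_extract[OF assms, of False b] obtain k f' \<beta> where
    *: "uv_mset (add_mset b \<rho>) \<sigma> = add_mset (False, b) (add_mset (False, k) \<beta>)" "minor_mono \<beta> f'"
    "f = (\<lambda>X. minor False b k X * f' X)" by (auto simp: uv_mset_add)
  then have \<beta>: "uv_mset \<rho> \<sigma> = add_mset (False, k) \<beta>" by (simp add: uv_mset_add)
  then have "(False, k) \<in># uv_mset \<rho> \<sigma>" by simp
  then have "k \<in># \<rho>" by (auto simp: uv_mset_def)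
  then obtain \<rho>' where \<rho>: "\<rho> = add_mset k \<rho>'" by (meson multi_member_split)
  then have "\<beta> = uv_mset \<rho>' \<sigma>" using \<beta> by (simp add: uv_mset_add)
  then have "minor_mono (uv_mset \<rho>' \<sigma>) (\<lambda>X. - f' X)" using minor_mono_uminus[OF *(2)] by simp
  with \<rho> *(3) show ?thesis
    by (intro exI[of _ k] exI[of _ "\<lambda>X. - f' X"] exI[of _ \<rho>'] conjI) auto
qed

text \<open>
  The first part is the aim: a product of minors in which \<open>u\<^sub>k\<close> and
  \<open>v\<^sub>k\<close> occur equally often is the value of an element of the graded algebra at rank one
  matrices. The second part is the same for a partially traversed cycle: the word \<open>w\<close> records
  the path walked so far, whose ends are the vectors \<open>u\<^sub>a\<close> and \<open>v\<^sub>b\<close>,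
  and the minors not yet visited contain one \<open>u\<^sub>a\<close> and one \<open>v\<^sub>b\<close> more
  than a balanced product. From \<open>v\<^sub>b\<close> the walk goes along its minor to some
  \<open>v\<^sub>k\<close>, changes to \<open>u\<^sub>k\<close> and goes along its minor to some
  \<open>u\<^sub>l\<close>. If \<open>l = a\<close> the cycle is closed.
\<close>

lemma minor_mono_glue_aux:
  fixes f c :: "'a::comm_ring_1 point \<Rightarrow> 'a"
  shows "(minor_mono (uv_mset \<rho> \<rho>) f \<longrightarrow> (\<exists>A. graded_alg \<rho> A \<and> (\<forall>X. A (split_pt UNIV X) = f X))) \<and>
    (odd (length w) \<longrightarrow> (\<forall>X. word False w (split_pt UNIV X) = scalar2 (c X) * outer a b X) \<longrightarrow>
     minor_mono (uv_mset (add_mset a \<rho>) (add_mset b \<rho>)) f \<longrightarrow>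
     (\<exists>A. graded_alg (mset w + \<rho>) A \<and> (\<forall>X. A (split_pt UNIV X) = c X * f X)))"
proof (induction "size \<rho>" arbitrary: \<rho> f w c a b rule: less_induct)
  case less
  have 1: "\<exists>A. graded_alg \<rho> A \<and> (\<forall>X. A (split_pt UNIV X) = f X)"
    if f: "minor_mono (uv_mset \<rho> \<rho>) f" for f :: "'a point \<Rightarrow> 'a"
  proof (cases \<rho>)
    case empty
    have "\<exists>c. f = (\<lambda>X. c)"
      using f unfolding empty uv_mset_def by (cases rule: minor_mono.cases) auto
    then show ?thesis using empty graded_alg.const by blast
  next
    case (add k \<rho>')
    have "\<exists>A. graded_alg (mset [k] + \<rho>') A \<and> (\<forall>X. A (split_pt UNIV X) = 1 * f X)"
    proof (rule less.hyps[THEN conjunct2, rule_format])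
      show "word False [k] (split_pt UNIV X) = scalar2 1 * outer k k X" for X :: "'a point"
        by (simp add: mtx_split_pt scalar2_one)
    qed (use f add in auto)
    then show ?thesis using add by simp
  qed
  have 2: "\<exists>A. graded_alg (mset w + \<rho>) A \<and> (\<forall>X. A (split_pt UNIV X) = c X * f X)"
    if w: "odd (length w)" "\<And>X. word False w (split_pt UNIV X) = scalar2 (c X) * outer a b X"
      and f: "minor_mono (uv_mset (add_mset a \<rho>) (add_mset b \<rho>)) f"
    for w a b and c f :: "'a point \<Rightarrow> 'a"
  proof -
    from minor_mono_uv_extract_True[OF f] obtain k f1 \<rho>1 where
      k: "\<rho> = add_mset k \<rho>1" and f1: "minor_mono (uv_mset (add_mset a \<rho>) \<rho>1) f1" "f = (\<lambda>X. minor True b k X * f1 X)"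
      by blast
    have "minor_mono (uv_mset (add_mset k (add_mset a \<rho>1)) \<rho>1) f1" using f1(1) k by (simp add: add_mset_commute)
    from minor_mono_uv_extract_False[OF this] obtain l f2 \<rho>2 where
      l: "add_mset a \<rho>1 = add_mset l \<rho>2" and f2: "minor_mono (uv_mset \<rho>2 \<rho>1) f2" "f1 = (\<lambda>X. (- minor False k l X) * f2 X)"
      by blast
    show ?thesis
    proof (cases "l = a")
      case True
      then have "\<rho>2 = \<rho>1" using l by simp
      then obtain A where A: "graded_alg \<rho>1 A" "\<And>X. A (split_pt UNIV X) = f2 X"
        using less.hyps[THEN conjunct1, rule_format, of \<rho>1 f2] f2(1) k by auto
      have "trace_word (w @ [k]) (split_pt UNIV X) = c X * (minor True b k X * (- minor False k a X))" for X :: "'a point"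
        using w unfolding trace_word_def word_append
        by (simp add: mtx_split_pt mult.assoc tr2_scalar2 outer_close)
      then have "trace_word (w @ [k]) (split_pt UNIV X) * A (split_pt UNIV X) = c X * f X" for X
        unfolding f1(2) f2(2) A(2) True by (simp add: mult.assoc)
      moreover have "graded_alg (mset (w @ [k]) + \<rho>1) (\<lambda>X. trace_word (w @ [k]) X * A X)"
        by (rule graded_alg.mult[OF graded_alg_trace_word A(1)]) (use w(1) in simp)
      ultimately show ?thesis using k by (intro exI[of _ "\<lambda>X. trace_word (w @ [k]) X * A X"]) simp
    next
      case False
      then obtain \<rho>3 where \<rho>3: "\<rho>1 = add_mset l \<rho>3" "\<rho>2 = add_mset a \<rho>3"
        using l by (metis add_eq_conv_ex)
      have "\<exists>A. graded_alg (mset (w @ [k, l]) + \<rho>3) A \<and>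
        (\<forall>X. A (split_pt UNIV X) = (c X * (minor True b k X * (- minor False k l X))) * f2 X)"
      proof (rule less.hyps[THEN conjunct2, rule_format])
        show "size \<rho>3 < size \<rho>" using k \<rho>3 by simp
        show "odd (length (w @ [k, l]))" using w(1) by simp
        show "minor_mono (uv_mset (add_mset a \<rho>3) (add_mset l \<rho>3)) f2" using f2(1) \<rho>3 by simp
        show "word False (w @ [k, l]) (split_pt UNIV X)
          = scalar2 (c X * (minor True b k X * (- minor False k l X))) * outer a l X" for X :: "'a point"
          using w unfolding word_append
          by (simp add: mtx_split_pt mult.assoc outer_step scalar2_scalar2)
      qed
      moreover have eq: "mset (w @ [k, l]) + \<rho>3 = mset w + \<rho>" using k \<rho>3 by simp
      ultimately show ?thesis unfolding f1(2) f2(2) eq by (simp add: mult.assoc)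
    qed
  qed
  show ?case using 1 2 by blast
qed

lemma minor_span_glue:
  assumes "minor_span (uv_mset \<rho> \<rho>) f"
  shows "\<exists>A. graded_alg \<rho> A \<and> (\<forall>X. A (split_pt UNIV X) = f X)"
proof -
  have "\<exists>A. graded_alg \<rho> A \<and> (\<forall>X. A (split_pt UNIV X) = f X)" if "minor_span \<alpha> f" "\<alpha> = uv_mset \<rho> \<rho>" for \<alpha>
    using that
  proof (induction rule: minor_span.induct)
    case (zero \<alpha>)
    show ?case using graded_alg.zero by blast
  next
    case (mon \<alpha> f)
    then show ?case using minor_mono_glue_aux by blast
  next
    case (add \<alpha> f g)
    then obtain A B where "graded_alg \<rho> A" "\<And>X. A (split_pt UNIV X) = f X" "graded_alg \<rho> B" "\<And>X. B (split_pt UNIV X) = g X"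
      by blast
    then show ?case by (intro exI[of _ "\<lambda>X. A X + B X"]) (auto intro: graded_alg.add)
  qed
  then show ?thesis using assms by blast
qed

section \<open>Invariants of matrices\<close>

lemma split_pt_act: "split_pt J (sl_act (J \<union> J') g h X) = sl_act J' g h (split_pt J X)" if "J \<inter> J' = {}"
proof
  fix v :: "bool \<times> bool \<times> nat"
  obtain i j k where v: "v = (i, j, k)" by (cases v)
  show "split_pt J (sl_act (J \<union> J') g h X) v = sl_act J' g h (split_pt J X) v"
  proof (cases "k \<in> J")
    case True
    then show ?thesis using that unfolding v
      by (cases i; cases j)
         (auto simp: split_pt_def sl_act_def entry_def mtx_def m2_simps transp2_def algebra_simps)
  next
    case False
    then show ?thesis unfolding v by (auto simp: split_pt_def sl_act_def mtx_def)
  qed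
qed

lemma split_pt_scale_vec:
  "k \<in> J \<Longrightarrow> split_pt J (scale (vec_vars (c, k)) t X) = scale (mat_vars k) t (split_pt J X)"
  by (cases c) (auto simp: split_pt_def scale_def fun_eq_iff algebra_simps)

lemma split_pt_scale_vec_other:
  "k \<notin> J \<Longrightarrow> split_pt J (scale (vec_vars (c, k)) t X) = scale (vec_vars (c, k)) t (split_pt J X)"
  by (auto simp: split_pt_def scale_def fun_eq_iff)

lemma split_pt_scale_mat:
  "k \<notin> J \<Longrightarrow> split_pt J (scale (mat_vars k) t X) = scale (mat_vars k) t (split_pt J X)"
  by (auto simp: split_pt_def scale_def fun_eq_iff)

lemma split_pt_split_pt: "J \<inter> J' = {} \<Longrightarrow> split_pt J (split_pt J' X) = split_pt (J \<union> J') X"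
  by (auto simp: split_pt_def fun_eq_iff)

lemma split_pt_polyfun:
  assumes "f \<in> polyfun (mats_vars M)"
  shows "(\<lambda>X. f (split_pt J X)) \<in> polyfun (mats_vars M)"
proof (rule polyfun_compose[OF assms])
  fix v assume "v \<in> mats_vars M"
  then show "(\<lambda>X. split_pt J X v) \<in> polyfun (mats_vars M)"
    by (cases v) (auto simp: split_pt_def intro!: polyfun_intros)
qed

context infinite_field begin

text \<open>
  A matrix of determinant zero with nonzero upper left entry is of rank one, and the corresponding vectors
  can be written down.
\<close>

lemma vanishing_det_dvd:
  fixes f :: "'a point \<Rightarrow> 'a"
  assumes f: "f \<in> polyfun (mats_vars M)" and k: "k \<in> M"
    and van: "\<And>X. f (split_pt {k} X) = 0"
  shows "\<exists>h\<in>polyfun (mats_vars M). \<forall>X. f X = det2 (mtx X k) * h X"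
proof -
  have "\<exists>h\<in>polyfun (mats_vars M). \<forall>X. f X =
      (X (False, False, k) * X (True, True, k) - X (False, True, k) * X (True, False, k)) * h X"
  proof (rule polyfun_det_dvd[OF f])
    fix X :: "'a point"
    assume nz: "X (False, False, k) \<noteq> 0"
      and eq: "X (False, False, k) * X (True, True, k) = X (False, True, k) * X (True, False, k)"
    define Y where "Y = (\<lambda>(c, i, l). if l = k then if c then X (False, i, k)
      else if i then X (True, False, k) / X (False, False, k) else 1 else X (c, i, l))"
    have "X = split_pt {k} Y"
    proof
      fix v :: "bool \<times> bool \<times> nat"
      obtain i j l where v: "v = (i, j, l)" by (cases v)
      show "X v = split_pt {k} Y v"
        using nz eq unfolding v by (cases i; cases j) (auto simp: split_pt_def Y_def field_simps)
    qed
    then show "f X = 0" using van[of Y] by simp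
  qed (use k in auto)
  then show ?thesis by (simp add: det2_def mtx_def)
qed

lemma det2_mtx_nonzero: "det2 (mtx (\<lambda>(i, j, l). if i = j then 1 else (0 :: 'a)) k) \<noteq> 0"
  by (simp add: det2_def mtx_def)

lemma det_homog_vec:
  "k \<noteq> l \<Longrightarrow> homog (vec_vars (c, l)) 0 (\<lambda>X. det2 (mtx X k))"
  by (simp add: homog_def det2_def mtx_def scale_def)

lemma det_invariant_unsplit: "k \<notin> J \<Longrightarrow> sl_invariant J (\<lambda>X. det2 (mtx X k))"
  by (simp add: sl_invariant_def mtx_sl_act det2_mult det2_transp2)

lemma act_closed_mats_vars: "act_closed J (mats_vars M)"
  by (simp add: act_closed_def)

text \<open>
  The indices outside \<open>K\<close> are split. Induction on \<open>K\<close>: for \<open>K = {}\<close>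
  only vectors are left. To add an index \<open>k\<close>, restrict to rank one in the \<open>k\<close>-th
  matrix; the restriction comes from some \<open>A\<close> in the graded algebra by induction, and
  \<open>f\<close> differs from \<open>A\<close> by \<open>det x\<^sub>k\<close> times an invariant to
  which an inner induction on the degree applies. The quotient is invariant because
  \<open>det x\<^sub>k\<close> is an invariant that can be cancelled.
\<close>

theorem mixed_invariants:
  fixes f :: "'a point \<Rightarrow> 'a"
  assumes "finite K" and M: "finite M" "K \<subseteq> M"
    and "f \<in> polyfun (mats_vars M)" "sl_invariant (- K) f" "set_mset \<alpha> \<subseteq> M"
    and "\<And>k. k \<in> K \<Longrightarrow> homog (mat_vars k) (count \<alpha> k) f"
    and "\<And>k c. k \<in> M - K \<Longrightarrow> homog (vec_vars (c, k)) (count \<alpha> k) f"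
  shows "\<exists>A. graded_alg \<alpha> A \<and> (\<forall>X. A (split_pt (- K) X) = f X)"
  using assms(1,3-)
proof (induction K arbitrary: f \<alpha> rule: finite_induct)
  case empty
  have "minor_span (uv_mset \<alpha> \<alpha>) f"
  proof (rule vector_invariants[of "UNIV \<times> M"])
    have "vecs_vars (UNIV \<times> M) = mats_vars M" by auto
    then show "f \<in> polyfun (vecs_vars (UNIV \<times> M))" using empty by simp
    show "set_mset (uv_mset \<alpha> \<alpha>) \<subseteq> UNIV \<times> M" using empty by (auto simp: uv_mset_def)
    show "homog (vec_vars p) (count (uv_mset \<alpha> \<alpha>) p) f" if "p \<in> UNIV \<times> M" for p
      using empty.prems(6)[of "snd p" "fst p"] that by (cases p) (simp add: count_uv_mset)
  qed (use M empty in simp_all)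
  from minor_span_glue[OF this] show ?case by simp
next
  case (insert k K)
  let ?J = "- insert k K"
  have kM: "k \<in> M" and kJ: "k \<notin> ?J" using insert.prems by auto
  have J: "- K = insert k ?J" "insert k ?J = {k} \<union> ?J" using insert.hyps by auto
  show ?case
    using insert.prems
  proof (induction "size \<alpha>" arbitrary: f \<alpha> rule: less_induct)
    case less
    note prems = less.prems
    have "\<exists>A. graded_alg \<alpha> A \<and> (\<forall>X. A (split_pt (- K) X) = f (split_pt {k} X))"
    proof (rule insert.IH)
      show "K \<subseteq> M" using prems by auto
      show "(\<lambda>X. f (split_pt {k} X)) \<in> polyfun (mats_vars M)" by (rule split_pt_polyfun) (rule prems)
      show "sl_invariant (- K) (\<lambda>X. f (split_pt {k} X))"
      proof -
        have "split_pt {k} (sl_act (insert k ?J) g h X) = sl_act ?J g h (split_pt {k} X)"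
          for g h and X :: "'a point"
          using split_pt_act[of "{k}" ?J g h X] kJ by simp
        then show ?thesis using prems(3) unfolding sl_invariant_def J(1) by simp
      qed
      show "set_mset \<alpha> \<subseteq> M" by (rule prems)
      show "homog (mat_vars l) (count \<alpha> l) (\<lambda>X. f (split_pt {k} X))" if "l \<in> K" for l
      proof -
        have "l \<notin> {k}" using that insert.hyps by auto
        then show ?thesis using homogD[OF prems(5)[of l]] that by (simp add: homog_def split_pt_scale_mat)
      qed
      show "homog (vec_vars (c, l)) (count \<alpha> l) (\<lambda>X. f (split_pt {k} X))" if "l \<in> M - K" for l c
      proof (cases "l = k")
        case True
        then show ?thesis using homogD[OF prems(5)[of k]] by (simp add: homog_def split_pt_scale_vec)
      next
        case False
        then show ?thesis using homogD[OF prems(6)[of l c]] that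
          by (simp add: homog_def split_pt_scale_vec_other)
      qed
    qed
    then obtain A where A: "graded_alg \<alpha> A" "\<And>X. A (split_pt (- K) X) = f (split_pt {k} X)" by blast
    have A_poly: "A \<in> polyfun (mats_vars M)" and A_inv: "sl_invariant {} A"
      and A_hom: "\<And>l. homog (mat_vars l) (count \<alpha> l) A"
      using graded_alg_props[OF A(1), of M] prems(4) by auto
    define D where "D X = f X - A (split_pt ?J X)" for X
    have D_poly: "D \<in> polyfun (mats_vars M)"
      unfolding D_def[abs_def] by (intro polyfun_diff split_pt_polyfun prems A_poly)
    have D_inv: "sl_invariant ?J D"
      unfolding D_def[abs_def]
    proof (rule sl_invariant_diff[OF prems(3)])
      show "sl_invariant ?J (\<lambda>X. A (split_pt ?J X))"
      proof -
        have "split_pt ?J (sl_act ?J g h X) = sl_act {} g h (split_pt ?J X)" for g h and X :: "'a point"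
          using split_pt_act[of ?J "{}" g h X] by simp
        then show ?thesis using sl_invariantD[OF A_inv] by (simp add: sl_invariant_def)
      qed
    qed
    have D_mat: "homog (mat_vars l) (count \<alpha> l) D" if "l \<in> insert k K" for l
      unfolding D_def[abs_def]
    proof (rule homog_diff[OF prems(5)[OF that]])
      show "homog (mat_vars l) (count \<alpha> l) (\<lambda>X. A (split_pt ?J X))"
        using homogD[OF A_hom] that by (simp add: homog_def split_pt_scale_mat)
    qed
    have D_vec: "homog (vec_vars (c, l)) (count \<alpha> l) D" if "l \<in> M - insert k K" for l c
      unfolding D_def[abs_def]
    proof (rule homog_diff[OF prems(6)[OF that]])
      show "homog (vec_vars (c, l)) (count \<alpha> l) (\<lambda>X. A (split_pt ?J X))"
        using homogD[OF A_hom] that by (simp add: homog_def split_pt_scale_vec)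
    qed
    have "D (split_pt {k} X) = 0" for X
    proof -
      have "split_pt ?J (split_pt {k} X) = split_pt (- K) X"
        unfolding J(1) using split_pt_split_pt[of ?J "{k}" X] by simp
      then show ?thesis using A(2)[of X] by (simp add: D_def)
    qed
    from vanishing_det_dvd[OF D_poly kM this] obtain h where
      h: "h \<in> polyfun (mats_vars M)" and Dh: "\<And>X. D X = det2 (mtx X k) * h X" by blast
    have D_eq: "D = (\<lambda>X. det2 (mtx X k) * h X)" using Dh by auto
    have f_eq: "f X = A (split_pt ?J X) + det2 (mtx X k) * h X" for X
      using Dh[of X] by (simp add: D_def algebra_simps)
    show ?case
    proof (cases "\<forall>X. h X = 0")
      case True
      then show ?thesis using A(1) f_eq by auto
    next
      case False
      have hmat: "count {#k, k#} l \<le> count \<alpha> l \<and> homog (mat_vars l) (count \<alpha> l - count {#k, k#} l) h"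
        if "l \<in> insert k K" for l
        using homog_cancel[OF det_polyfun[OF kM] det2_mtx_nonzero h D_mat[OF that, unfolded D_eq] det_homog]
          False by blast
      have hvec: "homog (vec_vars (c, l)) (count \<alpha> l) h" if "l \<in> M - insert k K" for l c
        using homog_cancel[OF det_polyfun[OF kM] det2_mtx_nonzero h D_vec[OF that, unfolded D_eq] det_homog_vec]
          False that by (metis Diff_iff diff_zero insertI1)
      define \<beta> where "\<beta> = \<alpha> - {#k, k#}"
      have "{#k, k#} \<subseteq># \<alpha>"
        by (rule mset_subset_eqI) (use hmat[of k] in \<open>auto split: if_splits\<close>)
      then have \<beta>: "\<alpha> = {#k, k#} + \<beta>" unfolding \<beta>_def by (metis subset_mset.add_diff_inverse)
      have "\<exists>B. graded_alg \<beta> B \<and> (\<forall>X. B (split_pt ?J X) = h X)"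
      proof (rule less.hyps)
        show "size \<beta> < size \<alpha>" by (simp add: \<beta>)
        show "insert k K \<subseteq> M" by (rule prems)
        show "sl_invariant ?J h"
          by (rule sl_invariant_cancel[OF D_inv[unfolded D_eq] det_invariant_unsplit[OF kJ]
                det_polyfun[OF kM] det2_mtx_nonzero h act_closed_mats_vars])
        show "set_mset \<beta> \<subseteq> M" using prems(4) \<beta> by auto
        show "homog (mat_vars l) (count \<beta> l) h" if "l \<in> insert k K" for l
          using hmat[OF that] by (simp add: \<beta>_def)
        show "homog (vec_vars (c, l)) (count \<beta> l) h" if "l \<in> M - insert k K" for l c
        proof -
          have "count \<beta> l = count \<alpha> l" using that by (auto simp: \<beta>_def)
          then show ?thesis using hvec[OF that] by simp
        qed
      qed (rule h)
      then obtain B where B: "graded_alg \<beta> B" "\<And>X. B (split_pt ?J X) = h X" by blast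
      have "graded_alg \<alpha> (\<lambda>X. A X + det2 (mtx X k) * B X)"
      proof (rule graded_alg.add[OF A(1)])
        show "graded_alg \<alpha> (\<lambda>X. det2 (mtx X k) * B X)"
          unfolding \<beta> by (rule graded_alg.mult[OF graded_alg.det B(1)])
      qed
      then show ?thesis
        by (rule exI[of _ "\<lambda>X. A X + det2 (mtx X k) * B X", OF conjI])
           (simp add: f_eq B mtx_split_pt(2)[OF kJ])
    qed
  qed
qed

corollary homogeneous_invariants:
  fixes f :: "'a point \<Rightarrow> 'a"
  assumes M: "finite M" and f: "f \<in> polyfun (mats_vars M)" and inv: "sl_invariant {} f"
    and \<alpha>: "set_mset \<alpha> \<subseteq> M" and hom: "\<And>k. k \<in> M \<Longrightarrow> homog (mat_vars k) (count \<alpha> k) f"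
  shows "graded_alg \<alpha> f"
proof -
  have "sl_invariant (- M) f"
    unfolding sl_invariant_def
  proof (intro allI impI)
    fix g h :: "'a m2" and X :: "'a point" assume g: "det2 g = 1" "det2 h = 1"
    have "f (sl_act (- M) g h X) = f (sl_act {} g h X)"
      by (rule polyfun_cong[OF f]) (auto simp: sl_act_def)
    then show "f (sl_act (- M) g h X) = f X" using sl_invariantD[OF inv g] by simp
  qed
  from mixed_invariants[OF M M order_refl f this \<alpha> hom] obtain A where
    A: "graded_alg \<alpha> A" "\<And>X. A (split_pt (- M) X) = f X" by auto
  have "A X = f X" for X
  proof -
    have "A \<in> polyfun (mats_vars M)" using graded_alg_props[OF A(1), of M] \<alpha> by blast
    then have "A (split_pt (- M) X) = A X" by (rule polyfun_cong) (auto simp: split_pt_def)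
    then show ?thesis using A(2) by simp
  qed
  then have "A = f" by auto
  then show ?thesis using A(1) by simp
qed

text \<open>
  The homogeneous components of an invariant with respect to one matrix after the other are invariant, so a
  set of functions that is closed under addition may be tested on homogeneous invariants.
\<close>

theorem invariants_in_closure:
  fixes f :: "'a point \<Rightarrow> 'a"
  assumes M: "finite M" and f: "f \<in> polyfun (mats_vars M)" and inv: "sl_invariant {} f"
    and H: "\<And>\<alpha> g. set_mset \<alpha> \<subseteq> M \<Longrightarrow> graded_alg \<alpha> g \<Longrightarrow> g \<in> H"
      "\<And>g h. g \<in> H \<Longrightarrow> h \<in> H \<Longrightarrow> (\<lambda>X. g X + h X) \<in> H"
  shows "f \<in> H"
proof -
  have "f \<in> H" if "finite N" "N \<subseteq> M" "f \<in> polyfun (mats_vars M)" "sl_invariant {} f"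
    "\<And>k. k \<in> M - N \<Longrightarrow> \<exists>n. homog (mat_vars k) n f" for N and f :: "'a point \<Rightarrow> 'a"
    using that
  proof (induction N arbitrary: f rule: finite_induct)
    case empty
    then obtain n where n: "\<And>k. k \<in> M \<Longrightarrow> homog (mat_vars k) (n k) f" by (metis Diff_empty)
    define \<alpha> where "\<alpha> = (\<Sum>k\<in>M. replicate_mset (n k) k)"
    have "count \<alpha> k = (if k \<in> M then n k else 0)" for k
      unfolding \<alpha>_def count_sum using M by simp
    then have "graded_alg \<alpha> f"
      by (intro homogeneous_invariants[OF M empty(2,3)]) (use n in \<open>auto simp flip: count_greater_zero_iff split: if_splits\<close>)
    moreover have "set_mset \<alpha> \<subseteq> M"
      unfolding \<alpha>_def by (auto simp: set_mset_sum[OF M] split: if_splits)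
    ultimately show ?case using H(1) by blast
  next
    case (insert k N)
    from homog_components[OF insert.prems(2), of "mat_vars k"] obtain m F where
      F: "\<And>n. F n \<in> polyfun (mats_vars M)" "\<And>n. homog (mat_vars k) n (F n)" "\<And>X. f X = (\<Sum>n\<le>m. F n X)"
      and eqv: "\<And>T c n X. (\<And>X. f (T X) = c * f X) \<Longrightarrow> (\<And>t X. T (scale (mat_vars k) t X) = scale (mat_vars k) t (T X)) \<Longrightarrow>
        F n (T X) = c * F n X" by blast
    have "F n \<in> H" for n
    proof (rule insert.IH)
      show "N \<subseteq> M" using insert.prems by auto
      show "F n \<in> polyfun (mats_vars M)" by (rule F)
      show "sl_invariant {} (F n)"
        unfolding sl_invariant_def
      proof (intro allI impI)
        fix g h :: "'a m2" and X :: "'a point" assume g: "det2 g = 1" "det2 h = 1"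
        have "F n (sl_act {} g h X) = 1 * F n X"
        proof (rule eqv)
          show "f (sl_act {} g h X) = 1 * f X" for X using sl_invariantD[OF insert.prems(3) g] by simp
          show "sl_act {} g h (scale (mat_vars k) t X) = scale (mat_vars k) t (sl_act {} g h X)" for t X
            by (auto simp: sl_act_def scale_def mtx_def entry_def m2_simps transp2_def fun_eq_iff algebra_simps)
        qed
        then show "F n (sl_act {} g h X) = F n X" by simp
      qed
      show "\<exists>d. homog (mat_vars l) d (F n)" if l: "l \<in> M - N" for l
      proof (cases "l = k")
        case True
        then show ?thesis using F(2) by blast
      next
        case False
        then obtain d where d: "homog (mat_vars l) d f" using insert.prems(4)[of l] l by blast
        have "F n (scale (mat_vars l) t X) = t ^ d * F n X" for t X
          by (rule eqv) (use homogD[OF d] in \<open>auto intro: scale_commute\<close>)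
        then show ?thesis by (auto simp: homog_def)
      qed
    qed
    moreover have "(\<lambda>X. \<Sum>n\<le>m. F n X) \<in> H" if "\<And>n. F n \<in> H" for m
    proof (induction m)
      case 0
      then show ?case using that by simp
    next
      case (Suc m)
      then show ?case using H(2)[OF _ that] by simp
    qed
    moreover have "f = (\<lambda>X. \<Sum>n\<le>m. F n X)" using F(3) by auto
    ultimately show ?case by simp
  qed
  from this[OF M order_refl f inv] show ?thesis by simp
qed

end

section \<open>Substitution into polynomials\<close>

definition mono_val :: "('v \<Rightarrow> 'b::comm_ring_1) \<Rightarrow> ('v \<Rightarrow>\<^sub>0 nat) \<Rightarrow> 'b" where
  "mono_val X t = (\<Prod>v\<in>Poly_Mapping.keys t. X v ^ Poly_Mapping.lookup t v)"

text \<open>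
  Evaluation of a polynomial in another ring, with the coefficients mapped by \<open>\<phi>\<close>. Apart
  from the evaluation in the field itself it is used to specialise generic matrices to matrices of
  polynomials.
\<close>

definition subst :: "('a::comm_ring_1 \<Rightarrow> 'b::comm_ring_1) \<Rightarrow> ('v \<Rightarrow> 'b) \<Rightarrow> ('v, 'a) mpoly \<Rightarrow> 'b" where
  "subst \<phi> X p = (\<Sum>t\<in>Poly_Mapping.keys p. \<phi> (Poly_Mapping.lookup p t) * mono_val X t)"

lemma mono_val_superset:
  assumes "finite V" "Poly_Mapping.keys t \<subseteq> V"
  shows "mono_val X t = (\<Prod>v\<in>V. X v ^ Poly_Mapping.lookup t v)"
  unfolding mono_val_def
  by (rule prod.mono_neutral_left[OF assms]) (auto simp: in_keys_iff)

lemma mono_val_add: "mono_val X (s + t) = mono_val X s * mono_val X t"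
proof -
  let ?V = "Poly_Mapping.keys s \<union> Poly_Mapping.keys t"
  have "mono_val X (s + t) = (\<Prod>v\<in>?V. X v ^ Poly_Mapping.lookup (s + t) v)"
    by (rule mono_val_superset) (use keys_add[of s t] in auto)
  also have "\<dots> = (\<Prod>v\<in>?V. X v ^ Poly_Mapping.lookup s v) * (\<Prod>v\<in>?V. X v ^ Poly_Mapping.lookup t v)"
    by (simp add: lookup_add power_add prod.distrib)
  also have "\<dots> = mono_val X s * mono_val X t"
    using mono_val_superset[of ?V s X] mono_val_superset[of ?V t X] by simp
  finally show ?thesis .
qed

lemma mono_val_0 [simp]: "mono_val X 0 = 1"
  by (simp add: mono_val_def)

lemma mono_val_single [simp]: "mono_val X (Poly_Mapping.single v n) = X v ^ n"
  by (cases "n = 0") (simp_all add: mono_val_def)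

lemma mono_val_sum: "mono_val X (\<Sum>i\<in>I. t i) = (\<Prod>i\<in>I. mono_val X (t i))"
  by (induction I rule: infinite_finite_induct) (simp_all add: mono_val_add)

lemma mpoly_eval_subst: "mpoly_eval = subst (\<lambda>c. c)"
  by (intro ext) (simp add: mpoly_eval_def subst_def mono_val_def)

lemma comm_ring_hom_id: "comm_ring_hom (\<lambda>c. c)"
  by unfold_locales auto

context comm_ring_hom begin

lemma subst_superset:
  assumes "finite K" "Poly_Mapping.keys p \<subseteq> K"
  shows "subst hom X p = (\<Sum>t\<in>K. hom (Poly_Mapping.lookup p t) * mono_val X t)"
  unfolding subst_def
  by (rule sum.mono_neutral_left[OF assms]) (auto simp: in_keys_iff)

lemma subst_add: "subst hom X (p + q) = subst hom X p + subst hom X q"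
proof -
  let ?K = "Poly_Mapping.keys p \<union> Poly_Mapping.keys q"
  have "subst hom X (p + q) = (\<Sum>t\<in>?K. hom (Poly_Mapping.lookup (p + q) t) * mono_val X t)"
    by (rule subst_superset) (use keys_add[of p q] in auto)
  also have "\<dots> = (\<Sum>t\<in>?K. hom (Poly_Mapping.lookup p t) * mono_val X t) + (\<Sum>t\<in>?K. hom (Poly_Mapping.lookup q t) * mono_val X t)"
    by (simp add: lookup_add hom_add distrib_right sum.distrib)
  also have "\<dots> = subst hom X p + subst hom X q"
    using subst_superset[of ?K p X] subst_superset[of ?K q X] by simp
  finally show ?thesis .
qed

lemma subst_single: "subst hom X (Poly_Mapping.single t c) = hom c * mono_val X t"
  by (cases "c = 0") (simp_all add: subst_def)

lemma subst_0: "subst hom X 0 = 0"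
  by (simp add: subst_def)

lemma subst_sum: "subst hom X (\<Sum>i\<in>I. p i) = (\<Sum>i\<in>I. subst hom X (p i))"
  by (induction I rule: infinite_finite_induct) (simp_all add: subst_add subst_0)

end

lemma poly_mapping_sum_single:
  "p = (\<Sum>t\<in>Poly_Mapping.keys p. Poly_Mapping.single t (Poly_Mapping.lookup p t))"
  by (rule poly_mapping_eqI) (simp add: lookup_sum lookup_single when_def in_keys_iff)

context comm_ring_hom begin

lemma subst_mult: "subst hom X (p * q) = subst hom X p * subst hom X q"
proof -
  let ?s = "\<lambda>p t. Poly_Mapping.single t (Poly_Mapping.lookup p t)"
  have "p * q = (\<Sum>s\<in>Poly_Mapping.keys p. \<Sum>t\<in>Poly_Mapping.keys q. ?s p s * ?s q t)"
    by (simp only: sum_product[symmetric] poly_mapping_sum_single[symmetric])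
  then have "subst hom X (p * q) = (\<Sum>s\<in>Poly_Mapping.keys p. \<Sum>t\<in>Poly_Mapping.keys q.
      (hom (Poly_Mapping.lookup p s) * mono_val X s) * (hom (Poly_Mapping.lookup q t) * mono_val X t))"
    by (simp add: subst_sum mult_single subst_single hom_mult mono_val_add ac_simps)
  then show ?thesis by (simp add: subst_def sum_product)
qed

lemma comm_ring_hom_subst: "comm_ring_hom (subst hom X)"
proof unfold_locales
  show "subst hom X 1 = 1" using subst_single[of X 0 1] by simp
qed (simp_all add: subst_add subst_mult subst_0)

lemma subst_Const: "subst hom X (Const c) = hom c"
  by (simp add: Const_def subst_single)

lemma subst_Var: "subst hom X (Var v) = X v"
  by (simp add: Var_def subst_single)

end

lemma comm_ring_hom_Const: "comm_ring_hom (Const :: 'a::comm_ring_1 \<Rightarrow> ('v, 'a) mpoly)"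
  by unfold_locales (simp_all add: Const_def single_add mult_single)

section \<open>Expansion of the bracket and of \<open>\<xi>\<^sub>q\<close>\<close>

lemma det_2x2:
  assumes "A \<in> carrier_mat 2 2"
  shows "det A = A $$ (0, 0) * A $$ (1, 1) - A $$ (0, 1) * A $$ (1, 0)"
proof -
  have "{0..<2::nat} = {0, 1}" by auto
  then show ?thesis
    unfolding det_def'[OF assms]
    by (simp add: sum_over_permutations_insert sign_swap_id permutation_swap_id sign_compose sign_id transpose_def)
qed

lemma lookup_signof_mult:
  "Poly_Mapping.lookup (signof p * q) t = signof p * Poly_Mapping.lookup q t"
  by (cases "sign p = 1") (auto simp: sign_def)

lemma prod_single:
  "(\<Prod>i\<in>I. Poly_Mapping.single (t i) (c i)) = Poly_Mapping.single (\<Sum>i\<in>I. t i) (\<Prod>i\<in>I. c i :: 'a::comm_ring_1)"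
  by (induction I rule: infinite_finite_induct) (simp_all add: mult_single)

lemma bracket_formula:
  assumes "x \<in> carrier_mat 2 2" "y \<in> carrier_mat 2 2"
  shows "bracket x y = x $$ (0, 0) * y $$ (1, 1) + y $$ (0, 0) * x $$ (1, 1)
    - x $$ (0, 1) * y $$ (1, 0) - y $$ (0, 1) * x $$ (1, 0)"
proof -
  define z :: "nat + nat \<Rightarrow>\<^sub>0 nat" where "z = Poly_Mapping.single (Inl 1) 1"
  define w :: "nat + nat \<Rightarrow>\<^sub>0 nat" where "w = Poly_Mapping.single (Inr 1) 1"
  define M where "M = z_var 1 \<cdot>\<^sub>m map_mat Const x + w_var 1 \<cdot>\<^sub>m map_mat Const y"
  have M: "M \<in> carrier_mat 2 2" using assms by (auto simp: M_def)
  have e: "M $$ (i, j) = Poly_Mapping.single z (x $$ (i, j)) + Poly_Mapping.single w (y $$ (i, j))"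
    if "i < 2" "j < 2" for i j
    using assms that by (simp add: M_def Var_def Const_def mult_single z_def w_def)
  have "Poly_Mapping.lookup z (Inl 1) \<noteq> Poly_Mapping.lookup w (Inl 1)"
    by (simp add: z_def w_def lookup_single when_def)
  then have zw: "z \<noteq> w" by metis
  have l: "Poly_Mapping.lookup ((Poly_Mapping.single z a + Poly_Mapping.single w b)
      * (Poly_Mapping.single z c + Poly_Mapping.single w d)) (z + w) = a * d + b * c" for a b c d :: 'a
    using zw by (simp add: distrib_left distrib_right mult_single lookup_add lookup_single when_def add.commute)
  have "bracket x y = Poly_Mapping.lookup (det M) (z + w)"
    by (simp add: bracket_def M_def zw_monomial_def z_def w_def)
  also have "\<dots> = x $$ (0, 0) * y $$ (1, 1) + y $$ (0, 0) * x $$ (1, 1)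
      - (x $$ (0, 1) * y $$ (1, 0) + y $$ (0, 1) * x $$ (1, 0))"
    by (simp only: det_2x2[OF M] lookup_minus e l zero_less_numeral one_less_numeral_iff semiring_norm)
  finally show ?thesis by simp
qed

text \<open>
  The auxiliary variable in the block \<open>(r, s)\<close> of the matrix defining
  \<open>\<xi>\<^sub>q\<close>, if the block is not zero.
\<close>

definition blk :: "nat \<Rightarrow> nat \<Rightarrow> nat \<Rightarrow> (nat + nat) option" where
  "blk q r s = (if s = r then Some (Inl r) else if s = r + 1 then Some (Inr r)
     else if r = q \<and> s = 1 then Some (Inr q) else None)"

text \<open>
  The position of the argument \<open>y\<close> that accompanies an auxiliary variable.
\<close>

definition arg_index :: "nat \<Rightarrow> nat + nat \<Rightarrow> nat" where
  "arg_index q v = (case v of Inl r \<Rightarrow> r | Inr r \<Rightarrow> q + r)"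

text \<open>
  In zero blocks the variable is a dummy; the coefficient is 0 there.
\<close>

definition xi_var :: "nat \<Rightarrow> nat \<Rightarrow> nat \<Rightarrow> nat + nat" where
  "xi_var q i j = (case blk q (i div 2 + 1) (j div 2 + 1) of Some v \<Rightarrow> v | None \<Rightarrow> Inl 0)"

definition xi_coeff :: "nat \<Rightarrow> (nat \<Rightarrow> 'a::comm_ring_1 mat) \<Rightarrow> nat \<Rightarrow> nat \<Rightarrow> 'a" where
  "xi_coeff q y i j = (case blk q (i div 2 + 1) (j div 2 + 1) of
     Some v \<Rightarrow> y (arg_index q v) $$ (i mod 2, j mod 2) | None \<Rightarrow> 0)"

text \<open>
  The permutations whose term in the Leibniz expansion of the determinant contains every auxiliary variable
  exactly once.
\<close>

definition xi_perms :: "nat \<Rightarrow> (nat \<Rightarrow> nat) set" where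
  "xi_perms q = {p. p permutes {0..<2 * q} \<and>
     (\<Sum>i = 0..<2 * q. Poly_Mapping.single (xi_var q i (p i)) 1) = zw_monomial q}"

lemma blk_arg_index:
  assumes "blk q r s = Some v" "r \<in> {1..q}" "s \<in> {1..q}"
  shows "arg_index q v \<in> {1..2 * q}"
  using assms by (auto simp: blk_def arg_index_def split: if_splits)

lemma block_index: "i < 2 * q \<Longrightarrow> i div 2 + 1 \<in> {1..q}" for i q :: nat
  by auto

lemma xi_block_entry:
  assumes y: "\<And>s. s \<in> {1..2 * q} \<Longrightarrow> y s \<in> carrier_mat 2 2"
    and rs: "r \<in> {1..q}" "s \<in> {1..q}" and ab: "a < 2" "b < 2"
  shows "xi_block q y r s $$ (a, b) =
    (case blk q r s of Some v \<Rightarrow> Var v * Const (y (arg_index q v) $$ (a, b)) | None \<Rightarrow> 0)"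
proof (cases "blk q r s")
  case None
  then show ?thesis using ab by (auto simp: xi_block_def blk_def split: if_splits)
next
  case (Some v)
  have "y (arg_index q v) \<in> carrier_mat 2 2" using blk_arg_index[OF Some rs] y by blast
  moreover have "xi_block q y r s = Var v \<cdot>\<^sub>m map_mat Const (y (arg_index q v))"
    using Some by (auto simp: xi_block_def blk_def arg_index_def mult_2 split: if_splits)
  ultimately show ?thesis using Some ab by simp
qed

lemma xi_matrix_entry:
  assumes y: "\<And>s. s \<in> {1..2 * q} \<Longrightarrow> y s \<in> carrier_mat 2 2" and ij: "i < 2 * q" "j < 2 * q"
  shows "xi_matrix q y $$ (i, j) =
    Poly_Mapping.single (Poly_Mapping.single (xi_var q i j) 1) (xi_coeff q y i j)"
proof -
  have "xi_matrix q y $$ (i, j) = xi_block q y (i div 2 + 1) (j div 2 + 1) $$ (i mod 2, j mod 2)"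
    using ij by (simp add: xi_matrix_def)
  also have "\<dots> = (case blk q (i div 2 + 1) (j div 2 + 1) of
      Some v \<Rightarrow> Var v * Const (y (arg_index q v) $$ (i mod 2, j mod 2)) | None \<Rightarrow> 0)"
    by (rule xi_block_entry[OF y block_index[OF ij(1)] block_index[OF ij(2)]]) simp_all
  finally show ?thesis
    by (simp add: xi_coeff_def xi_var_def Var_def Const_def mult_single split: option.split)
qed

text \<open>
  All entries of the matrix are monomials in the auxiliary variables, so each term of the Leibniz expansion
  contributes to exactly one coefficient. This form shows that \<open>\<xi>\<^sub>q\<close> commutes with
  ring homomorphisms and is linear in each argument.
\<close>

lemma xi_formula:
  assumes y: "\<And>s. s \<in> {1..2 * q} \<Longrightarrow> y s \<in> carrier_mat 2 2"
  shows "xi q y = (\<Sum>p\<in>xi_perms q. signof p * (\<Prod>i = 0..<2 * q. xi_coeff q y i (p i)))"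
proof -
  have M: "xi_matrix q y \<in> carrier_mat (2 * q) (2 * q)" by (simp add: xi_matrix_def)
  have "Poly_Mapping.lookup (\<Prod>i = 0..<2 * q. xi_matrix q y $$ (i, p i)) (zw_monomial q)
    = (if p \<in> xi_perms q then \<Prod>i = 0..<2 * q. xi_coeff q y i (p i) else 0)"
    if p: "p permutes {0..<2 * q}" for p
  proof -
    have "(\<Prod>i = 0..<2 * q. xi_matrix q y $$ (i, p i)) =
      (\<Prod>i = 0..<2 * q. Poly_Mapping.single (Poly_Mapping.single (xi_var q i (p i)) 1) (xi_coeff q y i (p i)))"
      by (rule prod.cong[OF refl], rule xi_matrix_entry[OF y]) (use permutes_in_image[OF p] in auto)
    then show ?thesis using p by (simp add: prod_single lookup_single when_def xi_perms_def)
  qed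
  then have "xi q y = (\<Sum>p | p permutes {0..<2 * q}. signof p *
      (if p \<in> xi_perms q then \<Prod>i = 0..<2 * q. xi_coeff q y i (p i) else 0))"
    unfolding xi_def det_def'[OF M] by (simp add: lookup_sum lookup_signof_mult)
  also have "\<dots> = (\<Sum>p\<in>xi_perms q. signof p * (\<Prod>i = 0..<2 * q. xi_coeff q y i (p i)))"
    by (rule sum.mono_neutral_cong_right) (auto simp: xi_perms_def finite_permutations)
  finally show ?thesis .
qed

lemma xi_matrix_cong:
  assumes "\<And>s. s \<in> {1..2 * q} \<Longrightarrow> y s = y' s"
  shows "xi_matrix q y = xi_matrix q y'"
proof (rule eq_matI)
  fix i j assume "i < dim_row (xi_matrix q y')" "j < dim_col (xi_matrix q y')"
  then have "i < 2 * q" "j < 2 * q" by (simp_all add: xi_matrix_def)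
  then show "xi_matrix q y $$ (i, j) = xi_matrix q y' $$ (i, j)"
    using assms by (auto simp: xi_matrix_def xi_block_def)
qed (simp_all add: xi_matrix_def)

lemma xi_cong:
  assumes "\<And>s. s \<in> {1..2 * q} \<Longrightarrow> y s = y' s"
  shows "xi q y = xi q y'"
proof -
  have "xi_matrix q y = xi_matrix q y'" by (rule xi_matrix_cong) (rule assms)
  then show ?thesis by (simp add: xi_def)
qed

lemma (in comm_ring_hom) hom_xi:
  assumes y: "\<And>s. s \<in> {1..2 * q} \<Longrightarrow> y s \<in> carrier_mat 2 2"
  shows "xi q (\<lambda>s. map_mat hom (y s)) = hom (xi q y)"
proof -
  have "xi_coeff q (\<lambda>s. map_mat hom (y s)) i j = hom (xi_coeff q y i j)" if "i < 2 * q" "j < 2 * q" for i j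
  proof (cases "blk q (i div 2 + 1) (j div 2 + 1)")
    case (Some v)
    from y[OF blk_arg_index[OF Some block_index[OF that(1)] block_index[OF that(2)]]] Some
    show ?thesis by (simp add: xi_coeff_def)
  qed (simp add: xi_coeff_def)
  then have e: "(\<Prod>i = 0..<2 * q. xi_coeff q (\<lambda>s. map_mat hom (y s)) i (p i))
      = hom (\<Prod>i = 0..<2 * q. xi_coeff q y i (p i))" if "p \<in> xi_perms q" for p
    unfolding hom_prod using permutes_in_image[of p "{0..<2 * q}"] that
    by (intro prod.cong) (auto simp: xi_perms_def)
  have "xi q (\<lambda>s. map_mat hom (y s)) = (\<Sum>p\<in>xi_perms q. signof p *
      (\<Prod>i = 0..<2 * q. xi_coeff q (\<lambda>s. map_mat hom (y s)) i (p i)))"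
    by (rule xi_formula) (use y in auto)
  also have "\<dots> = (\<Sum>p\<in>xi_perms q. hom (signof p * (\<Prod>i = 0..<2 * q. xi_coeff q y i (p i))))"
    by (rule sum.cong[OF refl]) (simp only: e hom_mult hom_signof)
  also have "\<dots> = hom (\<Sum>p\<in>xi_perms q. signof p * (\<Prod>i = 0..<2 * q. xi_coeff q y i (p i)))"
    by (simp only: hom_sum)
  also have "\<dots> = hom (xi q y)" by (subst xi_formula) (use y in auto)
  finally show ?thesis .
qed

lemma mono_val_zw: "mono_val X (zw_monomial q) = (\<Prod>r = 1..q. X (Inl r) * X (Inr r))"
  by (simp add: zw_monomial_def mono_val_sum mono_val_add)

lemma prod_arg_index: "(\<Prod>r = 1..q. c (arg_index q (Inl r)) * c (arg_index q (Inr r))) = (\<Prod>s = 1..2 * q. c s :: 'a::comm_ring_1)"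
proof -
  have "(\<Prod>s = 1..2 * q. c s) = prod c {1..q} * prod c {q + 1..q + q}"
    unfolding mult_2 by (rule prod.ub_add_nat) simp
  also have "prod c {q + 1..q + q} = (\<Prod>r = 1..q. c (q + r))"
    using prod.shift_bounds_cl_nat_ivl[of c 1 q q] by (simp add: add.commute)
  finally show ?thesis by (simp add: arg_index_def prod.distrib)
qed

text \<open>
  Scaling the arguments multiplies the term of a permutation in \<open>xi_perms q\<close> by one factor for
  each auxiliary variable, and by definition every auxiliary variable occurs once.
\<close>

lemma xi_smult:
  assumes y: "\<And>s. s \<in> {1..2 * q} \<Longrightarrow> y s \<in> carrier_mat 2 2"
  shows "xi q (\<lambda>s. c s \<cdot>\<^sub>m y s) = (\<Prod>s = 1..2 * q. c s) * xi q y"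
proof -
  have e: "xi_coeff q (\<lambda>s. c s \<cdot>\<^sub>m y s) i j = c (arg_index q (xi_var q i j)) * xi_coeff q y i j"
    if "i < 2 * q" "j < 2 * q" for i j
  proof (cases "blk q (i div 2 + 1) (j div 2 + 1)")
    case (Some v)
    from y[OF blk_arg_index[OF Some block_index[OF that(1)] block_index[OF that(2)]]] Some
    show ?thesis by (simp add: xi_coeff_def xi_var_def)
  qed (simp add: xi_coeff_def)
  have "(\<Prod>i = 0..<2 * q. xi_coeff q (\<lambda>s. c s \<cdot>\<^sub>m y s) i (p i))
      = (\<Prod>s = 1..2 * q. c s) * (\<Prod>i = 0..<2 * q. xi_coeff q y i (p i))"
    if p: "p \<in> xi_perms q" for p
  proof -
    have perm: "p permutes {0..<2 * q}" using p by (simp add: xi_perms_def)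
    have "(\<Prod>i = 0..<2 * q. xi_coeff q (\<lambda>s. c s \<cdot>\<^sub>m y s) i (p i))
      = (\<Prod>i = 0..<2 * q. c (arg_index q (xi_var q i (p i))) * xi_coeff q y i (p i))"
      using permutes_in_image[OF perm] by (intro prod.cong) (auto simp: e)
    also have "\<dots> = (\<Prod>i = 0..<2 * q. c (arg_index q (xi_var q i (p i)))) * (\<Prod>i = 0..<2 * q. xi_coeff q y i (p i))"
      by (rule prod.distrib)
    also have "(\<Prod>i = 0..<2 * q. c (arg_index q (xi_var q i (p i))))
        = mono_val (\<lambda>v. c (arg_index q v)) (\<Sum>i = 0..<2 * q. Poly_Mapping.single (xi_var q i (p i)) 1)"
      by (simp add: mono_val_sum)
    also have "\<dots> = (\<Prod>s = 1..2 * q. c s)"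
      using p prod_arg_index[of c q] by (simp add: xi_perms_def mono_val_zw)
    finally show ?thesis .
  qed
  note e' = this
  have "xi q (\<lambda>s. c s \<cdot>\<^sub>m y s) = (\<Sum>p\<in>xi_perms q. signof p *
      (\<Prod>i = 0..<2 * q. xi_coeff q (\<lambda>s. c s \<cdot>\<^sub>m y s) i (p i)))"
    by (rule xi_formula) (use y in auto)
  also have "\<dots> = (\<Sum>p\<in>xi_perms q. signof p *
      ((\<Prod>s = 1..2 * q. c s) * (\<Prod>i = 0..<2 * q. xi_coeff q y i (p i))))"
    by (rule sum.cong[OF refl]) (simp only: e')
  also have "\<dots> = (\<Prod>s = 1..2 * q. c s) * (\<Sum>p\<in>xi_perms q. signof p * (\<Prod>i = 0..<2 * q. xi_coeff q y i (p i)))"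
    by (simp add: sum_distrib_left mult.left_commute)
  also have "\<dots> = (\<Prod>s = 1..2 * q. c s) * xi q y" by (subst xi_formula) (use y in auto)
  finally show ?thesis .
qed

section \<open>Invariance of \<open>\<xi>\<^sub>q\<close>\<close>

definition block_diag :: "nat \<Rightarrow> 'a::comm_ring_1 mat \<Rightarrow> 'a mat" where
  "block_diag q g = mat (2 * q) (2 * q) (\<lambda>(i, j). if i div 2 = j div 2 then g $$ (i mod 2, j mod 2) else 0)"

lemma block_diag_carrier [simp]: "block_diag q g \<in> carrier_mat (2 * q) (2 * q)"
  unfolding block_diag_def by (rule mat_carrier)

lemma det_block_diag:
  fixes g :: "'a::idom mat"
  assumes g: "g \<in> carrier_mat 2 2"
  shows "det (block_diag q g) = det g ^ q"
proof (induction q)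
  case 0
  show ?case by (simp add: block_diag_def)
next
  case (Suc q)
  have "block_diag (Suc q) g = four_block_mat g (0\<^sub>m 2 (2 * q)) (0\<^sub>m (2 * q) 2) (block_diag q g)"
    (is "?L = ?R")
  proof (rule eq_matI)
    fix i j assume "i < dim_row ?R" "j < dim_col ?R"
    then have ij: "i < 2 * q + 2" "j < 2 * q + 2" using g by (auto simp: block_diag_def)
    have shift: "(n - 2) div 2 = n div 2 - 1" "(n - 2) mod 2 = n mod 2" "1 \<le> n div 2" if "\<not> n < 2" for n :: nat
      using that by presburger+
    show "?L $$ (i, j) = ?R $$ (i, j)"
      using ij g by (cases "i < 2"; cases "j < 2") (auto simp: block_diag_def shift div_eq_0_iff)
  qed (use g in \<open>auto simp: block_diag_def\<close>)
  moreover have "det (four_block_mat g (0\<^sub>m 2 (2 * q)) (0\<^sub>m (2 * q) 2) (block_diag q g)) = det g * det (block_diag q g)"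
    by (rule det_four_block_mat_lower_left_zero[OF g zero_carrier_mat refl block_diag_carrier])
  ultimately show ?case using Suc by simp
qed

lemma sum_pairs: "(\<Sum>k = 0..<2 * q. f k) = (\<Sum>a<q. f (2 * a) + f (2 * a + 1) :: 'a::comm_monoid_add)"
  for q :: nat
  by (induction q) (simp_all add: ac_simps)

lemma sum_block_diag:
  assumes "i < 2 * q"
  shows "(\<Sum>k = 0..<2 * q. block_diag q g $$ (i, k) * f k) =
      g $$ (i mod 2, 0) * f (2 * (i div 2)) + g $$ (i mod 2, 1) * f (2 * (i div 2) + 1)"
    and "(\<Sum>k = 0..<2 * q. f k * block_diag q g $$ (k, i)) =
      f (2 * (i div 2)) * g $$ (0, i mod 2) + f (2 * (i div 2) + 1) * g $$ (1, i mod 2)"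
proof -
  have d: "i div 2 < q" using assms by auto
  have "(\<Sum>k = 0..<2 * q. block_diag q g $$ (i, k) * f k)
    = (\<Sum>a<q. if a = i div 2 then g $$ (i mod 2, 0) * f (2 * a) + g $$ (i mod 2, 1) * f (2 * a + 1) else 0)"
    unfolding sum_pairs by (rule sum.cong) (use assms in \<open>auto simp: block_diag_def\<close>)
  then show "(\<Sum>k = 0..<2 * q. block_diag q g $$ (i, k) * f k) =
      g $$ (i mod 2, 0) * f (2 * (i div 2)) + g $$ (i mod 2, 1) * f (2 * (i div 2) + 1)"
    using d by simp
  have "(\<Sum>k = 0..<2 * q. f k * block_diag q g $$ (k, i))
    = (\<Sum>a<q. if a = i div 2 then f (2 * a) * g $$ (0, i mod 2) + f (2 * a + 1) * g $$ (1, i mod 2) else 0)"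
    unfolding sum_pairs by (rule sum.cong) (use assms in \<open>auto simp: block_diag_def\<close>)
  then show "(\<Sum>k = 0..<2 * q. f k * block_diag q g $$ (k, i)) =
      f (2 * (i div 2)) * g $$ (0, i mod 2) + f (2 * (i div 2) + 1) * g $$ (1, i mod 2)"
    using d by simp
qed

lemma mat_mult_entry:
  assumes "A \<in> carrier_mat n k" "B \<in> carrier_mat k m" "i < n" "j < m"
  shows "(A * B) $$ (i, j) = (\<Sum>l = 0..<k. A $$ (i, l) * B $$ (l, j))"
  using assms by (simp add: scalar_prod_def)

lemma map_block_diag:
  assumes "g \<in> carrier_mat 2 2"
  shows "map_mat Const (block_diag q g) = block_diag q (map_mat Const g)"
  using assms by (intro eq_matI) (auto simp: block_diag_def Const_def)

lemma triple_mult_entry: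
  assumes "g \<in> carrier_mat 2 2" "x \<in> carrier_mat 2 2" "h \<in> carrier_mat 2 2" "a < 2" "b < 2"
  shows "(g * x * h) $$ (a, b) =
    (g $$ (a, 0) * x $$ (0, 0) + g $$ (a, 1) * x $$ (1, 0)) * h $$ (0, b) +
    (g $$ (a, 0) * x $$ (0, 1) + g $$ (a, 1) * x $$ (1, 1)) * h $$ (1, b)"
proof -
  have gx: "g * x \<in> carrier_mat 2 2" using assms by simp
  have t: "{0..<2::nat} = {0, 1}" by auto
  show ?thesis
    by (subst mat_mult_entry[OF gx assms(3-5)])
       (simp add: t mat_mult_entry[OF assms(1,2,4)] del: index_mult_mat)
qed

lemma xi_matrix_act:
  fixes y :: "nat \<Rightarrow> 'a::comm_ring_1 mat"
  assumes y: "\<And>s. s \<in> {1..2 * q} \<Longrightarrow> y s \<in> carrier_mat 2 2"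
    and g: "g \<in> carrier_mat 2 2" and h: "h \<in> carrier_mat 2 2"
  shows "xi_matrix q (\<lambda>s. g * y s * h) =
    map_mat Const (block_diag q g) * xi_matrix q y * map_mat Const (block_diag q h)"
    (is "?L = ?G * ?M * ?H")
proof (rule eq_matI)
  interpret C: comm_ring_hom "Const :: 'a \<Rightarrow> (nat + nat, 'a) mpoly" by (rule comm_ring_hom_Const)
  have c: "?G \<in> carrier_mat (2 * q) (2 * q)" "?M \<in> carrier_mat (2 * q) (2 * q)" "?H \<in> carrier_mat (2 * q) (2 * q)"
    by (simp_all add: xi_matrix_def)
  fix i j assume "i < dim_row (?G * ?M * ?H)" "j < dim_col (?G * ?M * ?H)"
  then have ij: "i < 2 * q" "j < 2 * q" by (auto simp: block_diag_def)
  define i1 i0 j1 j0 where "i1 = i div 2" "i0 = i mod 2" "j1 = j div 2" "j0 = j mod 2"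
  note d = this
  have lt: "i1 < q" "j1 < q" "i0 < 2" "j0 < 2" using ij by (auto simp: d)
  have rs: "i1 + 1 \<in> {1..q}" "j1 + 1 \<in> {1..q}" using lt by auto
  let ?e = "\<lambda>a b. xi_block q y (i1 + 1) (j1 + 1) $$ (a, b)"
  have M: "?M $$ (2 * i1 + a, 2 * j1 + b) = ?e a b" if "a < 2" "b < 2" for a b
    using that lt by (simp add: xi_matrix_def)
  have GM: "(?G * ?M) $$ (i, 2 * j1 + b) = Const (g $$ (i0, 0)) * ?e 0 b + Const (g $$ (i0, 1)) * ?e 1 b"
    if "b < 2" for b
  proof -
    have b: "2 * j1 + b < 2 * q" using that lt by auto
    have "(?G * ?M) $$ (i, 2 * j1 + b) = map_mat Const g $$ (i mod 2, 0) * ?M $$ (2 * (i div 2), 2 * j1 + b)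
        + map_mat Const g $$ (i mod 2, 1) * ?M $$ (2 * (i div 2) + 1, 2 * j1 + b)"
      by (subst mat_mult_entry[OF c(1,2) ij(1) b], unfold map_block_diag[OF g], rule sum_block_diag(1)[OF ij(1)])
    then show ?thesis using g M[of 0 b] M[of 1 b] that by (simp add: d)
  qed
  have "(?G * ?M * ?H) $$ (i, j) = (?G * ?M) $$ (i, 2 * (j div 2)) * map_mat Const h $$ (0, j mod 2)
      + (?G * ?M) $$ (i, 2 * (j div 2) + 1) * map_mat Const h $$ (1, j mod 2)"
    by (subst mat_mult_entry[OF mult_carrier_mat[OF c(1,2)] c(3) ij], unfold map_block_diag[OF h],
        rule sum_block_diag(2)[OF ij(2)])
  also have "\<dots> = (Const (g $$ (i0, 0)) * ?e 0 0 + Const (g $$ (i0, 1)) * ?e 1 0) * Const (h $$ (0, j0))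
      + (Const (g $$ (i0, 0)) * ?e 0 1 + Const (g $$ (i0, 1)) * ?e 1 1) * Const (h $$ (1, j0))"
    using GM[of 0] GM[of 1] h by (simp add: d)
  also have "\<dots> = ?L $$ (i, j)"
  proof (cases "blk q (i1 + 1) (j1 + 1)")
    case None
    then have "?e a b = 0" if "a < 2" "b < 2" for a b using xi_block_entry[OF y rs that] by simp
    moreover have "?L $$ (i, j) = 0"
      using None ij by (auto simp: xi_matrix_def xi_block_def blk_def d split: if_splits)
    ultimately show ?thesis by simp
  next
    case (Some v)
    let ?x = "y (arg_index q v)"
    have x: "?x \<in> carrier_mat 2 2" using blk_arg_index[OF Some rs] y by blast
    have e: "?e a b = Var v * Const (?x $$ (a, b))" if "a < 2" "b < 2" for a b
      using xi_block_entry[OF y rs that] Some by simp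
    have "?L $$ (i, j) = xi_block q (\<lambda>s. g * y s * h) (i1 + 1) (j1 + 1) $$ (i0, j0)"
      using ij by (simp add: xi_matrix_def d)
    also have "\<dots> = Var v * Const ((g * ?x * h) $$ (i0, j0))"
    proof -
      have "g * y s * h \<in> carrier_mat 2 2" if "s \<in> {1..2 * q}" for s
        using mult_carrier_mat[OF mult_carrier_mat[OF g y[OF that]] h] .
      from xi_block_entry[OF this rs lt(3,4)] show ?thesis using Some by simp
    qed
    finally show ?thesis
      using e[of 0 0] e[of 0 1] e[of 1 0] e[of 1 1]
      by (simp add: triple_mult_entry[OF g x h lt(3,4)] C.hom_add C.hom_mult algebra_simps)
  qed
  finally show "?L $$ (i, j) = (?G * ?M * ?H) $$ (i, j)" by simp
qed (simp_all add: block_diag_def xi_matrix_def)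

text \<open>
  The substitution multiplies the defining matrix from both sides by block diagonal matrices of determinant
  one with entries in the base ring, which does not change the determinant.
\<close>

lemma xi_act:
  fixes y :: "nat \<Rightarrow> 'a::idom mat"
  assumes y: "\<And>s. s \<in> {1..2 * q} \<Longrightarrow> y s \<in> carrier_mat 2 2"
    and g: "g \<in> carrier_mat 2 2" "det g = 1" and h: "h \<in> carrier_mat 2 2" "det h = 1"
  shows "xi q (\<lambda>s. g * y s * h) = xi q y"
proof -
  interpret C: comm_ring_hom "Const :: 'a \<Rightarrow> (nat + nat, 'a) mpoly" by (rule comm_ring_hom_Const)
  let ?G = "map_mat Const (block_diag q g)" and ?H = "map_mat Const (block_diag q h)"
  have c: "?G \<in> carrier_mat (2 * q) (2 * q)" "xi_matrix q y \<in> carrier_mat (2 * q) (2 * q)" "?H \<in> carrier_mat (2 * q) (2 * q)"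
    by (simp_all add: xi_matrix_def)
  have "xi_matrix q (\<lambda>s. g * y s * h) = ?G * xi_matrix q y * ?H"
    by (rule xi_matrix_act) (use y g h in auto)
  then have "det (xi_matrix q (\<lambda>s. g * y s * h)) = det ?G * det (xi_matrix q y) * det ?H"
    using det_mult[OF mult_carrier_mat[OF c(1,2)] c(3)] det_mult[OF c(1,2)] by simp
  also have "\<dots> = det (xi_matrix q y)"
    by (simp add: C.hom_det det_block_diag g h C.hom_one)
  finally show ?thesis by (simp add: xi_def)
qed

section \<open>\<open>\<xi>\<^sub>q\<close> as an invariant function\<close>

definition mat_of :: "'a m2 \<Rightarrow> 'a mat" where
  "mat_of x = mat 2 2 (\<lambda>(i, j). entry x (i = 1) (j = 1))"

lemma mat_of_carrier [simp]: "mat_of x \<in> carrier_mat 2 2"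
  by (simp add: mat_of_def)

lemma mat_of_index: "i < 2 \<Longrightarrow> j < 2 \<Longrightarrow> mat_of x $$ (i, j) = entry x (i = 1) (j = 1)"
  by (simp add: mat_of_def)

lemma mat_of_mult: "mat_of (x * y) = mat_of x * mat_of y"
proof (rule eq_matI)
  fix i j assume "i < dim_row (mat_of x * mat_of y)" "j < dim_col (mat_of x * mat_of y)"
  then have ij: "i < 2" "j < 2" by (simp_all add: mat_of_def)
  have t: "{0..<2::nat} = {0, 1}" by auto
  have "i = 0 \<or> i = 1" "j = 0 \<or> j = 1" using ij by auto
  then show "mat_of (x * y) $$ (i, j) = (mat_of x * mat_of y) $$ (i, j)"
    unfolding mat_mult_entry[OF mat_of_carrier mat_of_carrier ij]
    by (auto simp: mat_of_index t entry_def times_m2_def)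
qed (simp_all add: mat_of_def)

lemma det_mat_of: "det (mat_of x) = det2 x"
  by (simp add: det_2x2 mat_of_index entry_def det2_def)

definition xi_fun :: "nat \<Rightarrow> (nat \<Rightarrow> nat) \<Rightarrow> 'a::comm_ring_1 point \<Rightarrow> 'a" where
  "xi_fun q \<kappa> X = xi q (\<lambda>s. mat_of (mtx X (\<kappa> s)))"

lemma xi_fun_invariant: "sl_invariant {} (xi_fun q \<kappa> :: 'a::idom point \<Rightarrow> 'a)"
  unfolding sl_invariant_def xi_fun_def
proof (intro allI impI)
  fix g h :: "'a m2" and X :: "'a point"
  assume "det2 g = 1" "det2 h = 1"
  then show "xi q (\<lambda>s. mat_of (mtx (sl_act {} g h X) (\<kappa> s))) = xi q (\<lambda>s. mat_of (mtx X (\<kappa> s)))"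
    by (simp add: mtx_sl_act mat_of_mult xi_act det_mat_of det2_transp2)
qed

lemma xi_fun_polyfun:
  fixes \<kappa> :: "nat \<Rightarrow> nat"
  assumes \<kappa>: "\<kappa> ` {1..2 * q} \<subseteq> M"
  shows "(xi_fun q \<kappa> :: 'a::comm_ring_1 point \<Rightarrow> 'a) \<in> polyfun (mats_vars M)"
proof -
  have "(\<lambda>X :: 'a point. xi_coeff q (\<lambda>s. mat_of (mtx X (\<kappa> s))) i j) \<in> polyfun (mats_vars M)"
    if ij: "i < 2 * q" "j < 2 * q" for i j
  proof (cases "blk q (i div 2 + 1) (j div 2 + 1)")
    case None
    then show ?thesis by (simp add: xi_coeff_def polyfun.const)
  next
    case (Some v)
    have "\<kappa> (arg_index q v) \<in> M"
      using blk_arg_index[OF Some block_index[OF ij(1)] block_index[OF ij(2)]] \<kappa> by blast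
    then show ?thesis using Some
      by (auto simp: xi_coeff_def mat_of_index entry_def mtx_def intro!: polyfun_intros)
  qed
  then have "(\<lambda>X :: 'a point. \<Sum>p\<in>xi_perms q. signof p * (\<Prod>i = 0..<2 * q. xi_coeff q (\<lambda>s. mat_of (mtx X (\<kappa> s))) i (p i)))
      \<in> polyfun (mats_vars M)"
    using permutes_in_image
    by (intro polyfun_sum polyfun_prod polyfun.mult polyfun.const) (auto simp: xi_perms_def permutes_in_image)
  moreover have "xi_fun q \<kappa> = (\<lambda>X :: 'a point. \<Sum>p\<in>xi_perms q. signof p * (\<Prod>i = 0..<2 * q. xi_coeff q (\<lambda>s. mat_of (mtx X (\<kappa> s))) i (p i)))"
    unfolding xi_fun_def by (intro ext xi_formula) simp
  ultimately show ?thesis by simp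
qed

lemma xi_fun_homog:
  "homog (mat_vars k) (count (image_mset \<kappa> (mset_set {1..2 * q})) k) (xi_fun q \<kappa>)"
  unfolding homog_def
proof (intro allI)
  fix t :: 'a and X :: "'a point"
  define c where "c s = (if \<kappa> s = k then t else 1)" for s
  have "mat_of (mtx (scale (mat_vars k) t X) (\<kappa> s)) = c s \<cdot>\<^sub>m mat_of (mtx X (\<kappa> s))" for s
    by (rule eq_matI) (auto simp: mat_of_def mtx_def scale_def entry_def c_def)
  then have "xi_fun q \<kappa> (scale (mat_vars k) t X) = (\<Prod>s = 1..2 * q. c s) * xi_fun q \<kappa> X"
    by (simp add: xi_fun_def xi_smult)
  moreover have "(\<Prod>s\<in>A. c s) = t ^ count (image_mset \<kappa> (mset_set A)) k" if "finite A" for A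
    using that by (induction A rule: finite_induct) (simp_all add: c_def)
  ultimately show "xi_fun q \<kappa> (scale (mat_vars k) t X) = t ^ count (image_mset \<kappa> (mset_set {1..2 * q})) k * xi_fun q \<kappa> X"
    by simp
qed

lemma (in infinite_field) graded_alg_xi_fun:
  "graded_alg (image_mset \<kappa> (mset_set {1..2 * q})) (xi_fun q \<kappa> :: 'a point \<Rightarrow> 'a)"
  by (rule homogeneous_invariants[of "\<kappa> ` {1..2 * q}"])
     (use xi_fun_polyfun xi_fun_invariant xi_fun_homog in auto)

section \<open>A point where \<open>\<xi>\<^sub>q\<close> equals one\<close>

text \<open>
  A repeated variable would have exponent at least 2 in the term of \<open>p\<close>.
\<close>

lemma xi_perms_distinct_var:
  assumes p: "p \<in> xi_perms q" and ij: "i < 2 * q" "j < 2 * q" "i \<noteq> j"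
  shows "xi_var q i (p i) \<noteq> xi_var q j (p j)"
proof
  assume eq: "xi_var q i (p i) = xi_var q j (p j)"
  define v where "v = xi_var q i (p i)"
  have "Poly_Mapping.lookup (zw_monomial q) v
      = (\<Sum>l = 0..<2 * q. if xi_var q l (p l) = v then 1 else 0)"
  proof -
    have "zw_monomial q = (\<Sum>l = 0..<2 * q. Poly_Mapping.single (xi_var q l (p l)) 1)"
      using p by (simp add: xi_perms_def)
    then show ?thesis by (simp only: lookup_sum lookup_single when_def)
  qed
  also have "\<dots> \<ge> (\<Sum>l\<in>{i, j}. if xi_var q l (p l) = v then 1 else 0)"
    by (rule sum_mono2) (use ij in auto)
  finally have "2 \<le> Poly_Mapping.lookup (zw_monomial q) v" using ij eq by (simp add: v_def)
  moreover have "Poly_Mapping.lookup (zw_monomial q) v \<le> 1"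
  proof -
    have "Poly_Mapping.lookup (zw_monomial q) v = (\<Sum>r = 1..q. if v = Inl r \<or> v = Inr r then 1 else 0)"
      unfolding zw_monomial_def lookup_sum
      by (rule sum.cong) (auto simp: lookup_add lookup_single when_def)
    also have "\<dots> \<le> 1" by (cases v) simp_all
    finally show ?thesis .
  qed
  ultimately show False by simp
qed

text \<open>
  This permutation takes the diagonal blocks in odd rows and the off-diagonal blocks in even rows, counting
  from 0.
\<close>

definition shift_even :: "nat \<Rightarrow> nat \<Rightarrow> nat" where
  "shift_even q i = (if i < 2 * q \<and> even i then if i + 2 < 2 * q then i + 2 else 0 else i)"

lemma blk_shift:
  assumes "a < q" "2 \<le> q"
  shows "blk q (a + 1) ((if a + 1 < q then a + 1 else 0) + 1) = Some (Inr (a + 1))"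
  using assms by (auto simp: blk_def)

lemma shift_even_in_xi_perms:
  assumes q: "2 \<le> q"
  shows "shift_even q \<in> xi_perms q"
proof -
  have "inj_on (shift_even q) {0..<2 * q}"
    by (rule inj_onI) (auto simp: shift_even_def split: if_splits; presburger)
  moreover have "shift_even q ` {0..<2 * q} \<subseteq> {0..<2 * q}" by (auto simp: shift_even_def)
  ultimately have "bij_betw (shift_even q) {0..<2 * q} {0..<2 * q}"
    by (simp add: bij_betw_def endo_inj_surj)
  then have perm: "shift_even q permutes {0..<2 * q}"
    by (rule bij_imp_permutes) (auto simp: shift_even_def)
  have ev: "xi_var q (2 * a) (shift_even q (2 * a)) = Inr (a + 1)" if "a < q" for a
  proof -
    have "shift_even q (2 * a) div 2 = (if a + 1 < q then a + 1 else 0)"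
      using that by (auto simp: shift_even_def)
    then show ?thesis using blk_shift[OF that q] by (simp add: xi_var_def)
  qed
  have od: "xi_var q (2 * a + 1) (shift_even q (2 * a + 1)) = Inl (a + 1)" for a
    by (simp add: xi_var_def shift_even_def blk_def)
  have "(\<Sum>i = 0..<2 * q. Poly_Mapping.single (xi_var q i (shift_even q i)) 1) = zw_monomial q"
  proof -
    have "zw_monomial q = (\<Sum>a<q. Poly_Mapping.single (Inl (Suc a)) 1 + Poly_Mapping.single (Inr (Suc a)) 1)"
      by (simp add: zw_monomial_def sum.atLeast1_atMost_eq)
    also have "\<dots> = (\<Sum>a<q. Poly_Mapping.single (xi_var q (2 * a) (shift_even q (2 * a))) 1
        + Poly_Mapping.single (xi_var q (2 * a + 1) (shift_even q (2 * a + 1))) 1)"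
    proof (rule sum.cong[OF refl])
      fix a assume "a \<in> {..<q}"
      then have "a < q" by simp
      from od[of a] ev[OF this]
      show "Poly_Mapping.single (Inl (Suc a)) 1 + Poly_Mapping.single (Inr (Suc a)) 1
        = Poly_Mapping.single (xi_var q (2 * a) (shift_even q (2 * a))) 1
        + Poly_Mapping.single (xi_var q (2 * a + 1) (shift_even q (2 * a + 1))) (1 :: nat)"
        by (simp add: add.commute)
    qed
    finally show ?thesis by (simp only: sum_pairs)
  qed
  with perm show ?thesis by (simp add: xi_perms_def)
qed

text \<open>
  All arguments are identity matrices, except that the first one lacks its upper left entry. The nonzero
  entries of the matrix lie on the diagonal of its blocks, so a contributing permutation preserves parity
  and either fixes an index or moves it by two cyclically. The index 0 cannot be fixed because that entry
  is zero, and by injectivity no other even index can be fixed either. Then all off-diagonal variables are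
  used up by the even rows and the odd indices are fixed. So \<open>shift_even q\<close> is the only
  contributing permutation. Characteristic 2 makes its sign irrelevant.
\<close>

lemma xi_special:
  fixes y :: "nat \<Rightarrow> 'a::comm_ring_1 mat"
  assumes q: "2 \<le> q" and char2: "(1 :: 'a) + 1 = 0"
    and y: "\<And>s. s \<in> {1..2 * q} \<Longrightarrow> y s \<in> carrier_mat 2 2"
    and ye: "\<And>s a b. s \<in> {1..2 * q} \<Longrightarrow> a < 2 \<Longrightarrow> b < 2 \<Longrightarrow>
        y s $$ (a, b) = (if a = b \<and> (s = 1 \<longrightarrow> a = 1) then 1 else 0)"
  shows "xi q y = 1"
proof -
  have nz: "i mod 2 = j mod 2 \<and> blk q (i div 2 + 1) (j div 2 + 1) \<noteq> None \<and> (i = 0 \<longrightarrow> j \<noteq> 0)"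
    if "xi_coeff q y i j \<noteq> 0" and ij: "i < 2 * q" "j < 2 * q" for i j
  proof (cases "blk q (i div 2 + 1) (j div 2 + 1)")
    case None
    then show ?thesis using that by (simp add: xi_coeff_def)
  next
    case (Some v)
    have "arg_index q v \<in> {1..2 * q}"
      by (rule blk_arg_index[OF Some block_index[OF ij(1)] block_index[OF ij(2)]])
    then have "i mod 2 = j mod 2 \<and> (arg_index q v = 1 \<longrightarrow> i mod 2 = 1)"
      using that Some ye[of "arg_index q v" "i mod 2" "j mod 2"] by (auto simp: xi_coeff_def split: if_splits)
    moreover have "arg_index q v = 1" if "i = 0" "j = 0"
      using that Some by (auto simp: blk_def arg_index_def)
    ultimately show ?thesis using Some by auto
  qed
  have uniq: "p = shift_even q"
    if p: "p \<in> xi_perms q" and prod: "(\<Prod>i = 0..<2 * q. xi_coeff q y i (p i)) \<noteq> 0" for p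
  proof -
    have perm: "p permutes {0..<2 * q}" using p by (simp add: xi_perms_def)
    have lt: "p i < 2 * q" if "i < 2 * q" for i using permutes_in_image[OF perm, of i] that by simp
    have c: "xi_coeff q y i (p i) \<noteq> 0" if "i < 2 * q" for i
    proof
      assume "xi_coeff q y i (p i) = 0"
      then have "(\<Prod>i = 0..<2 * q. xi_coeff q y i (p i)) = 0"
        using that by (intro prod_zero) auto
      with prod show False by simp
    qed
    have step: "p i = i \<or> (p i = i + 2 \<or> i + 2 \<ge> 2 * q \<and> p i = i mod 2) \<and> xi_var q i (p i) = Inr (i div 2 + 1)"
      if i: "i < 2 * q" for i
    proof -
      have n: "i mod 2 = p i mod 2" "blk q (i div 2 + 1) (p i div 2 + 1) \<noteq> None"
        using nz[OF c[OF i] i lt[OF i]] by auto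
      consider "p i div 2 = i div 2" | "p i div 2 = i div 2 + 1" | "i div 2 + 1 = q" "p i div 2 = 0"
        using n(2) by (auto simp: blk_def split: if_splits)
      then show ?thesis
      proof cases
        case 1
        then have "p i = i" using n(1) by (metis div_mod_decomp)
        then show ?thesis by simp
      next
        case 2
        then have "p i = i + 2" using n(1) by presburger
        then show ?thesis using 2 by (simp add: xi_var_def blk_def)
      next
        case 3
        then have "p i = i mod 2" "i + 2 \<ge> 2 * q" using n(1) by presburger+
        then show ?thesis using 3 q by (auto simp: xi_var_def blk_def)
      qed
    qed
    have even_ne: "p (2 * a) \<noteq> 2 * a" if "a < q" for a
      using that
    proof (induction a)
      case 0
      then show ?case using nz[OF c[of 0] _ lt[of 0]] by auto
    next
      case (Suc a)
      then have "p (2 * a) = 2 * a + 2" using step[of "2 * a"] by auto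
      then have "p (2 * a) = 2 * Suc a" by simp
      then show ?case using permutes_inj[OF perm] by (metis injD Suc_n_not_n mult_left_cancel zero_neq_numeral)
    qed
    have "p i = shift_even q i" for i
    proof (cases "i < 2 * q")
      case False
      then show ?thesis using permutes_not_in[OF perm, of i] by (simp add: shift_even_def)
    next
      case True
      show ?thesis
      proof (cases "even i")
        case ev: True
        then obtain a where a: "i = 2 * a" by blast
        then have "p i \<noteq> i" using even_ne[of a] True by auto
        then show ?thesis using step[OF True] True ev lt[OF True] by (auto simp: shift_even_def)
      next
        case False
        then obtain a where a: "i = 2 * a + 1" by (elim oddE)
        have a': "2 * a < 2 * q" using a True by simp
        have "xi_var q (2 * a) (p (2 * a)) = Inr (a + 1)"
          using step[OF a'] even_ne[of a] a' by auto
        moreover have "xi_var q (2 * a) (p (2 * a)) \<noteq> xi_var q i (p i)"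
          by (rule xi_perms_distinct_var[OF p a' True]) (simp add: a)
        ultimately have "p i = i" using step[OF True] a by auto
        then show ?thesis using False by (simp add: shift_even_def)
      qed
    qed
    then show ?thesis by auto
  qed
  have one: "xi_coeff q y i (shift_even q i) = 1" if i: "i < 2 * q" for i
  proof (cases "even i")
    case True
    then obtain a where a: "i = 2 * a" by blast
    have d: "shift_even q i div 2 = (if a + 1 < q then a + 1 else 0)" "even (shift_even q i)"
      using i a by (auto simp: shift_even_def)
    have "blk q (i div 2 + 1) (shift_even q i div 2 + 1) = Some (Inr (a + 1))"
      using blk_shift[of a q] q i a d(1) by simp
    moreover have "arg_index q (Inr (a + 1)) \<in> {1..2 * q}" "arg_index q (Inr (a + 1)) \<noteq> 1"
      using i a q by (auto simp: arg_index_def)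
    ultimately show ?thesis using ye[of "arg_index q (Inr (a + 1))" 0 0] a d(2) by (simp add: xi_coeff_def)
  next
    case False
    then have "shift_even q i = i" by (simp add: shift_even_def)
    moreover have "i mod 2 = 1" using False by presburger
    moreover have "arg_index q (Inl (i div 2 + 1)) \<in> {1..2 * q}" using i by (auto simp: arg_index_def)
    ultimately show ?thesis using ye[of "arg_index q (Inl (i div 2 + 1))" 1 1]
      by (simp add: xi_coeff_def blk_def)
  qed
  have "xi q y = (\<Sum>p\<in>xi_perms q. signof p * (\<Prod>i = 0..<2 * q. xi_coeff q y i (p i)))"
    by (rule xi_formula) (rule y)
  also have "\<dots> = (\<Sum>p\<in>{shift_even q}. signof p * (\<Prod>i = 0..<2 * q. xi_coeff q y i (p i)))"
  proof (rule sum.mono_neutral_right)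
    show "finite (xi_perms q)" by (simp add: xi_perms_def finite_permutations)
    show "{shift_even q} \<subseteq> xi_perms q" using shift_even_in_xi_perms[OF q] by simp
    show "\<forall>p\<in>xi_perms q - {shift_even q}. signof p * (\<Prod>i = 0..<2 * q. xi_coeff q y i (p i)) = 0"
      using uniq by (metis DiffD1 DiffD2 mult_zero_right singletonI)
  qed
  also have "\<dots> = signof (shift_even q)" using one by simp
  also have "\<dots> = (1 :: 'a)"
  proof -
    have "- 1 = (1 :: 'a)" using char2 by (metis add_eq_0_iff2)
    then show ?thesis by (cases "sign (shift_even q) = 1") (auto simp: sign_def)
  qed
  finally show ?thesis .
qed

section \<open>Indecomposability in characteristic two\<close>

text \<open>
  The matrix with index \<open>k\<close> is the matrix unit in the lower right corner, all others are the
  identity.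
\<close>

definition special_pt :: "nat \<Rightarrow> 'a::comm_ring_1 point" where
  "special_pt k = (\<lambda>(i, j, l). if i = j \<and> (l = k \<longrightarrow> i) then 1 else 0)"

lemma mtx_special_pt: "mtx (special_pt k) l = (if l = k then M2 0 0 0 1 else 1)"
  by (simp add: mtx_def special_pt_def one_m2_def)

lemma word_special_pt: "k \<notin> set w \<Longrightarrow> word b w (special_pt k) = (1 :: 'a::comm_ring_1 m2)"
proof (induction w arbitrary: b)
  case (Cons l w)
  have "adj2 1 = (1 :: 'a m2)" by (simp add: adj2_def one_m2_def)
  then show ?case using Cons by (auto simp: mtx_special_pt)
qed simp

lemma trace_word_special_pt_1:
  assumes "distinct w" "k \<in> set w"
  shows "trace_word w (special_pt k) = 1"
proof -
  obtain u v where w: "w = u @ k # v" using assms(2) by (meson split_list)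
  then have "k \<notin> set u" "k \<notin> set v" using assms(1) by auto
  then show ?thesis unfolding w trace_word_def word_append
    by (simp add: word_special_pt mtx_special_pt tr2_def adj2_def)
qed

lemma trace_word_special_pt_0:
  assumes "(1 :: 'a::comm_ring_1) + 1 = 0" "k \<notin> set w"
  shows "trace_word w (special_pt k) = (0 :: 'a)"
  using assms by (simp add: trace_word_def word_special_pt tr2_def one_m2_def)

text \<open>
  In characteristic 2 the trace of the identity is zero, so every generator without the letter
  \<open>k\<close> and without repetitions vanishes at this point.
\<close>

lemma graded_alg_special_pt_0:
  assumes char2: "(1 :: 'a::comm_ring_1) + 1 = 0"
    and "graded_alg \<beta> (f :: 'a point \<Rightarrow> 'a)" "\<And>k. count \<beta> k \<le> 1" "\<beta> \<noteq> {#}" "k \<notin># \<beta>"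
  shows "f (special_pt k) = 0"
  using assms(2-)
proof (induction rule: graded_alg.induct)
  case (mult \<alpha> f \<beta> g)
  have le: "count \<alpha> l \<le> 1" "count \<beta> l \<le> 1" for l
    using mult.prems(1)[of l] by auto
  show ?case
  proof (cases "\<alpha> = {#}")
    case True
    then have "g (special_pt k) = 0" using mult.prems le by (intro mult.IH(2)) auto
    then show ?thesis by simp
  next
    case False
    then have "f (special_pt k) = 0" using mult.prems le by (intro mult.IH(1)) auto
    then show ?thesis by simp
  qed
next
  case (det l)
  from det(1)[of l] show ?case by simp
next
  case (tr w)
  then show ?case by (intro trace_word_special_pt_0[OF char2]) simp
qed auto

lemma xi_fun_special_pt:
  assumes q: "2 \<le> q" and char2: "(1 :: 'a::comm_ring_1) + 1 = 0" and inj: "inj_on \<kappa> {1..2 * q}"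
  shows "xi_fun q \<kappa> (special_pt (\<kappa> 1)) = (1 :: 'a)"
  unfolding xi_fun_def
proof (rule xi_special[OF q char2])
  fix s a b :: nat assume s: "s \<in> {1..2 * q}" and ab: "a < 2" "b < 2"
  have "\<kappa> s = \<kappa> 1 \<longleftrightarrow> s = 1"
    using inj_on_eq_iff[OF inj s, of 1] q by simp
  moreover have "a = 0 \<or> a = 1" "b = 0 \<or> b = 1" using ab by auto
  ultimately show "mat_of (mtx (special_pt (\<kappa> 1)) (\<kappa> s)) $$ (a, b)
      = (if a = b \<and> (s = 1 \<longrightarrow> a = 1) then 1 else 0 :: 'a)"
    by (auto simp: mat_of_index mtx_special_pt entry_def one_m2_def)
qed simp

lemma graded_alg_empty_const: "graded_alg \<alpha> f \<Longrightarrow> \<alpha> = {#} \<Longrightarrow> \<exists>c. \<forall>X. f X = c"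
  by (induction rule: graded_alg.induct) auto

text \<open>
  The intended instance is the algebra of functions generated by the claimed generators.
\<close>

locale function_algebra =
  fixes H :: "('a::field point \<Rightarrow> 'a) set"
  assumes const_closed: "(\<lambda>X. c) \<in> H"
    and add_closed: "f \<in> H \<Longrightarrow> g \<in> H \<Longrightarrow> (\<lambda>X. f X + g X) \<in> H"
    and mult_closed: "f \<in> H \<Longrightarrow> g \<in> H \<Longrightarrow> (\<lambda>X. f X * g X) \<in> H"
begin

lemma graded_alg_in_H:
  assumes "graded_alg \<alpha> f" and "set_mset \<alpha> \<subseteq> M"
    and "\<And>k. k \<in> M \<Longrightarrow> (\<lambda>X. det2 (mtx X k)) \<in> H"
    and "\<And>w. sorted_wrt (<) w \<Longrightarrow> even (length w) \<Longrightarrow> w \<noteq> [] \<Longrightarrow> set w \<subseteq> M \<Longrightarrow> length w \<le> size \<alpha> \<Longrightarrow> trace_word w \<in> H"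
  shows "f \<in> H"
  using assms
proof (induction rule: graded_alg.induct)
  case (tr w)
  then show ?case by auto
qed (auto intro: const_closed add_closed mult_closed)

text \<open>
  A multilinear element of the degree of \<open>w\<close> is a multiple of the trace of \<open>w\<close>
  plus products of two elements of positive degree. These lie in \<open>H\<close> by the assumption on
  shorter words, and they vanish at the special point because only one factor can involve the matrix
  \<open>k\<close>.
\<close>

lemma graded_alg_decompose:
  assumes char2: "(1 :: 'a) + 1 = 0"
    and f: "graded_alg \<alpha> f" "\<alpha> = mset w"
    and w: "sorted_wrt (<) w" "set w \<subseteq> M" "k \<in> set w"
    and det: "\<And>k. k \<in> M \<Longrightarrow> (\<lambda>X. det2 (mtx X k)) \<in> H"
    and shorter: "\<And>w'. sorted_wrt (<) w' \<Longrightarrow> even (length w') \<Longrightarrow> w' \<noteq> [] \<Longrightarrow> set w' \<subseteq> M \<Longrightarrow>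
      length w' < length w \<Longrightarrow> trace_word w' \<in> H"
  shows "\<exists>c. \<exists>g\<in>H. (\<forall>X. f X = c * trace_word w X + g X) \<and> g (special_pt k) = 0"
  using f
proof (induction rule: graded_alg.induct)
  case (zero \<alpha>)
  show ?case by (intro exI[of _ 0] bexI[OF _ const_closed[of 0]]) simp
next
  case (const c)
  then show ?case using w(3) by simp
next
  case (add \<alpha> f g)
  then obtain c f' d g' where "f' \<in> H" "\<forall>X. f X = c * trace_word w X + f' X" "f' (special_pt k) = 0"
    "g' \<in> H" "\<forall>X. g X = d * trace_word w X + g' X" "g' (special_pt k) = 0" by blast
  then show ?case
    by (intro exI[of _ "c + d"] bexI[of _ "\<lambda>X. f' X + g' X"]) (auto simp: algebra_simps intro: add_closed)
next
  case (mult \<alpha> f \<beta> g)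
  have size: "size \<alpha> + size \<beta> = length w" using arg_cong[OF mult.prems, of size] by simp
  have set: "set_mset \<alpha> \<union> set_mset \<beta> \<subseteq> M" using arg_cong[OF mult.prems, of set_mset] w(2) by simp
  have dist: "distinct w" using w(1) by (simp add: strict_sorted_iff)
  have cnt: "count \<alpha> l + count \<beta> l \<le> 1" for l
    using arg_cong[OF mult.prems, of "\<lambda>a. count a l"] distinct_count_atmost_1[of w] dist by simp
  consider (left) "\<alpha> = {#}" | (right) "\<beta> = {#}" | (both) "\<alpha> \<noteq> {#}" "\<beta> \<noteq> {#}" by blast
  then show ?case
  proof cases
    case left
    then obtain c0 where c0: "\<And>X. f X = c0" using graded_alg_empty_const mult.hyps(1) by blast
    obtain c g' where g': "g' \<in> H" "\<forall>X. g X = c * trace_word w X + g' X" "g' (special_pt k) = 0"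
      using mult.IH(2) mult.prems left by auto
    then show ?thesis
      by (intro exI[of _ "c0 * c"] bexI[of _ "\<lambda>X. c0 * g' X"])
         (auto simp: c0 algebra_simps intro: mult_closed const_closed)
  next
    case right
    then obtain c0 where c0: "\<And>X. g X = c0" using graded_alg_empty_const mult.hyps(2) by blast
    obtain c f' where f': "f' \<in> H" "\<forall>X. f X = c * trace_word w X + f' X" "f' (special_pt k) = 0"
      using mult.IH(1) mult.prems right by auto
    then show ?thesis
      by (intro exI[of _ "c0 * c"] bexI[of _ "\<lambda>X. c0 * f' X"])
         (auto simp: c0 algebra_simps intro: mult_closed const_closed)
  next
    case both
    then have "size \<alpha> > 0" "size \<beta> > 0" by (simp_all add: nonempty_has_size)
    then have "size \<alpha> < length w" "size \<beta> < length w" using size by linarith+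
    then have fg: "f \<in> H" "g \<in> H"
      using set by (auto intro!: graded_alg_in_H[OF mult.hyps(1) _ det shorter] graded_alg_in_H[OF mult.hyps(2) _ det shorter])
    have "k \<notin># \<alpha> \<or> k \<notin># \<beta>"
    proof (rule ccontr)
      assume "\<not> ?thesis"
      then have "count \<alpha> k \<ge> 1" "count \<beta> k \<ge> 1" by simp_all
      then show False using cnt[of k] by linarith
    qed
    moreover have "count \<alpha> l \<le> 1" "count \<beta> l \<le> 1" for l using cnt[of l] by auto
    ultimately have "f (special_pt k) * g (special_pt k) = 0"
      using graded_alg_special_pt_0[OF char2 mult.hyps(1) _ both(1), of k] graded_alg_special_pt_0[OF char2 mult.hyps(2) _ both(2), of k]
      by auto
    then show ?thesis
      by (intro exI[of _ 0] bexI[of _ "\<lambda>X. f X * g X"]) (auto intro: mult_closed fg)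
  qed
next
  case (det l)
  have "count (mset w) l \<le> 1"
    using w(1) distinct_count_atmost_1[of w] by (simp add: strict_sorted_iff)
  moreover have "count (mset w) l = 2" using arg_cong[OF det(1), of "\<lambda>a. count a l"] by simp
  ultimately show ?case by simp
next
  case (tr w')
  have "w' = w"
    using tr w(1) by (metis properties_for_sort strict_sorted_iff)
  then show ?case by (intro exI[of _ 1] bexI[OF _ const_closed[of 0]]) simp
qed

text \<open>
  Apply the decomposition to \<open>\<xi>\<^sub>q\<close> of the letters of \<open>w\<close>. The value 1
  at the special point of the first letter shows that the trace occurs with coefficient 1, so it can be
  solved for.
\<close>

lemma trace_word_in_H:
  assumes "infinite (UNIV :: 'a set)" and char2: "(1 :: 'a) + 1 = 0"
    and det: "\<And>k. k \<in> M \<Longrightarrow> (\<lambda>X. det2 (mtx X k)) \<in> H"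
    and pair: "\<And>l r. l \<in> M \<Longrightarrow> r \<in> M \<Longrightarrow> l < r \<Longrightarrow> trace_word [l, r] \<in> H"
    and xi: "\<And>q \<kappa>. 2 \<le> q \<Longrightarrow> strict_mono_on {1..2 * q} \<kappa> \<Longrightarrow> \<kappa> ` {1..2 * q} \<subseteq> M \<Longrightarrow> xi_fun q \<kappa> \<in> H"
  shows "sorted_wrt (<) w \<Longrightarrow> even (length w) \<Longrightarrow> w \<noteq> [] \<Longrightarrow> set w \<subseteq> M \<Longrightarrow> trace_word w \<in> H"
proof (induction "length w" arbitrary: w rule: less_induct)
  case less
  interpret infinite_field "TYPE('a)" by unfold_locales (rule assms(1))
  obtain q where q: "length w = 2 * q" using less.prems(2) by blast
  show ?case
  proof (cases "q = 1")
    case True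
    then obtain l r where "w = [l, r]" using q
      by (metis One_nat_def Suc_1 length_0_conv length_Suc_conv nat_mult_1_right)
    then show ?thesis using less.prems by (auto intro: pair)
  next
    case False
    then have q2: "2 \<le> q" using q less.prems(3) by (cases q) auto
    define \<kappa> where "\<kappa> s = w ! (s - 1)" for s
    have map_\<kappa>: "map \<kappa> [1..<2 * q + 1] = w"
      by (rule nth_equalityI) (auto simp: q \<kappa>_def simp del: upt_Suc)
    have img: "image_mset \<kappa> (mset_set {1..2 * q}) = mset w"
    proof -
      have "mset w = image_mset \<kappa> (mset [1..<2 * q + 1])" by (metis map_\<kappa> mset_map)
      also have "mset [1..<2 * q + 1] = mset_set {1..2 * q}"
        by (simp only: mset_upt atLeastLessThanSuc_atLeastAtMost Suc_eq_plus1[symmetric])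
      finally show ?thesis by simp
    qed
    have "\<kappa> ` {1..2 * q} = set w" using arg_cong[OF img, of set_mset] by simp
    then have "xi_fun q \<kappa> \<in> H"
    proof (intro xi q2)
      show "strict_mono_on {1..2 * q} \<kappa>"
      proof (rule strict_mono_onI)
        fix r s assume "r \<in> {1..2 * q}" "s \<in> {1..2 * q}" "r < s"
        then have "r - 1 < s - 1" "s - 1 < length w" using q by auto
        then show "\<kappa> r < \<kappa> s" unfolding \<kappa>_def by (rule sorted_wrt_nth_less[OF less.prems(1)])
      qed
    qed (use less.prems in simp)
    define k where "k = \<kappa> 1"
    have k: "k \<in> set w" using q q2 by (simp add: k_def \<kappa>_def)
    have dist: "distinct w" using less.prems(1) by (simp add: strict_sorted_iff)
    \<comment> \<open>\<open>k\<close> has to be the first argument of \<open>\<xi>\<^sub>q\<close>, whose entry is removed in \<open>xi_special\<close>\<close>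
    from graded_alg_decompose[OF char2 graded_alg_xi_fun img less.prems(1,4) k det less.hyps]
    obtain c g where g: "g \<in> H" "\<And>X. xi_fun q \<kappa> X = c * trace_word w X + g X" "g (special_pt k) = 0"
      by blast
    have "inj_on \<kappa> {1..2 * q}"
      using dist q by (auto simp: inj_on_def \<kappa>_def nth_eq_iff_index_eq)
    then have "xi_fun q \<kappa> (special_pt k) = (1 :: 'a)"
      unfolding k_def by (rule xi_fun_special_pt[OF q2 char2])
    moreover have "trace_word w (special_pt k) = (1 :: 'a)" by (rule trace_word_special_pt_1[OF dist k])
    ultimately have "c = 1" using g(2)[of "special_pt k"] g(3) by simp
    then have "trace_word w = (\<lambda>X. xi_fun q \<kappa> X + (- 1) * g X)" using g(2) by auto
    then show ?thesis using add_closed[OF \<open>xi_fun q \<kappa> \<in> H\<close> mult_closed[OF const_closed g(1)]] by metis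
  qed
qed

end

section \<open>Polynomials as functions\<close>

text \<open>
  Translation between the index conventions of points and of generic matrices; a row or column number above
  1 is read as 0, which does not arise for polynomials in the coordinate ring.
\<close>

definition nat_point :: "'a point \<Rightarrow> nat \<times> nat \<times> nat \<Rightarrow> 'a" where
  "nat_point X = (\<lambda>(i, j, k). X (i = 1, j = 1, k))"

definition poly_fun :: "'a::comm_ring_1 xpoly \<Rightarrow> 'a point \<Rightarrow> 'a" where
  "poly_fun p X = mpoly_eval (nat_point X) p"

lemma comm_ring_hom_mpoly_eval: "comm_ring_hom (mpoly_eval X)"
  unfolding mpoly_eval_subst by (rule comm_ring_hom.comm_ring_hom_subst[OF comm_ring_hom_id])

lemma mpoly_eval_Const [simp]: "mpoly_eval X (Const c) = c"
  unfolding mpoly_eval_subst by (rule comm_ring_hom.subst_Const[OF comm_ring_hom_id])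

lemma mpoly_eval_Var [simp]: "mpoly_eval X (Var v) = X v"
  unfolding mpoly_eval_subst by (rule comm_ring_hom.subst_Var[OF comm_ring_hom_id])

lemma mpoly_eval_add: "mpoly_eval X (p + q) = mpoly_eval X p + mpoly_eval X q"
  and mpoly_eval_mult: "mpoly_eval X (p * q) = mpoly_eval X p * mpoly_eval X q"
  unfolding mpoly_eval_subst
  by (rule comm_ring_hom.subst_add[OF comm_ring_hom_id] comm_ring_hom.subst_mult[OF comm_ring_hom_id])+

lemma mpoly_eval_cong:
  assumes "\<And>t v. t \<in> Poly_Mapping.keys p \<Longrightarrow> v \<in> Poly_Mapping.keys t \<Longrightarrow> X v = Y v"
  shows "mpoly_eval X p = mpoly_eval Y p"
  unfolding mpoly_eval_def using assms by (intro sum.cong prod.cong arg_cong2[where f = "(*)"]) auto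

lemma mpoly_eval_coord_cong:
  assumes "p \<in> coord_ring m" and "\<And>i j k. i < 2 \<Longrightarrow> j < 2 \<Longrightarrow> k \<in> {1..m} \<Longrightarrow> X (i, j, k) = Y (i, j, k)"
  shows "mpoly_eval X p = mpoly_eval Y p"
proof (rule mpoly_eval_cong)
  fix t v assume tv: "t \<in> Poly_Mapping.keys p" "v \<in> Poly_Mapping.keys t"
  then have "v \<in> {0..<2} \<times> {0..<2} \<times> {1..m}" using assms(1) unfolding coord_ring_def by blast
  then show "X v = Y v" using assms(2) by auto
qed

lemma poly_fun_polyfun:
  assumes "p \<in> coord_ring m"
  shows "poly_fun p \<in> polyfun (mats_vars {1..m})"
proof -
  have "(\<lambda>X. nat_point X v) \<in> polyfun (mats_vars {1..m})"
    if "t \<in> Poly_Mapping.keys p" "v \<in> Poly_Mapping.keys t" for t v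
  proof -
    have "v \<in> {0..<2} \<times> {0..<2} \<times> {1..m}" using assms that unfolding coord_ring_def by blast
    then show ?thesis by (auto simp: nat_point_def intro!: polyfun.var)
  qed
  then show ?thesis
    unfolding poly_fun_def[abs_def] mpoly_eval_def
    by (intro polyfun_sum polyfun_prod polyfun.mult polyfun.const polyfun_power)
qed

context infinite_field begin

text \<open>
  Distinct monomials are linearly independent as functions on an infinite field. Induction on the set of
  variables: comparing coefficients of powers of one variable leaves the monomials with a fixed exponent of
  it, which still differ in the others.
\<close>

lemma monomials_independent:
  fixes c :: "('v \<Rightarrow> nat) \<Rightarrow> 'a"
  assumes "finite S" "finite K" and "\<And>t t'. t \<in> K \<Longrightarrow> t' \<in> K \<Longrightarrow> (\<And>v. v \<in> S \<Longrightarrow> t v = t' v) \<Longrightarrow> t = t'"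
    and "\<And>X. (\<Sum>t\<in>K. c t * (\<Prod>v\<in>S. X v ^ t v)) = 0" and "t \<in> K"
  shows "c t = 0"
  using assms
proof (induction S arbitrary: K rule: finite_induct)
  case empty
  then have "K = {t}" by blast
  then show ?case using empty.prems(3) by simp
next
  case (insert v S)
  show ?case
  proof (rule insert.IH[of "{t' \<in> K. t' v = t v}"])
    show "finite {t' \<in> K. t' v = t v}" using insert.prems by simp
    show "t1 = t2" if "t1 \<in> {t' \<in> K. t' v = t v}" "t2 \<in> {t' \<in> K. t' v = t v}" "\<And>w. w \<in> S \<Longrightarrow> t1 w = t2 w" for t1 t2
      using that by (intro insert.prems(2)) auto
    show "t \<in> {t' \<in> K. t' v = t v}" using insert.prems by simp
    fix X :: "'v \<Rightarrow> 'a"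
    define b where "b t' = c t' * (\<Prod>w\<in>S. X w ^ t' w)" for t'
    have "(\<Sum>t'\<in>K. monom (b t') (t' v)) = 0"
    proof (rule poly_eq_cofinite[of "{}"])
      fix x :: 'a
      have "(\<Prod>w\<in>insert v S. (X(v := x)) w ^ t' w) = x ^ t' v * (\<Prod>w\<in>S. X w ^ t' w)" for t' :: "'v \<Rightarrow> nat"
      proof -
        have "(\<Prod>w\<in>S. (X(v := x)) w ^ t' w) = (\<Prod>w\<in>S. X w ^ t' w)"
          by (rule prod.cong[OF refl]) (use insert.hyps(2) in \<open>metis fun_upd_other\<close>)
        then show ?thesis using insert.hyps by simp
      qed
      then have "(\<Sum>t'\<in>K. b t' * x ^ t' v) = (\<Sum>t'\<in>K. c t' * (\<Prod>w\<in>insert v S. (X(v := x)) w ^ t' w))"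
        by (intro sum.cong) (simp_all add: b_def ac_simps)
      also have "\<dots> = 0" by (rule insert.prems)
      finally show "poly (\<Sum>t'\<in>K. monom (b t') (t' v)) x = poly 0 x"
        by (simp add: poly_sum poly_monom)
    qed simp
    then have "0 = coeff (\<Sum>t'\<in>K. monom (b t') (t' v)) (t v)" by simp
    also have "\<dots> = (\<Sum>t'\<in>K. if t' v = t v then b t' else 0)" by (simp add: coeff_sum)
    also have "\<dots> = (\<Sum>t'\<in>{t' \<in> K. t' v = t v}. b t')" by (rule sum.inter_filter[symmetric]) (rule insert.prems)
    finally show "(\<Sum>t'\<in>{t' \<in> K. t' v = t v}. c t' * (\<Prod>w\<in>S. X w ^ t' w)) = 0" by (simp add: b_def)
  qed
qed

lemma mpoly_eval_eq_0:
  fixes p :: "('v, 'a) mpoly"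
  assumes "\<And>X. mpoly_eval X p = 0"
  shows "p = 0"
proof (rule ccontr)
  assume "p \<noteq> 0"
  then obtain t where t: "t \<in> Poly_Mapping.keys p" by (metis keys_eq_empty all_not_in_conv)
  define S where "S = (\<Union>t\<in>Poly_Mapping.keys p. Poly_Mapping.keys t)"
  have fin: "finite S" by (simp add: S_def)
  define c where "c e = Poly_Mapping.lookup p (Abs_poly_mapping e)" for e :: "'v \<Rightarrow> nat"
  have "c (Poly_Mapping.lookup t) = 0"
  proof (rule monomials_independent[OF fin, of "Poly_Mapping.lookup ` Poly_Mapping.keys p"])
    fix t t' assume "t \<in> Poly_Mapping.lookup ` Poly_Mapping.keys p" "t' \<in> Poly_Mapping.lookup ` Poly_Mapping.keys p"
      and eq: "\<And>v. v \<in> S \<Longrightarrow> t v = t' v"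
    then obtain s s' where s: "s \<in> Poly_Mapping.keys p" "t = Poly_Mapping.lookup s"
      "s' \<in> Poly_Mapping.keys p" "t' = Poly_Mapping.lookup s'" by blast
    show "t = t'"
    proof
      fix v show "t v = t' v"
        using eq[of v] s by (cases "v \<in> S") (auto simp: S_def in_keys_iff)
    qed
  next
    fix X :: "'v \<Rightarrow> 'a"
    have "(\<Sum>e\<in>Poly_Mapping.lookup ` Poly_Mapping.keys p. c e * (\<Prod>v\<in>S. X v ^ e v))
      = (\<Sum>s\<in>Poly_Mapping.keys p. Poly_Mapping.lookup p s * (\<Prod>v\<in>S. X v ^ Poly_Mapping.lookup s v))"
      by (subst sum.reindex) (auto simp: c_def lookup_inject inj_on_def lookup_inverse)
    also have "\<dots> = mpoly_eval X p"
      unfolding mpoly_eval_def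
    proof (rule sum.cong[OF refl])
      fix s assume "s \<in> Poly_Mapping.keys p"
      then have "mono_val X s = (\<Prod>v\<in>S. X v ^ Poly_Mapping.lookup s v)"
        by (intro mono_val_superset[OF fin]) (auto simp: S_def)
      then show "Poly_Mapping.lookup p s * (\<Prod>v\<in>S. X v ^ Poly_Mapping.lookup s v)
        = Poly_Mapping.lookup p s * (\<Prod>v\<in>Poly_Mapping.keys s. X v ^ Poly_Mapping.lookup s v)"
        by (simp add: mono_val_def)
    qed
    finally show "(\<Sum>e\<in>Poly_Mapping.lookup ` Poly_Mapping.keys p. c e * (\<Prod>v\<in>S. X v ^ e v)) = 0"
      using assms by simp
  qed (use t in auto)
  then show False using t by (simp add: c_def lookup_inverse in_keys_iff)
qed

end

section \<open>The coordinate ring\<close>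

text \<open>
  The homogeneous component of degree \<open>d\<close> of the coordinate ring. Working with it proves
  homogeneity and membership in the coordinate ring at the same time.
\<close>

definition graded_part :: "nat \<Rightarrow> nat \<Rightarrow> 'a::comm_ring_1 xpoly set" where
  "graded_part m d = {p. \<forall>t\<in>Poly_Mapping.keys p. Poly_Mapping.keys t \<subseteq> {0..<2} \<times> {0..<2} \<times> {1..m} \<and>
     (\<Sum>v\<in>Poly_Mapping.keys t. Poly_Mapping.lookup t v) = d}"

lemma monomial_degree_add:
  "(\<Sum>v\<in>Poly_Mapping.keys (s + t). Poly_Mapping.lookup (s + t) v) =
   (\<Sum>v\<in>Poly_Mapping.keys s. Poly_Mapping.lookup s v) + (\<Sum>v\<in>Poly_Mapping.keys t. Poly_Mapping.lookup (t :: 'v \<Rightarrow>\<^sub>0 nat) v)"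
  by (rule setsum_keys_plus_distrib) auto

lemma graded_part_add: "p \<in> graded_part m d \<Longrightarrow> q \<in> graded_part m d \<Longrightarrow> p + q \<in> graded_part m d"
  unfolding graded_part_def using keys_add[of p q] by blast

lemma keys_mult_cases:
  assumes "t \<in> Poly_Mapping.keys (p * q)"
  obtains a b where "t = a + b" "a \<in> Poly_Mapping.keys p" "b \<in> Poly_Mapping.keys q"
  using keys_mult[of p q] assms by blast

lemma graded_part_mult:
  assumes "p \<in> graded_part m d" "q \<in> graded_part m e"
  shows "p * q \<in> graded_part m (d + e)"
  unfolding graded_part_def
proof (intro CollectI ballI)
  fix t assume "t \<in> Poly_Mapping.keys (p * q)"
  then obtain a b where t: "t = a + b" "a \<in> Poly_Mapping.keys p" "b \<in> Poly_Mapping.keys q"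
    by (rule keys_mult_cases)
  then show "Poly_Mapping.keys t \<subseteq> {0..<2} \<times> {0..<2} \<times> {1..m} \<and>
     (\<Sum>v\<in>Poly_Mapping.keys t. Poly_Mapping.lookup t v) = d + e"
    using assms keys_add[of a b] unfolding graded_part_def t(1) monomial_degree_add by fast
qed

lemma graded_part_Const: "Const c \<in> graded_part m 0"
  by (simp add: graded_part_def Const_def)

lemma graded_part_Var: "i < 2 \<Longrightarrow> j < 2 \<Longrightarrow> k \<in> {1..m} \<Longrightarrow> Var (i, j, k) \<in> graded_part m 1"
  by (simp add: graded_part_def Var_def)

lemma graded_part_0: "0 \<in> graded_part m d"
  by (simp add: graded_part_def)

lemma graded_part_uminus: "p \<in> graded_part m d \<Longrightarrow> - p \<in> graded_part m d"
  by (simp add: graded_part_def keys_def)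

lemma graded_part_diff: "p \<in> graded_part m d \<Longrightarrow> q \<in> graded_part m d \<Longrightarrow> p - q \<in> graded_part m d"
  using graded_part_add[OF _ graded_part_uminus, of p m d q] by simp

lemma graded_part_sum: "(\<And>i. i \<in> I \<Longrightarrow> p i \<in> graded_part m d) \<Longrightarrow> (\<Sum>i\<in>I. p i) \<in> graded_part m d"
  by (induction I rule: infinite_finite_induct) (auto intro: graded_part_add graded_part_0)

lemma graded_part_prod:
  assumes "finite I" "\<And>i. i \<in> I \<Longrightarrow> p i \<in> graded_part m 1"
  shows "(\<Prod>i\<in>I. p i) \<in> graded_part m (card I)"
  using assms
proof (induction I rule: finite_induct)
  case empty
  show ?case using graded_part_Const[of 1 m] by (simp add: Const_def)
next
  case (insert i I)
  then show ?case using graded_part_mult[of "p i" m 1] by simp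
qed

lemma graded_part_signof: "p \<in> graded_part m d \<Longrightarrow> signof \<sigma> * p \<in> graded_part m d"
  by (cases "sign \<sigma> = 1") (auto simp: sign_def intro: graded_part_uminus)

lemma graded_part_coord_ring: "p \<in> graded_part m d \<Longrightarrow> p \<in> coord_ring m"
  by (auto simp: graded_part_def coord_ring_def)

lemma graded_part_homogeneous: "p \<in> graded_part m d \<Longrightarrow> homogeneous p"
  by (auto simp: graded_part_def homogeneous_def)

lemma generic_matrix_carrier [simp]: "generic_matrix k \<in> carrier_mat 2 2"
  by (simp add: generic_matrix_def)

lemma generic_matrix_index: "i < 2 \<Longrightarrow> j < 2 \<Longrightarrow> generic_matrix k $$ (i, j) = Var (i, j, k)"
  by (simp add: generic_matrix_def)

lemma generic_entry: "i < 2 \<Longrightarrow> j < 2 \<Longrightarrow> k \<in> {1..m} \<Longrightarrow> generic_matrix k $$ (i, j) \<in> graded_part m 1"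
  by (simp only: generic_matrix_index graded_part_Var)

lemma generators_graded:
  assumes "p \<in> generators m"
  shows "\<exists>d. (p :: 'a::comm_ring_1 xpoly) \<in> graded_part m d"
proof -
  consider (det) k where "p = det (generic_matrix k)" "k \<in> {1..m}"
    | (bracket) l r where "p = bracket (generic_matrix l) (generic_matrix r)" "l \<in> {1..m}" "r \<in> {1..m}"
    | (xi) q \<kappa> where "p = xi q (\<lambda>s. generic_matrix (\<kappa> s))" "\<kappa> ` {1..2 * q} \<subseteq> {1..m}"
    using assms unfolding generators_def by fastforce
  then show ?thesis
  proof cases
    case det
    then show ?thesis
      by (intro exI[of _ "1 + 1"])
         (simp only: det_2x2[OF generic_matrix_carrier], intro graded_part_diff graded_part_mult generic_entry; simp)
  next
    case bracket
    then show ?thesis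
      by (intro exI[of _ "1 + 1"])
         (simp only: bracket_formula[OF generic_matrix_carrier generic_matrix_carrier],
          intro graded_part_diff graded_part_add graded_part_mult generic_entry; simp)
  next
    case xi
    have "xi_coeff q (\<lambda>s. generic_matrix (\<kappa> s)) i j \<in> graded_part m 1" if ij: "i < 2 * q" "j < 2 * q" for i j
    proof (cases "blk q (i div 2 + 1) (j div 2 + 1)")
      case None
      then show ?thesis by (simp add: xi_coeff_def graded_part_0)
    next
      case (Some v)
      have "\<kappa> (arg_index q v) \<in> {1..m}"
        using blk_arg_index[OF Some block_index[OF ij(1)] block_index[OF ij(2)]] xi(2) by blast
      then have "generic_matrix (\<kappa> (arg_index q v)) $$ (i mod 2, j mod 2) \<in> graded_part m 1"
        by (intro generic_entry) simp_all
      then show ?thesis using Some by (simp add: xi_coeff_def)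
    qed
    then have "(\<Prod>i = 0..<2 * q. xi_coeff q (\<lambda>s. generic_matrix (\<kappa> s)) i (\<sigma> i)) \<in> graded_part m (card {0..<2 * q})"
      if "\<sigma> \<in> xi_perms q" for \<sigma>
      using that permutes_in_image[of \<sigma> "{0..<2 * q}"] by (intro graded_part_prod) (auto simp: xi_perms_def)
    then have "p \<in> graded_part m (card {0..<2 * q})"
      unfolding xi(1) by (subst xi_formula) (auto intro!: graded_part_sum graded_part_signof)
    then show ?thesis by blast
  qed
qed

lemma coord_ring_add: "p \<in> coord_ring m \<Longrightarrow> q \<in> coord_ring m \<Longrightarrow> p + q \<in> coord_ring m"
  unfolding coord_ring_def using keys_add[of p q] by blast

lemma coord_ring_mult:
  assumes "p \<in> coord_ring m" "q \<in> coord_ring m"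
  shows "p * q \<in> coord_ring m"
  unfolding coord_ring_def
proof (intro CollectI ballI)
  fix t assume "t \<in> Poly_Mapping.keys (p * q)"
  then obtain a b where t: "t = a + b" "a \<in> Poly_Mapping.keys p" "b \<in> Poly_Mapping.keys q"
    by (rule keys_mult_cases)
  then show "Poly_Mapping.keys t \<subseteq> {0..<2} \<times> {0..<2} \<times> {1..m}"
    using assms keys_add[of a b] unfolding coord_ring_def t(1) by fast
qed

lemma poly_fun_add: "poly_fun (p + q) X = poly_fun p X + poly_fun q X"
  and poly_fun_mult: "poly_fun (p * q) X = poly_fun p X * poly_fun q X"
  and poly_fun_Const: "poly_fun (Const c) X = c"
  by (simp_all add: poly_fun_def mpoly_eval_add mpoly_eval_mult)

lemma (in infinite_field) poly_fun_inj:
  fixes p q :: "'a xpoly"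
  assumes pq: "p \<in> coord_ring m" "q \<in> coord_ring m" and eq: "\<And>X. poly_fun p X = poly_fun q X"
  shows "p = q"
proof -
  have "mpoly_eval X (p + Const (- 1) * q) = 0" for X
  proof -
    define Z where "Z = (\<lambda>(i, j, k). X (if i then 1 else 0, if j then 1 else 0, k) :: 'a)"
    have nz: "nat_point Z (i, j, k) = X (i, j, k)" if "i < 2" "j < 2" for i j k :: nat
    proof -
      have "i = 0 \<or> i = 1" "j = 0 \<or> j = 1" using that by auto
      then show ?thesis by (auto simp: nat_point_def Z_def)
    qed
    have "mpoly_eval X p = poly_fun p Z" "mpoly_eval X q = poly_fun q Z"
      unfolding poly_fun_def by (rule mpoly_eval_coord_cong[OF pq(1)] mpoly_eval_coord_cong[OF pq(2)]; simp add: nz)+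
    then show ?thesis using eq by (simp add: mpoly_eval_add mpoly_eval_mult)
  qed
  then have "p + Const (- 1) * q = 0" by (rule mpoly_eval_eq_0)
  moreover have "Const (- 1) = (- 1 :: 'a xpoly)" by (simp add: Const_def single_uminus)
  ultimately show ?thesis by simp
qed

section \<open>Invariant polynomials as invariant functions\<close>

definition m2_of :: "'a mat \<Rightarrow> 'a m2" where
  "m2_of A = M2 (A $$ (0, 0)) (A $$ (0, 1)) (A $$ (1, 0)) (A $$ (1, 1))"

lemma mat_of_m2_of: "A \<in> carrier_mat 2 2 \<Longrightarrow> mat_of (m2_of A) = A"
proof (rule eq_matI)
  fix i j assume "A \<in> carrier_mat 2 2" "i < dim_row A" "j < dim_col A"
  then have "i = 0 \<or> i = 1" "j = 0 \<or> j = 1" by auto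
  then show "mat_of (m2_of A) $$ (i, j) = A $$ (i, j)"
    by (auto simp: mat_of_index m2_of_def entry_def)
qed (simp_all add: mat_of_def)

lemma mat_of_one: "mat_of 1 = 1\<^sub>m 2"
proof (rule eq_matI)
  fix i j assume "i < dim_row (1\<^sub>m 2 :: 'a mat)" "j < dim_col (1\<^sub>m 2 :: 'a mat)"
  then have "i = 0 \<or> i = 1" "j = 0 \<or> j = 1" by auto
  then show "mat_of 1 $$ (i, j) = (1\<^sub>m 2 :: 'a mat) $$ (i, j)"
    by (auto simp: mat_of_index one_m2_def entry_def)
qed (simp_all add: mat_of_def)

lemma inv_mat_of:
  assumes "det2 (x :: 'a::field m2) = 1"
  shows "inv\<^bsub>ring_mat TYPE('a) 2 ()\<^esub> (mat_of x) = mat_of (adj2 x)"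
proof -
  interpret ring "ring_mat TYPE('a) 2 ()" by (rule ring_mat)
  have "mat_of x * mat_of (adj2 x) = 1\<^sub>m 2" "mat_of (adj2 x) * mat_of x = 1\<^sub>m 2"
    using assms by (simp_all add: mult_adj2 adj2_mult_self scalar2_one mat_of_one flip: mat_of_mult)
  then show ?thesis by (intro inv_char) (simp_all add: ring_mat_simps)
qed

lemma eval_at_mat_of:
  assumes "p \<in> coord_ring m" and "\<And>k. k \<in> {1..m} \<Longrightarrow> A k = mat_of (mtx X k)"
  shows "eval_at A p = poly_fun p X"
  unfolding eval_at_def poly_fun_def
proof (rule mpoly_eval_coord_cong[OF assms(1)])
  fix i j k :: nat assume ij: "i < 2" "j < 2" "k \<in> {1..m}"
  then have "i = 0 \<or> i = 1" "j = 0 \<or> j = 1" by auto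
  then show "(case (i, j, k) of (i, j, k) \<Rightarrow> A k $$ (i, j)) = nat_point X (i, j, k)"
    using assms(2)[OF ij(3)] by (auto simp: mat_of_index nat_point_def entry_def mtx_def)
qed

text \<open>
  The two actions differ by the inverse transpose of \<open>h\<close>, which again ranges over the whole
  group; the adjugate serves as inverse.
\<close>

lemma invariants_iff:
  "(p :: 'a::field xpoly) \<in> invariants m \<longleftrightarrow> p \<in> coord_ring m \<and> sl_invariant {} (poly_fun p)"
proof safe
  assume p: "p \<in> invariants m"
  then show coord: "p \<in> coord_ring m" by (simp add: invariants_def)
  show "sl_invariant {} (poly_fun p)"
    unfolding sl_invariant_def
  proof (intro allI impI)
    fix g h :: "'a m2" and X :: "'a point" assume g: "det2 g = 1" and h: "det2 h = 1"
    define h' where "h' = adj2 (transp2 h)"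
    have h': "det2 h' = 1" "adj2 h' = transp2 h"
      using h by (auto simp: h'_def adj2_def transp2_def det2_def mult.commute)
    have "mat_of g \<in> SL2" "mat_of h' \<in> SL2" using g h' by (simp_all add: SL2_def det_mat_of)
    then have "eval_at (act (mat_of g) (mat_of h') (\<lambda>k. mat_of (mtx X k))) p = eval_at (\<lambda>k. mat_of (mtx X k)) p"
      using p by (simp add: invariants_def)
    moreover have "eval_at (\<lambda>k. mat_of (mtx X k)) p = poly_fun p X" by (rule eval_at_mat_of[OF coord]) simp
    moreover have "eval_at (act (mat_of g) (mat_of h') (\<lambda>k. mat_of (mtx X k))) p = poly_fun p (sl_act {} g h X)"
      by (rule eval_at_mat_of[OF coord]) (simp add: act_def inv_mat_of h' mtx_sl_act mat_of_mult)
    ultimately show "poly_fun p (sl_act {} g h X) = poly_fun p X" by simp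
  qed
next
  assume coord: "p \<in> coord_ring m" and inv: "sl_invariant {} (poly_fun p)"
  have "eval_at (act g h A) p = eval_at A p"
    if g: "g \<in> SL2" and h: "h \<in> SL2" and A: "\<forall>k\<in>{1..m}. A k \<in> carrier_mat 2 2" for g h A
  proof -
    define X where "X = (\<lambda>(i, j, k). entry (m2_of (A k)) i j)"
    have mX: "mtx X k = m2_of (A k)" for k by (simp add: mtx_def X_def entry_def m2_of_def)
    have AX: "A k = mat_of (mtx X k)" if "k \<in> {1..m}" for k using A that by (simp add: mX mat_of_m2_of)
    have gc: "g = mat_of (m2_of g)" "h = mat_of (m2_of h)" using g h by (simp_all add: SL2_def mat_of_m2_of)
    then have d: "det2 (m2_of g) = 1" "det2 (m2_of h) = 1"
      using g h by (simp_all add: SL2_def flip: det_mat_of)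
    define h' where "h' = transp2 (adj2 (m2_of h))"
    have h': "det2 h' = 1" "transp2 h' = adj2 (m2_of h)"
      using d(2) by (auto simp: h'_def adj2_def transp2_def det2_def mult.commute)
    have "eval_at (act g h A) p = poly_fun p (sl_act {} (m2_of g) h' X)"
    proof (rule eval_at_mat_of[OF coord])
      fix k assume k: "k \<in> {1..m}"
      have "inv\<^bsub>ring_mat TYPE('a) 2 ()\<^esub> h = mat_of (adj2 (m2_of h))"
        using inv_mat_of[OF d(2)] gc(2) by metis
      then have "act g h A k = mat_of (m2_of g) * mat_of (mtx X k) * mat_of (adj2 (m2_of h))"
        by (simp only: act_def AX[OF k, symmetric] gc(1)[symmetric])
      then show "act g h A k = mat_of (mtx (sl_act {} (m2_of g) h' X) k)"
        by (simp add: mtx_sl_act mat_of_mult h')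
    qed
    also have "\<dots> = poly_fun p X" by (rule sl_invariantD[OF inv d(1) h'(1)])
    also have "\<dots> = eval_at A p" by (rule eval_at_mat_of[OF coord, symmetric]) (rule AX)
    finally show ?thesis .
  qed
  then show "p \<in> invariants m" using coord by (simp add: invariants_def)
qed

section \<open>The generators as functions\<close>

lemma map_generic_matrix:
  "map_mat (mpoly_eval (nat_point X)) (generic_matrix k) = mat_of (mtx X k)"
proof (rule eq_matI)
  fix i j assume "i < dim_row (mat_of (mtx X k))" "j < dim_col (mat_of (mtx X k))"
  then have ij: "i < 2" "j < 2" by (simp_all add: mat_of_def)
  then have "i = 0 \<or> i = 1" "j = 0 \<or> j = 1" by auto
  then show "map_mat (mpoly_eval (nat_point X)) (generic_matrix k) $$ (i, j) = mat_of (mtx X k) $$ (i, j)"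
    using ij by (auto simp: generic_matrix_def mat_of_index nat_point_def entry_def mtx_def)
qed (simp_all add: generic_matrix_def mat_of_def)

lemma (in comm_ring_hom) hom_bracket:
  assumes "x \<in> carrier_mat 2 2" "y \<in> carrier_mat 2 2"
  shows "bracket (map_mat hom x) (map_mat hom y) = hom (bracket x y)"
  using assms by (simp add: bracket_formula hom_distribs)

lemma bracket_smult:
  assumes "x \<in> carrier_mat 2 2" "y \<in> carrier_mat 2 2"
  shows "bracket (a \<cdot>\<^sub>m x) (b \<cdot>\<^sub>m y) = a * b * bracket x y"
  using assms by (simp add: bracket_formula algebra_simps)

lemma bracket_mat_of: "bracket (mat_of (mtx X k)) (mat_of (mtx X l)) = trace_word [k, l] X"
  by (simp add: bracket_formula mat_of_index entry_def trace_word_def tr2_def adj2_def m2_simps algebra_simps)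

lemma poly_fun_det: "poly_fun (det (generic_matrix k)) X = det2 (mtx X k)"
  using comm_ring_hom.hom_det[OF comm_ring_hom_mpoly_eval, of "nat_point X" "generic_matrix k"]
  by (simp add: poly_fun_def map_generic_matrix det_mat_of)

lemma poly_fun_bracket: "poly_fun (bracket (generic_matrix k) (generic_matrix l)) X = trace_word [k, l] X"
  using comm_ring_hom.hom_bracket[OF comm_ring_hom_mpoly_eval generic_matrix_carrier generic_matrix_carrier,
      of "nat_point X" k l]
  by (simp add: poly_fun_def map_generic_matrix bracket_mat_of)

lemma poly_fun_xi: "poly_fun (xi q (\<lambda>s. generic_matrix (\<kappa> s))) X = xi_fun q \<kappa> X"
  using comm_ring_hom.hom_xi[OF comm_ring_hom_mpoly_eval, of q "\<lambda>s. generic_matrix (\<kappa> s)" "nat_point X"]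
  by (simp add: poly_fun_def map_generic_matrix xi_fun_def)

section \<open>Generation\<close>

lemma is_subalgebra_hull: "is_subalgebra (is_subalgebra hull T)"
  by (rule hull_in) (auto simp: is_subalgebra_def)

lemma is_subalgebraD:
  assumes "is_subalgebra B"
  shows "Const c \<in> B" "p \<in> B \<Longrightarrow> q \<in> B \<Longrightarrow> p + q \<in> B" "p \<in> B \<Longrightarrow> q \<in> B \<Longrightarrow> p * q \<in> B"
  using assms by (auto simp: is_subalgebra_def)

lemma is_subalgebra_invariants: "is_subalgebra (invariants m :: 'a::field xpoly set)"
  unfolding is_subalgebra_def
proof (intro conjI allI ballI)
  fix c :: 'a
  have "Const c \<in> (coord_ring m :: 'a xpoly set)" by (simp add: coord_ring_def Const_def)
  then show "Const c \<in> invariants m" by (simp add: invariants_iff sl_invariant_def poly_fun_Const)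
qed (auto simp: invariants_iff sl_invariant_def poly_fun_add poly_fun_mult intro: coord_ring_add coord_ring_mult)

lemma generators_invariant: "(generators m :: 'a::field xpoly set) \<subseteq> invariants m"
proof
  fix p :: "'a xpoly" assume p: "p \<in> generators m"
  have "sl_invariant {} (poly_fun p)"
    using p unfolding generators_def
  proof (elim UnE CollectE exE conjE)
    fix k assume "p = det (generic_matrix k)"
    then show ?thesis using det_invariant[of k] by (simp add: poly_fun_det sl_invariant_def)
  next
    fix l r assume "p = bracket (generic_matrix l) (generic_matrix r)"
    then show ?thesis using trace_word_invariant[of "[l, r]"] by (simp add: poly_fun_bracket sl_invariant_def)
  next
    fix q \<kappa> assume "p = xi q (\<lambda>s. generic_matrix (\<kappa> s))"
    then show ?thesis using xi_fun_invariant[of q \<kappa>] by (simp add: poly_fun_xi sl_invariant_def)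
  qed
  moreover have "p \<in> coord_ring m"
    using generators_graded[OF p] graded_part_coord_ring by blast
  ultimately show "p \<in> invariants m" by (simp add: invariants_iff)
qed

lemma hull_generators_subset:
  "is_subalgebra hull generators m \<subseteq> (invariants m :: 'a::field xpoly set)"
  by (rule hull_minimal) (rule generators_invariant is_subalgebra_invariants)+

text \<open>
  The functions defined by the generated subalgebra form an algebra that contains all determinants and
  traces, hence all invariant functions. Since polynomials are determined by their functions, the
  subalgebra contains all invariant polynomials.
\<close>

theorem (in infinite_field) generators_generate:
  assumes char2: "(1 :: 'a) + 1 = 0"
  shows "is_subalgebra hull generators m = (invariants m :: 'a xpoly set)"
proof
  show "is_subalgebra hull generators m \<subseteq> (invariants m :: 'a xpoly set)"
    by (rule hull_generators_subset)
  let ?G = "is_subalgebra hull generators m :: 'a xpoly set"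
  define H where "H = poly_fun ` ?G"
  note sub = is_subalgebraD[OF is_subalgebra_hull[of "generators m"]]
  have HI: "f \<in> H" if "p \<in> ?G" "\<And>X. poly_fun p X = f X" for p f
    using that unfolding H_def by (intro image_eqI[of _ _ p]) auto
  have gen: "p \<in> ?G" if "p \<in> generators m" for p using that by (rule hull_inc)
  interpret H: function_algebra H
  proof
    show "(\<lambda>X. c) \<in> H" for c by (rule HI[of "Const c"]) (use sub poly_fun_Const in auto)
    fix f g assume "f \<in> H" "g \<in> H"
    then obtain p q where "p \<in> ?G" "q \<in> ?G" "f = poly_fun p" "g = poly_fun q" by (auto simp: H_def)
    then show "(\<lambda>X. f X + g X) \<in> H" "(\<lambda>X. f X * g X) \<in> H"
      by (auto intro: HI[OF sub(2)[of p q]] HI[OF sub(3)[of p q]] simp: poly_fun_add poly_fun_mult)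
  qed
  have det: "(\<lambda>X. det2 (mtx X k)) \<in> H" if "k \<in> {1..m}" for k
    by (rule HI[OF gen poly_fun_det]) (use that in \<open>auto simp: generators_def\<close>)
  have pair: "trace_word [l, r] \<in> H" if "l \<in> {1..m}" "r \<in> {1..m}" "l < r" for l r
    by (rule HI[OF gen poly_fun_bracket]) (use that in \<open>auto simp: generators_def\<close>)
  have xi: "xi_fun q \<kappa> \<in> H" if "2 \<le> q" "strict_mono_on {1..2 * q} \<kappa>" "\<kappa> ` {1..2 * q} \<subseteq> {1..m}" for q \<kappa>
  proof (rule HI[OF gen poly_fun_xi])
    have "card (\<kappa> ` {1..2 * q}) \<le> card {1..m}" by (rule card_mono) (use that in auto)
    moreover have "card (\<kappa> ` {1..2 * q}) = 2 * q"
      using card_image[OF strict_mono_on_imp_inj_on[OF that(2)]] by simp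
    ultimately show "xi q (\<lambda>s. generic_matrix (\<kappa> s)) \<in> generators m"
      using that by (auto simp: generators_def)
  qed
  show "(invariants m :: 'a xpoly set) \<subseteq> ?G"
  proof
    fix p :: "'a xpoly" assume "p \<in> invariants m"
    then have p: "p \<in> coord_ring m" "sl_invariant {} (poly_fun p)" by (simp_all add: invariants_iff)
    have "poly_fun p \<in> H"
    proof (rule invariants_in_closure[OF _ poly_fun_polyfun[OF p(1)] p(2)])
      fix \<alpha> and g :: "'a point \<Rightarrow> 'a" assume "set_mset \<alpha> \<subseteq> {1..m}" "graded_alg \<alpha> g"
      then show "g \<in> H"
        using H.graded_alg_in_H[of \<alpha> g "{1..m}"] H.trace_word_in_H[OF infinite_field char2 det pair xi] det by blast
    qed (auto intro: H.add_closed)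
    then obtain p' where p': "p' \<in> ?G" "poly_fun p = poly_fun p'" by (auto simp: H_def)
    then have "p' \<in> coord_ring m"
      using hull_generators_subset[of m] invariants_iff by blast
    then have "p = p'" by (rule poly_fun_inj[OF p(1)]) (use p' in simp)
    then show "p \<in> ?G" using p'(1) by simp
  qed
qed

section \<open>Minimality\<close>

definition param :: "nat set \<Rightarrow> nat \<Rightarrow> (nat, 'a::comm_ring_1) mpoly" where
  "param K k = (if k \<in> K then Var k else 0)"

text \<open>
  The matrices of the special point are multiplied by independent parameters for the indices in
  \<open>K\<close>, and by 0 for the others.
\<close>

definition specialise :: "nat set \<Rightarrow> nat \<Rightarrow> 'a::comm_ring_1 xpoly \<Rightarrow> (nat, 'a) mpoly" where
  "specialise K k0 =
     subst Const (\<lambda>(i, j, k). param K k * Const (special_pt k0 (i = 1, j = 1, k)))"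

lemma comm_ring_hom_specialise: "comm_ring_hom (specialise K k0 :: 'a::comm_ring_1 xpoly \<Rightarrow> _)"
  unfolding specialise_def by (rule comm_ring_hom.comm_ring_hom_subst[OF comm_ring_hom_Const])

lemma specialise_generic_matrix:
  "map_mat (specialise K k0) (generic_matrix k) =
     param K k \<cdot>\<^sub>m map_mat Const (mat_of (mtx (special_pt k0) k) :: 'a::comm_ring_1 mat)"
proof (rule eq_matI)
  fix i j assume "i < dim_row (param K k \<cdot>\<^sub>m map_mat Const (mat_of (mtx (special_pt k0) k) :: 'a mat))"
    "j < dim_col (param K k \<cdot>\<^sub>m map_mat Const (mat_of (mtx (special_pt k0) k) :: 'a mat))"
  then have ij: "i < 2" "j < 2" by (simp_all add: mat_of_def)
  then have "i = 0 \<or> i = 1" "j = 0 \<or> j = 1" by auto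
  then show "map_mat (specialise K k0) (generic_matrix k) $$ (i, j) =
      (param K k \<cdot>\<^sub>m map_mat Const (mat_of (mtx (special_pt k0) k) :: 'a mat)) $$ (i, j)"
    using ij by (auto simp: generic_matrix_def specialise_def mat_of_def entry_def mtx_def
        comm_ring_hom.subst_Var[OF comm_ring_hom_Const])
qed (simp_all add: generic_matrix_def mat_of_def)

lemma specialise_det:
  "specialise K k0 (det (generic_matrix k)) = param K k ^ 2 * Const (det2 (mtx (special_pt k0) k))"
  by (subst comm_ring_hom.hom_det[OF comm_ring_hom_specialise, symmetric])
     (simp add: specialise_generic_matrix comm_ring_hom.hom_det[OF comm_ring_hom_Const] det_mat_of
      carrier_matD(2)[OF mat_of_carrier])

lemma specialise_bracket:
  "specialise K k0 (bracket (generic_matrix l) (generic_matrix r)) =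
     param K l * param K r * Const (trace_word [l, r] (special_pt k0))"
  by (subst comm_ring_hom.hom_bracket[OF comm_ring_hom_specialise, symmetric])
     (simp_all add: specialise_generic_matrix bracket_smult comm_ring_hom.hom_bracket[OF comm_ring_hom_Const]
       bracket_mat_of)

lemma specialise_xi:
  "specialise K k0 (xi q (\<lambda>s. generic_matrix (\<kappa> s))) =
     (\<Prod>s = 1..2 * q. param K (\<kappa> s)) * Const (xi_fun q \<kappa> (special_pt k0))"
  by (subst comm_ring_hom.hom_xi[OF comm_ring_hom_specialise, symmetric])
     (simp_all add: specialise_generic_matrix xi_smult comm_ring_hom.hom_xi[OF comm_ring_hom_Const] xi_fun_def)

lemma prod_param:
  assumes "finite L"
  shows "(\<Prod>k\<in>L. param K k) = (if L \<subseteq> K then Poly_Mapping.single (\<Sum>k\<in>L. Poly_Mapping.single k 1) 1 else 0 :: (nat, 'a::comm_ring_1) mpoly)"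
proof (cases "L \<subseteq> K")
  case True
  then have "(\<Prod>k\<in>L. param K k) = (\<Prod>k\<in>L. Poly_Mapping.single (Poly_Mapping.single k 1) 1 :: (nat, 'a) mpoly)"
    by (intro prod.cong) (auto simp: param_def Var_def)
  with True show ?thesis by (simp add: prod_single)
next
  case False
  then obtain k where "k \<in> L" "k \<notin> K" by blast
  then have "\<exists>k\<in>L. param K k = (0 :: (nat, 'a) mpoly)" by (auto simp: param_def)
  then show ?thesis using assms False by (simp add: prod_zero)
qed

text \<open>
  The exponents of the parameters that occur in polynomials in the other generators: the determinants
  contribute squares of parameters other than \<open>k0\<close>, every other contributing generator
  contributes \<open>k0\<close> once, together with some but not all parameters of \<open>K\<close>.
  Exponent 2 or more in \<open>k0\<close> is admitted to make the condition stable under addition.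
  The exponent with value 1 on all of \<open>K\<close> violates the condition.
\<close>

definition decomposable_exponent :: "nat set \<Rightarrow> nat \<Rightarrow> (nat \<Rightarrow>\<^sub>0 nat) \<Rightarrow> bool" where
  "decomposable_exponent K k0 e \<longleftrightarrow>
     Poly_Mapping.lookup e k0 = 0 \<and> (\<forall>k. even (Poly_Mapping.lookup e k)) \<or>
     Poly_Mapping.lookup e k0 = 1 \<and> (\<exists>k\<in>K. even (Poly_Mapping.lookup e k)) \<or>
     Poly_Mapping.lookup e k0 \<ge> 2"

lemma decomposable_exponent_add:
  assumes "decomposable_exponent K k0 d" "decomposable_exponent K k0 e"
  shows "decomposable_exponent K k0 (d + e)"
proof -
  consider "Poly_Mapping.lookup d k0 + Poly_Mapping.lookup e k0 \<ge> 2"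
    | "Poly_Mapping.lookup d k0 = 0" "Poly_Mapping.lookup e k0 = 0"
    | "Poly_Mapping.lookup d k0 = 1" "Poly_Mapping.lookup e k0 = 0"
    | "Poly_Mapping.lookup d k0 = 0" "Poly_Mapping.lookup e k0 = 1"
    by linarith
  then show ?thesis
    using assms by cases (auto simp: decomposable_exponent_def lookup_add)
qed

definition decomposables :: "nat set \<Rightarrow> nat \<Rightarrow> 'a::comm_ring_1 xpoly set" where
  "decomposables K k0 =
     {p. \<forall>e\<in>Poly_Mapping.keys (specialise K k0 p). decomposable_exponent K k0 e}"

lemma is_subalgebra_decomposables: "is_subalgebra (decomposables K k0 :: 'a::comm_ring_1 xpoly set)"
proof -
  interpret \<psi>: comm_ring_hom "specialise K k0 :: 'a xpoly \<Rightarrow> _" by (rule comm_ring_hom_specialise)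
  show ?thesis
    unfolding is_subalgebra_def
  proof (intro conjI allI ballI)
    fix c :: 'a
    have "specialise K k0 (Const c) = Const c"
      unfolding specialise_def by (rule comm_ring_hom.subst_Const[OF comm_ring_hom_Const])
    then show "Const c \<in> decomposables K k0"
      by (simp add: decomposables_def Const_def decomposable_exponent_def)
  next
    fix p q :: "'a xpoly" assume pq: "p \<in> decomposables K k0" "q \<in> decomposables K k0"
    then show "p + q \<in> decomposables K k0"
      using keys_add[of "specialise K k0 p" "specialise K k0 q"]
      unfolding decomposables_def by (simp only: \<psi>.hom_add mem_Collect_eq) blast
    show "p * q \<in> decomposables K k0"
      unfolding decomposables_def
    proof (intro CollectI ballI)
      fix t assume "t \<in> Poly_Mapping.keys (specialise K k0 (p * q))"
      then have "t \<in> Poly_Mapping.keys (specialise K k0 p * specialise K k0 q)"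
        by (simp only: \<psi>.hom_mult)
      then obtain a b where "t = a + b" "a \<in> Poly_Mapping.keys (specialise K k0 p)"
        "b \<in> Poly_Mapping.keys (specialise K k0 q)" by (rule keys_mult_cases)
      then show "decomposable_exponent K k0 t"
        using pq decomposable_exponent_add unfolding decomposables_def by blast
    qed
  qed
qed

text \<open>
  The generators that are linear in each matrix occurring in them, with the set \<open>L\<close> of their
  indices and the function that they define. Brackets and \<open>\<xi>\<^sub>q\<close> behave alike from
  here on.
\<close>

definition squarefree_generator :: "'a::comm_ring_1 xpoly \<Rightarrow> nat set \<Rightarrow> ('a point \<Rightarrow> 'a) \<Rightarrow> bool" where
  "squarefree_generator p L f \<longleftrightarrow>
     (\<exists>l r. l < r \<and> L = {l, r} \<and> p = bracket (generic_matrix l) (generic_matrix r) \<and> f = trace_word [l, r]) \<or>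
     (\<exists>q \<kappa>. 2 \<le> q \<and> strict_mono_on {1..2 * q} \<kappa> \<and> L = \<kappa> ` {1..2 * q} \<and>
        p = xi q (\<lambda>s. generic_matrix (\<kappa> s)) \<and> f = xi_fun q \<kappa>)"

lemma generators_cases:
  assumes "p \<in> generators m"
  obtains (det) k where "p = det (generic_matrix k)" | (squarefree) L f where "squarefree_generator p L f"
proof -
  from assms consider (d) k where "p = det (generic_matrix k)"
    | (b) l r where "p = bracket (generic_matrix l) (generic_matrix r)" "l < r"
    | (x) q \<kappa> where "p = xi q (\<lambda>s. generic_matrix (\<kappa> s))" "2 \<le> q" "strict_mono_on {1..2 * q} \<kappa>"
    unfolding generators_def by (elim UnE CollectE exE conjE) metis+
  then show thesis
  proof cases
    case d
    then show thesis by (rule det)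
  next
    case b
    then have "squarefree_generator p {l, r} (trace_word [l, r])" unfolding squarefree_generator_def by blast
    then show thesis by (rule squarefree)
  next
    case x
    then have "squarefree_generator p (\<kappa> ` {1..2 * q}) (xi_fun q \<kappa>)"
      unfolding squarefree_generator_def by blast
    then show thesis by (rule squarefree)
  qed
qed

lemma squarefree_generator_finite:
  "squarefree_generator p L f \<Longrightarrow> finite L \<and> L \<noteq> {}"
  by (auto simp: squarefree_generator_def)

lemma (in infinite_field) squarefree_generator_graded_alg:
  assumes "squarefree_generator p L (f :: 'a point \<Rightarrow> 'a)"
  shows "graded_alg (mset_set L) f"
  using assms unfolding squarefree_generator_def
proof (elim disjE exE conjE)
  fix l r :: nat assume "l < r" "L = {l, r}" "f = trace_word [l, r]"
  then show ?thesis using graded_alg_trace_word_pair[of l r] by simp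
next
  fix q :: nat and \<kappa> :: "nat \<Rightarrow> nat" assume "strict_mono_on {1..2 * q} \<kappa>" "L = \<kappa> ` {1..2 * q}" "f = xi_fun q \<kappa>"
  then show ?thesis using graded_alg_xi_fun[of \<kappa> q] image_mset_mset_set[OF strict_mono_on_imp_inj_on] by metis
qed

lemma squarefree_generator_specialise:
  assumes "squarefree_generator p L f"
  shows "specialise K k0 p = (\<Prod>k\<in>L. param K k) * Const (f (special_pt k0))"
  using assms unfolding squarefree_generator_def
proof (elim disjE exE conjE)
  fix l r :: nat assume "l < r" "L = {l, r}" "p = bracket (generic_matrix l) (generic_matrix r)" "f = trace_word [l, r]"
  then show ?thesis by (simp add: specialise_bracket)
next
  fix q :: nat and \<kappa> :: "nat \<Rightarrow> nat" assume *: "strict_mono_on {1..2 * q} \<kappa>" "L = \<kappa> ` {1..2 * q}" "p = xi q (\<lambda>s. generic_matrix (\<kappa> s))"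
    "f = xi_fun q \<kappa>"
  show ?thesis unfolding *(2-4) specialise_xi prod.reindex[OF strict_mono_on_imp_inj_on[OF *(1)]] by simp
qed

lemma squarefree_generator_special_pt:
  assumes char2: "(1 :: 'a::comm_ring_1) + 1 = 0" and "squarefree_generator p L (f :: 'a point \<Rightarrow> 'a)"
  shows "f (special_pt (Min L)) = 1"
  using assms(2) unfolding squarefree_generator_def
proof (elim disjE exE conjE)
  fix l r :: nat assume "l < r" "L = {l, r}" "f = trace_word [l, r]"
  then show ?thesis by (simp add: trace_word_special_pt_1)
next
  fix q :: nat and \<kappa> :: "nat \<Rightarrow> nat" assume *: "2 \<le> q" "strict_mono_on {1..2 * q} \<kappa>" "L = \<kappa> ` {1..2 * q}" "f = xi_fun q \<kappa>"
  have "Min L = \<kappa> 1"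
    unfolding *(3)
  proof (rule Min_eqI)
    fix y assume "y \<in> \<kappa> ` {1..2 * q}"
    then obtain s where s: "s \<in> {1..2 * q}" "y = \<kappa> s" by blast
    then show "\<kappa> 1 \<le> y"
      using strict_mono_onD[OF *(2), of 1 s] by (cases "s = 1") auto
  qed (use *(1) in auto)
  then show ?thesis using xi_fun_special_pt[OF *(1) char2 strict_mono_on_imp_inj_on[OF *(2)]] *(4) by simp
qed

lemma strict_mono_on_image_eq:
  fixes \<kappa> \<mu> :: "nat \<Rightarrow> nat"
  assumes "strict_mono_on {1..n} \<kappa>" "strict_mono_on {1..n} \<mu>" "\<kappa> ` {1..n} = \<mu> ` {1..n}" "s \<in> {1..n}"
  shows "\<kappa> s = \<mu> s"
proof -
  have srt: "sorted_wrt (<) (map f [1..<n + 1])" if "strict_mono_on {1..n} f" for f :: "nat \<Rightarrow> nat"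
    unfolding sorted_wrt_map
    by (rule sorted_wrt_mono_rel[OF _ sorted_wrt_upt]) (use strict_mono_onD[OF that] in auto)
  have "map \<kappa> [1..<n + 1] = map \<mu> [1..<n + 1]"
  proof (rule sorted_distinct_set_unique)
    show "set (map \<kappa> [1..<n + 1]) = set (map \<mu> [1..<n + 1])"
      using assms(3) by (simp add: atLeastLessThanSuc_atLeastAtMost del: upt_Suc)
  qed (use srt assms(1,2) in \<open>simp_all add: strict_sorted_iff del: upt_Suc\<close>)
  then show ?thesis using assms(4) by (simp add: atLeastLessThanSuc_atLeastAtMost del: upt_Suc)
qed

text \<open>
  The size of \<open>L\<close> tells a bracket from a \<open>\<xi>\<^sub>q\<close> and determines
  \<open>q\<close>, and a strictly increasing enumeration is determined by its image.
\<close>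

lemma squarefree_generator_unique:
  assumes "squarefree_generator p L f" "squarefree_generator p' L f'"
  shows "p = p'"
proof -
  have card_xi: "card (\<kappa> ` {1..2 * q}) = 2 * q" if "strict_mono_on {1..2 * q} \<kappa>" for q and \<kappa> :: "nat \<Rightarrow> nat"
    using card_image[OF strict_mono_on_imp_inj_on[OF that]] by simp
  consider (pair) l r where "l < r" "L = {l, r}" "p = bracket (generic_matrix l) (generic_matrix r)"
    | (xi) q \<kappa> where "2 \<le> q" "strict_mono_on {1..2 * q} \<kappa>" "L = \<kappa> ` {1..2 * q}"
        "p = xi q (\<lambda>s. generic_matrix (\<kappa> s))"
    using assms(1) unfolding squarefree_generator_def by blast
  then show ?thesis
  proof cases
    case pair
    from assms(2) show ?thesis unfolding squarefree_generator_def
    proof (elim disjE exE conjE)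
      fix l' r' :: nat assume "l' < r'" "L = {l', r'}" "p' = bracket (generic_matrix l') (generic_matrix r')"
      moreover from this pair have "l' = l" "r' = r" by (auto simp: doubleton_eq_iff)
      ultimately show ?thesis using pair by simp
    next
      fix q :: nat and \<kappa> :: "nat \<Rightarrow> nat" assume x: "2 \<le> q" "strict_mono_on {1..2 * q} \<kappa>" "L = \<kappa> ` {1..2 * q}"
      have "card L = 2 * q" using card_xi[OF x(2)] x(3) by simp
      moreover have "card L = 2" using pair by simp
      ultimately show ?thesis using x(1) by simp
    qed
  next
    case xi
    from assms(2) show ?thesis unfolding squarefree_generator_def
    proof (elim disjE exE conjE)
      fix l' r' :: nat assume "l' < r'" "L = {l', r'}"
      then have "card L = 2" by simp
      moreover have "card L = 2 * q" using card_xi[OF xi(2)] xi(3) by simp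
      ultimately show ?thesis using xi(1) by simp
    next
      fix q' :: nat and \<kappa>' :: "nat \<Rightarrow> nat" assume *: "strict_mono_on {1..2 * q'} \<kappa>'" "L = \<kappa>' ` {1..2 * q'}"
        "p' = xi q' (\<lambda>s. generic_matrix (\<kappa>' s))"
      have "q' = q" using card_xi[OF *(1)] card_xi[OF xi(2)] *(2) xi(3) by simp
      then have "\<kappa> s = \<kappa>' s" if "s \<in> {1..2 * q}" for s
        using strict_mono_on_image_eq[OF xi(2) _ _ that] * xi(3) by simp
      then show ?thesis unfolding xi(4) *(3) \<open>q' = q\<close> by (intro xi_cong) simp
    qed
  qed
qed

lemma xi_fun_eq_0:
  fixes X :: "'a::comm_ring_1 point"
  assumes "s \<in> {1..2 * q}" "mtx X (\<kappa> s) = 0"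
  shows "xi_fun q \<kappa> X = 0"
proof -
  define c where "c s' = (if s' = s then 0 else 1 :: 'a)" for s'
  have "mat_of (mtx X (\<kappa> s')) = c s' \<cdot>\<^sub>m mat_of (mtx X (\<kappa> s'))" for s'
    by (rule eq_matI) (auto simp: c_def assms(2) mat_of_def entry_def zero_m2_def)
  then have "xi_fun q \<kappa> X = (\<Prod>s' = 1..2 * q. c s') * xi_fun q \<kappa> X"
    unfolding xi_fun_def by (subst xi_smult[symmetric]) simp_all
  also have "(\<Prod>s' = 1..2 * q. c s') = 0"
    using assms(1) by (intro prod_zero) (auto simp: c_def)
  finally show ?thesis by simp
qed

lemma squarefree_generator_eq_0:
  fixes f :: "'a::comm_ring_1 point \<Rightarrow> 'a"
  assumes "squarefree_generator p L f" and "\<And>k. k \<noteq> k0 \<Longrightarrow> mtx X k = 0"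
  shows "f X = 0"
  using assms(1) unfolding squarefree_generator_def
proof (elim disjE exE conjE)
  fix l r :: nat assume lr: "l < r" "f = trace_word [l, r]"
  have z: "adj2 0 = (0 :: 'a m2)" "tr2 0 = (0 :: 'a)" by (simp_all add: adj2_def tr2_def zero_m2_def)
  show ?thesis
  proof (cases "l = k0")
    case True
    then have "mtx X r = 0" using lr by (intro assms(2)) simp
    then show ?thesis by (simp add: lr trace_word_def z)
  next
    case False
    then show ?thesis by (simp add: lr trace_word_def z assms(2))
  qed
next
  fix q :: nat and \<kappa> :: "nat \<Rightarrow> nat" assume *: "2 \<le> q" "strict_mono_on {1..2 * q} \<kappa>" "f = xi_fun q \<kappa>"
  have "\<kappa> 1 < \<kappa> 2" using *(1) by (intro strict_mono_onD[OF *(2)]) auto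
  then have "\<kappa> 1 \<noteq> k0 \<or> \<kappa> 2 \<noteq> k0" by auto
  moreover have "f X = 0" if "s \<in> {1..2 * q}" "\<kappa> s \<noteq> k0" for s
    unfolding *(3) using that(1) assms(2)[OF that(2)] by (rule xi_fun_eq_0)
  moreover have "1 \<in> {1..2 * q}" "2 \<in> {1..2 * q}" using *(1) by auto
  ultimately show ?thesis by blast
qed

lemma poly_fun_squarefree_generator:
  assumes "squarefree_generator p L f"
  shows "poly_fun p X = f X"
  using assms by (auto simp: squarefree_generator_def poly_fun_bracket poly_fun_xi)

text \<open>
  For a determinant it suffices to compare the values at the point where the \<open>k\<close>-th matrix is
  the identity and all others are zero with those at the zero point: all other generators vanish at both.
  For the remaining generators the specialisation separates \<open>s\<close> from the subalgebra generated
  by the others.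
\<close>

theorem (in infinite_field) generators_irredundant:
  assumes char2: "(1 :: 'a) + 1 = 0" and s: "s \<in> generators m"
  shows "(s :: 'a xpoly) \<notin> is_subalgebra hull (generators m - {s})"
  using s
proof (cases rule: generators_cases)
  case (det k)
  define X :: "'a point" where "X = (\<lambda>(i, j, l). if l = k \<and> i = j then 1 else 0)"
  define B where "B = {p. poly_fun p X = poly_fun p (\<lambda>v. 0)}"
  have "is_subalgebra B"
    by (simp add: is_subalgebra_def B_def poly_fun_add poly_fun_mult poly_fun_Const)
  moreover have "generators m - {s} \<subseteq> B"
  proof
    fix t assume "t \<in> generators m - {s}"
    then have t: "t \<in> generators m" "t \<noteq> s" by auto
    have z: "mtx X l = 0" if "l \<noteq> k" for l using that by (simp add: mtx_def X_def zero_m2_def)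
    have z0: "mtx (\<lambda>v. 0) l = (0 :: 'a m2)" for l by (simp add: mtx_def zero_m2_def)
    show "t \<in> B"
      using t(1)
    proof (cases rule: generators_cases)
      case (det l)
      then have "l \<noteq> k" using t(2) \<open>s = det (generic_matrix k)\<close> by auto
      then show ?thesis by (simp add: B_def det poly_fun_det z z0)
    next
      case (squarefree L f)
      have "f X = 0" "f (\<lambda>v. 0) = 0"
        using squarefree_generator_eq_0[OF squarefree, of k] z z0 by auto
      then show ?thesis by (simp add: B_def poly_fun_squarefree_generator[OF squarefree])
    qed
  qed
  ultimately have "is_subalgebra hull (generators m - {s}) \<subseteq> B" by (intro hull_minimal)
  moreover have "s \<notin> B"
    by (simp add: B_def det poly_fun_det det2_def mtx_def X_def)
  ultimately show ?thesis by blast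
next
  case (squarefree K f)
  define k0 where "k0 = Min K"
  have K: "finite K" "k0 \<in> K" using squarefree_generator_finite[OF squarefree] by (auto simp: k0_def)
  let ?B = "decomposables K k0 :: 'a xpoly set"
  have lookup: "Poly_Mapping.lookup (\<Sum>k\<in>L. Poly_Mapping.single k (1 :: nat)) l = (if l \<in> L then 1 else 0)"
    if "finite L" for L :: "nat set" and l
    using that by (simp add: lookup_sum lookup_single when_def)
  have "generators m - {s} \<subseteq> ?B"
  proof
    fix t assume "t \<in> generators m - {s}"
    then have t: "t \<in> generators m" "t \<noteq> s" by auto
    show "t \<in> ?B"
      using t(1)
    proof (cases rule: generators_cases)
      case (det l)
      show ?thesis
      proof (cases "l \<in> K \<and> l \<noteq> k0")
        case True
        then have "specialise K k0 t = Poly_Mapping.single (Poly_Mapping.single l 2) (det2 (mtx (special_pt k0) l))"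
          by (simp add: det specialise_det param_def Var_def Const_def power2_eq_square mult_single numeral_2_eq_2 flip: single_add)
        then show ?thesis
          using True by (auto simp: decomposables_def decomposable_exponent_def lookup_single when_def)
      next
        case False
        then have "param K l = (0 :: (nat, 'a) mpoly) \<or> det2 (mtx (special_pt k0) l) = (0 :: 'a)"
          by (auto simp: param_def mtx_special_pt det2_def)
        then have "specialise K k0 t = 0" by (auto simp: det specialise_det Const_def)
        then show ?thesis by (simp add: decomposables_def)
      qed
    next
      case sq: (squarefree L g)
      have L: "finite L" "L \<noteq> {}" using squarefree_generator_finite[OF sq] by auto
      have r: "specialise K k0 t = (\<Prod>k\<in>L. param K k) * Const (g (special_pt k0))"
        by (rule squarefree_generator_specialise[OF sq])
      show ?thesis
      proof (cases "L \<subseteq> K \<and> k0 \<in> L")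
        case True
        have "L \<noteq> K" using squarefree_generator_unique[OF sq] squarefree t(2) by blast
        then obtain k where k: "k \<in> K" "k \<notin> L" using True by blast
        have "Poly_Mapping.keys (specialise K k0 t) \<subseteq> {\<Sum>k\<in>L. Poly_Mapping.single k 1}"
          using True by (simp add: r prod_param[OF L(1)] Const_def mult_single)
        moreover have "decomposable_exponent K k0 (\<Sum>k\<in>L. Poly_Mapping.single k 1)"
          using True k lookup[OF L(1)] by (auto simp: decomposable_exponent_def)
        ultimately show ?thesis unfolding decomposables_def by blast
      next
        case False
        have "specialise K k0 t = 0"
        proof (cases "L \<subseteq> K")
          case True
          have "g (special_pt k0) = 0"
            by (rule graded_alg_special_pt_0[OF char2 squarefree_generator_graded_alg[OF sq]])
               (use L False True in \<open>auto simp: count_mset_set' mset_set_empty_iff\<close>)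
          then show ?thesis by (simp add: r Const_def)
        qed (simp add: r prod_param[OF L(1)])
        then show ?thesis by (simp add: decomposables_def)
      qed
    qed
  qed
  then have "is_subalgebra hull (generators m - {s}) \<subseteq> ?B"
    by (rule hull_minimal) (rule is_subalgebra_decomposables)
  moreover have "s \<notin> ?B"
  proof -
    have "specialise K k0 s = Poly_Mapping.single (\<Sum>k\<in>K. Poly_Mapping.single k 1) 1"
      using squarefree_generator_special_pt[OF char2 squarefree]
      by (simp add: squarefree_generator_specialise[OF squarefree] prod_param[OF K(1)] Const_def k0_def)
    moreover have "\<not> decomposable_exponent K k0 (\<Sum>k\<in>K. Poly_Mapping.single k 1)"
      using lookup[OF K(1)] K(2) by (auto simp: decomposable_exponent_def)
    ultimately show ?thesis by (simp add: decomposables_def)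
  qed
  ultimately show ?thesis by blast
qed

theorem theorem2p1:
  fixes m :: nat
  assumes "infinite (UNIV :: 'a::field set)"
    and "CHAR('a) = 2"
    and "m \<ge> 1"
  shows "minimal_homogeneous_generating_system
           (invariants m :: 'a xpoly set) (generators m)"
proof -
  interpret infinite_field "TYPE('a)" by unfold_locales (rule assms(1))
  have char2: "(1 :: 'a) + 1 = 0"
    using of_nat_CHAR[where 'a = 'a] assms(2) by simp
  have gen: "is_subalgebra hull generators m = (invariants m :: 'a xpoly set)"
    by (rule generators_generate[OF char2])
  have "is_subalgebra hull T \<noteq> (invariants m :: 'a xpoly set)" if T: "T \<subset> generators m" for T
  proof
    assume eq: "is_subalgebra hull T = (invariants m :: 'a xpoly set)"
    obtain s where s: "s \<in> generators m" "s \<notin> T" using T by blast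
    have "s \<in> is_subalgebra hull T" unfolding eq gen[symmetric] using s(1) by (rule hull_inc)
    moreover have "is_subalgebra hull T \<subseteq> is_subalgebra hull (generators m - {s})"
      by (rule hull_mono) (use T s in blast)
    ultimately show False using generators_irredundant[OF char2 s(1)] by blast
  qed
  moreover have "homogeneous p" if "p \<in> generators m" for p :: "'a xpoly"
    using generators_graded[OF that] graded_part_homogeneous by blast
  ultimately show ?thesis unfolding minimal_homogeneous_generating_system_def using gen by blast
qed

end
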